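(* Let $g\geqslant1$ and let $f(x)=1+\sum_{i=1}^{2g+1}c_ix^i\in\mathbb{C}[x]$ be square-free with $c_{2g+1}\neq0$. By contraction of the S-fraction $$F_0=\frac{y+\mathcal{P}_0(x)}{\mathcal{Q}_0(x)}=1-\cfrac{w_1x}{1-\cfrac{w_2x}{1-\cfrac{w_3x}{1-\cdots}}}\;,$$ a generic orbit of the Volterra map $\mathcal{V}_g$ corresponding to the odd spectral curve $\Gamma_f:\ y^2=f(x)$ of genus $g$ is transformed into an orbit of the J-fraction map $\mathcal{J}_g$ with an even spectral curve $\mathcal{C}:\ Y^2=\hat{\mathrm{F}}(X)$, $\hat{\mathrm{F}}(X)=X^{2g+2}+\sum_{j=2}^{2g+2}\hat c_jX^{2g+2-j}$. For coefficients $\hat c_j$ given suitably in terms of the $c_i$ there is a birational equivalence between $\Gamma_f$ and $\mathcal{C}$ given by $$X=x^{-1}+\frac{c_1}{2(g+1)},\qquad Y=\frac{y}{x^{g+1}}.$$ Moreover, the translation on $\mathrm{Jac}(\bar{\mathcal{C}})$ associated with a single iteration of $\mathcal{J}_g$ corresponds, under the induced isomorphism of Jacobians, to twice the translation on $\mathrm{Jac}(\bar\Gamma_f)$ associated with each iteration of $\mathcal{V}_g$. In fact, each generic orbit of $\mathcal{V}_g$ is related in this way to two different orbits of $\mathcal{J}_g$ (obtained by starting the contraction from $F_0$, respectively from $F_1$).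
   Context: Volterra map. $M_g$ is the space of triplets $\mathcal{P}=1+\sum_{i=1}^gp_ix^i$, $\mathcal{Q}=2+\sum_{i=1}^gq_ix^i$, $\mathcal{R}=\sum_{i=1}^{g+1}r_ix^i$ over $\mathbb{C}$; $\mathcal{V}_g(\mathcal{P},\mathcal{Q},\mathcal{R})=\big(\mathcal{Q}-\mathcal{P},\frac{2\mathcal{P}-\mathcal{Q}+\mathcal{R}}{-wx},-wx\mathcal{Q}\big)$ with $w=-\frac12(2p_1-q_1+r_1)$. It preserves $\mathcal{P}^2+\mathcal{Q}\mathcal{R}$, and the orbit has spectral curve $\Gamma_f$ if $\mathcal{P}^2+\mathcal{Q}\mathcal{R}=f$. For an orbit $(\mathcal{P}_n,\mathcal{Q}_n,\mathcal{R}_n)_{n\in\mathbb{Z}}$ put $w_n=-\frac12r_{n,1}$ and $F_n=\frac{y+\mathcal{P}_n(x)}{\mathcal{Q}_n(x)}$, so that $F_n=1-w_{n+1}x/F_{n+1}$. Generic: all iterates exist and all $w_n\ne0$. On $\mathrm{Jac}(\bar\Gamma_f)$ ($\bar\Gamma_f$ is the completion of $\Gamma_f$ by one point $\infty$; a triplet corresponds to the class $[\sum_{i=1}^g(x_i,\mathcal{P}(x_i))-g\infty]$, $x_i$ the roots of $\mathcal{Q}$), $\mathcal{V}_g$ is the translation by $[(0,-1)-\infty]$. Contraction. Combining successive pairs of lines: $X-\cfrac{w_1}{1-\cfrac{w_2}{X-\cfrac{w_3}{1-\cdots}}}=X+b_1-\cfrac{a_2}{X+b_2-\cfrac{a_3}{X+b_3-\cdots}}$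 with $b_1=-w_1$, $a_{j+1}=w_{2j-1}w_{2j}$, $b_{j+1}=-w_{2j}-w_{2j+1}$, $j\geqslant1$; here it is applied (up to the shift of spectral parameter and an additive constant) to $x^{-1}F_0-w_0$ or to $x^{-1}F_1-w_1$. The resulting J-fraction variables are $d_{j+1}=w_{2j-1}w_{2j}$, $v_{j+1}=-w_{2j}-w_{2j+1}-\frac{c_1}{2(g+1)}$ ($j\in\mathbb{Z}$) when starting from $F_0$, and $d_{j+1}=w_{2j}w_{2j+1}$, $v_{j+1}=-w_{2j+1}-w_{2j+2}-\frac{c_1}{2(g+1)}$ when starting from $F_1$. J-fraction map. Let $\mathcal{C}:Y^2=\hat{\mathrm{F}}(X)=A(X)^2+4R(X)$, with $A$ monic of degree $g+1$ without $X^g$ term and $R\neq0$ of degree at most $g$; $\bar{\mathcal{C}}$ has two points at infinity, $\infty_1$ (where $Y\sim X^{g+1}$) and $\infty_2$ (where $Y\sim-X^{g+1}$). An orbit of $\mathcal{J}_g$ with spectral curve $\mathcal{C}$ is given by functions $Y_n=\frac{Y+P_n(X)}{Q_n(X)}$ on $\mathcal{C}$, $n\in\mathbb{Z}$, with polynomials $P_n=A(X)+2d_nX^{g-1}+\mathcal{O}(X^{g-2})$, $Q_n=u_n(X^g-v_nX^{g-1}+\mathcal{O}(X^{g-2}))$, $u_n\ne0$, $P_n^2+Q_nQ_{n-1}=\hat{\mathrm{F}}$, such that $Y_n=\alpha_n+1/Y_{n+1}$ with $\alpha_n=2(X+v_n)/u_n$ the polynomial part of the expansion of $Y_n$ at $\infty_1$;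 then $u_nu_{n-1}=-4d_n\ne0$. The prefactors $u_n$ are disregarded: $\mathcal{J}_g$ is the resulting map $n\to n+1$ on the remaining coefficients of $P_n,Q_n$ (equivalently, a system of recurrences for $d_n,v_n$). On each generic fiber, an affine part of $\mathrm{Jac}(\bar{\mathcal{C}})$, $\mathcal{J}_g$ is the translation by $[\infty_2-\infty_1]$. *)

theory Defs
  imports
    "HOL-Algebra.Free_Abelian_Groups"
    "HOL-Analysis.Analysis"
    "HOL-Computational_Algebra.Computational_Algebra"
begin

section \<open>Hyperelliptic curves and their completions\<close>

definition affine_curve :: "complex poly \<Rightarrow> (complex \<times> complex) set" where
  "affine_curve f = {(x, y). y\<^sup>2 = poly f x}"

text \<open>
  The smooth completion of \<open>y\<^sup>2 = f(x)\<close>, for \<open>f\<close> square-free of degree \<open>2g+1\<close> or \<open>2g+2\<close>, is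
  obtained by gluing in the chart with coordinates \<open>z = 1/x\<close>, \<open>s = y/x^(g+1)\<close>, where the curve
  reads \<open>s\<^sup>2 = z^(2g+2) f(1/z)\<close>.  The point \<open>Inf s\<close> has coordinates \<open>(0,s)\<close> in this chart.
  If \<open>deg f = 2g+1\<close> the only point at infinity is \<open>Inf 0\<close>; if \<open>f\<close> is monic of degree \<open>2g+2\<close>
  there are two, namely \<open>Inf 1\<close> (where \<open>y ~ x^(g+1)\<close>, called \<open>\<infinity>\<^sub>1\<close>) and \<open>Inf (-1)\<close>
  (where \<open>y ~ -x^(g+1)\<close>, called \<open>\<infinity>\<^sub>2\<close>).
\<close>

datatype cpoint = Aff complex complex | Inf complex

definition completed_curve :: "nat \<Rightarrow> complex poly \<Rightarrow> cpoint set" where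
  "completed_curve g f =
     {Aff x y | x y. (x, y) \<in> affine_curve f} \<union> {Inf s | s. s\<^sup>2 = coeff f (2 * g + 2)}"

text \<open>Punctured neighbourhoods of a point of the completion, as a filter on the affine curve.\<close>

primrec point_filter :: "nat \<Rightarrow> complex poly \<Rightarrow> cpoint \<Rightarrow> (complex \<times> complex) filter" where
  "point_filter g f (Aff a b) = at (a, b) within affine_curve f"
| "point_filter g f (Inf s) =
     inf (filtercomap (\<lambda>(x, y). (1 / x, y / x ^ (g + 1))) (at (0, s)))
         (principal (affine_curve f))"

text \<open>
  A local parameter at a point: in either chart, the first coordinate (suitably translated),
  except at the Weierstrass points, where the second coordinate vanishes and is taken instead.
\<close>

primrec local_param :: "nat \<Rightarrow> cpoint \<Rightarrow> complex \<times> complex \<Rightarrow> complex" where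
  "local_param g (Aff a b) = (\<lambda>(x, y). if b = 0 then y else x - a)"
| "local_param g (Inf s) = (\<lambda>(x, y). if s = 0 then y / x ^ (g + 1) else 1 / x)"

definition has_order ::
    "nat \<Rightarrow> complex poly \<Rightarrow> (complex \<times> complex \<Rightarrow> complex) \<Rightarrow> cpoint \<Rightarrow> int \<Rightarrow> bool" where
  "has_order g f h p n \<longleftrightarrow>
     (\<exists>l. l \<noteq> 0 \<and> ((\<lambda>q. h q / local_param g p q powi n) \<longlongrightarrow> l) (point_filter g f p))"

text \<open>Every rational function on \<open>y\<^sup>2 = f(x)\<close> has the form \<open>(A(x) + B(x) y) / C(x)\<close>.\<close>

definition ratfun ::
    "complex poly \<Rightarrow> complex poly \<Rightarrow> complex poly \<Rightarrow> complex \<times> complex \<Rightarrow> complex" where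
  "ratfun A B C = (\<lambda>(x, y). (poly A x + poly B x * y) / poly C x)"

definition rational_on :: "(complex \<times> complex) set \<Rightarrow> (complex \<times> complex \<Rightarrow> complex) \<Rightarrow> bool" where
  "rational_on U h \<longleftrightarrow>
     (\<exists>A B C. \<forall>p\<in>U. poly C (fst p) \<noteq> 0 \<and> h p = ratfun A B C p)"

text \<open>
  The non-empty Zariski-open subsets of an irreducible affine curve are its cofinite subsets.
\<close>

definition birational_equivalence ::
    "complex poly \<Rightarrow> complex poly \<Rightarrow> (complex \<times> complex \<Rightarrow> complex \<times> complex) \<Rightarrow> bool" where
  "birational_equivalence f F \<phi> \<longleftrightarrow>
     (\<exists>\<theta> U V. U \<subseteq> affine_curve f \<and> finite (affine_curve f - U) \<and>
        V \<subseteq> affine_curve F \<and> finite (affine_curve F - V) \<and>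
        rational_on U (fst \<circ> \<phi>) \<and> rational_on U (snd \<circ> \<phi>) \<and>
        rational_on V (fst \<circ> \<theta>) \<and> rational_on V (snd \<circ> \<theta>) \<and>
        \<phi> ` U = V \<and> \<theta> ` V = U \<and> (\<forall>p\<in>U. \<theta> (\<phi> p) = p) \<and> (\<forall>q\<in>V. \<phi> (\<theta> q) = q))"

text \<open>
  The isomorphism of smooth completions determined by a birational map \<open>\<phi>\<close> is its continuous
  extension to all points of the completion.
\<close>

definition extends_to_completion ::
    "nat \<Rightarrow> complex poly \<Rightarrow> complex poly \<Rightarrow> (complex \<times> complex \<Rightarrow> complex \<times> complex) \<Rightarrow>
      (cpoint \<Rightarrow> cpoint) \<Rightarrow> bool" where
  "extends_to_completion g f F \<phi> \<Phi> \<longleftrightarrow>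
     bij_betw \<Phi> (completed_curve g f) (completed_curve g F) \<and>
     (\<forall>p\<in>completed_curve g f. filterlim \<phi> (point_filter g F (\<Phi> p)) (point_filter g f p))"


section \<open>Jacobians\<close>

text \<open>
  The Jacobian is the group of divisors of degree zero modulo divisors of rational functions.
\<close>

definition div0_group :: "nat \<Rightarrow> complex poly \<Rightarrow> (cpoint \<Rightarrow>\<^sub>0 int) monoid" where
  "div0_group g f = (free_Abelian_group (completed_curve g f))
     \<lparr>carrier := {D \<in> carrier (free_Abelian_group (completed_curve g f)).
        (\<Sum>p\<in>Poly_Mapping.keys D. Poly_Mapping.lookup D p) = 0}\<rparr>"

definition principal_divisors :: "nat \<Rightarrow> complex poly \<Rightarrow> (cpoint \<Rightarrow>\<^sub>0 int) set" where
  "principal_divisors g f = {D \<in> carrier (div0_group g f).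
     \<exists>A B C. C \<noteq> 0 \<and> (A \<noteq> 0 \<or> B \<noteq> 0) \<and>
       (\<forall>p\<in>completed_curve g f. has_order g f (ratfun A B C) p (Poly_Mapping.lookup D p))}"

definition Jac :: "nat \<Rightarrow> complex poly \<Rightarrow> (cpoint \<Rightarrow>\<^sub>0 int) set monoid" where
  "Jac g f = div0_group g f Mod principal_divisors g f"

definition jac_class :: "nat \<Rightarrow> complex poly \<Rightarrow> (cpoint \<Rightarrow>\<^sub>0 int) \<Rightarrow> (cpoint \<Rightarrow>\<^sub>0 int) set" where
  "jac_class g f D = principal_divisors g f #>\<^bsub>div0_group g f\<^esub> D"

definition push_divisor :: "(cpoint \<Rightarrow> cpoint) \<Rightarrow> (cpoint \<Rightarrow>\<^sub>0 int) \<Rightarrow> (cpoint \<Rightarrow>\<^sub>0 int)" where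
  "push_divisor \<Phi> D = frag_extend (\<lambda>p. frag_of (\<Phi> p)) D"

definition translation :: "('a, 'b) monoid_scheme \<Rightarrow> 'a \<Rightarrow> 'a \<Rightarrow> 'a" where
  "translation G \<tau> u = u \<otimes>\<^bsub>G\<^esub> \<tau>"

text \<open>\<open>\<Sum>\<^sub>i (x\<^sub>i, P(x\<^sub>i))\<close>, where \<open>x\<^sub>i\<close> runs over the roots of \<open>Q\<close> with multiplicity.\<close>

definition root_divisor :: "complex poly \<Rightarrow> complex poly \<Rightarrow> (cpoint \<Rightarrow>\<^sub>0 int)" where
  "root_divisor P Q =
     (\<Sum>a | poly Q a = 0. frag_cmul (int (Polynomial.order a Q)) (frag_of (Aff a (poly P a))))"


section \<open>The Volterra map\<close>

type_synonym triplet = "complex poly \<times> complex poly \<times> complex poly"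

definition volterra_space :: "nat \<Rightarrow> triplet set" where
  "volterra_space g = {(P, Q, R).
     degree P \<le> g \<and> coeff P 0 = 1 \<and> degree Q \<le> g \<and> coeff Q 0 = 2 \<and>
     degree R \<le> g + 1 \<and> coeff R 0 = 0}"

fun volterra_w :: "triplet \<Rightarrow> complex" where
  "volterra_w (P, Q, R) = - (2 * coeff P 1 - coeff Q 1 + coeff R 1) / 2"

text \<open>
  The quotient by \<open>-wx\<close> is exact on the phase space.  The map is only defined where \<open>w \<noteq> 0\<close>; this
  condition is imposed on orbits.
\<close>

fun volterra_map :: "triplet \<Rightarrow> triplet" where
  "volterra_map (P, Q, R) =
     (let w = volterra_w (P, Q, R)
      in (Q - P, (smult 2 P - Q + R) div [:0, - w:], [:0, - w:] * Q))"

definition tP :: "(int \<Rightarrow> triplet) \<Rightarrow> int \<Rightarrow> complex poly" where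
  "tP T n = fst (T n)"

definition tQ :: "(int \<Rightarrow> triplet) \<Rightarrow> int \<Rightarrow> complex poly" where
  "tQ T n = fst (snd (T n))"

definition tR :: "(int \<Rightarrow> triplet) \<Rightarrow> int \<Rightarrow> complex poly" where
  "tR T n = snd (snd (T n))"

definition wn :: "(int \<Rightarrow> triplet) \<Rightarrow> int \<Rightarrow> complex" where
  "wn T n = - coeff (tR T n) 1 / 2"

definition generic_volterra_orbit :: "nat \<Rightarrow> complex poly \<Rightarrow> (int \<Rightarrow> triplet) \<Rightarrow> bool" where
  "generic_volterra_orbit g f T \<longleftrightarrow>
     (\<forall>n. T n \<in> volterra_space g \<and> volterra_w (T n) \<noteq> 0 \<and> T (n + 1) = volterra_map (T n)) \<and>
     (\<forall>n. wn T n \<noteq> 0) \<and>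
     (\<forall>n. (tP T n)\<^sup>2 + tQ T n * tR T n = f)"

definition Fn :: "(int \<Rightarrow> triplet) \<Rightarrow> int \<Rightarrow> complex \<times> complex \<Rightarrow> complex" where
  "Fn T n = (\<lambda>(x, y). (y + poly (tP T n) x) / poly (tQ T n) x)"

definition s_fraction :: "complex poly \<Rightarrow> (int \<Rightarrow> triplet) \<Rightarrow> bool" where
  "s_fraction f T \<longleftrightarrow>
     (\<forall>n. \<forall>(x, y)\<in>affine_curve f.
        poly (tQ T n) x \<noteq> 0 \<and> poly (tQ T (n + 1)) x \<noteq> 0 \<and> Fn T (n + 1) (x, y) \<noteq> 0 \<longrightarrow>
        Fn T n (x, y) = 1 - wn T (n + 1) * x / Fn T (n + 1) (x, y))"

definition volterra_class :: "nat \<Rightarrow> complex poly \<Rightarrow> triplet \<Rightarrow> (cpoint \<Rightarrow>\<^sub>0 int) set" where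
  "volterra_class g f t = (case t of (P, Q, R) \<Rightarrow>
     jac_class g f (root_divisor P Q - frag_cmul (int g) (frag_of (Inf 0))))"

definition volterra_shift :: "nat \<Rightarrow> complex poly \<Rightarrow> (cpoint \<Rightarrow>\<^sub>0 int) set" where
  "volterra_shift g f = jac_class g f (frag_of (Aff 0 (- 1)) - frag_of (Inf 0))"


section \<open>The J-fraction map\<close>

text \<open>
  A state of the J-fraction map is a pair \<open>(P\<^sub>n, Q\<^sub>n / u\<^sub>n)\<close> with \<open>Q\<^sub>n / u\<^sub>n\<close> monic: the prefactors
  \<open>u\<^sub>n\<close> are not part of the state.
\<close>

type_synonym jstate = "complex poly \<times> complex poly"

definition jP :: "(int \<Rightarrow> jstate) \<Rightarrow> int \<Rightarrow> complex poly" where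
  "jP S n = fst (S n)"

definition jQ :: "(int \<Rightarrow> complex) \<Rightarrow> (int \<Rightarrow> jstate) \<Rightarrow> int \<Rightarrow> complex poly" where
  "jQ u S n = smult (u n) (snd (S n))"

text \<open>
  \<open>P\<^sub>n = A + 2 d\<^sub>n X^(g-1) + O(X^(g-2))\<close> and \<open>Q\<^sub>n = u\<^sub>n (X^g - v\<^sub>n X^(g-1) + O(X^(g-2)))\<close>.
\<close>

definition jd :: "nat \<Rightarrow> complex poly \<Rightarrow> (int \<Rightarrow> jstate) \<Rightarrow> int \<Rightarrow> complex" where
  "jd g A S n = (coeff (jP S n) (g - 1) - coeff A (g - 1)) / 2"

definition jv :: "nat \<Rightarrow> (int \<Rightarrow> jstate) \<Rightarrow> int \<Rightarrow> complex" where
  "jv g S n = - coeff (snd (S n)) (g - 1)"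

definition Yn :: "(int \<Rightarrow> complex) \<Rightarrow> (int \<Rightarrow> jstate) \<Rightarrow> int \<Rightarrow> complex \<times> complex \<Rightarrow> complex" where
  "Yn u S n = (\<lambda>(X, Y). (Y + poly (jP S n) X) / poly (jQ u S n) X)"

definition jalpha ::
    "nat \<Rightarrow> (int \<Rightarrow> complex) \<Rightarrow> (int \<Rightarrow> jstate) \<Rightarrow> int \<Rightarrow> complex \<Rightarrow> complex" where
  "jalpha g u S n X = 2 * (X + jv g S n) / u n"

definition jfrac_curve :: "nat \<Rightarrow> complex poly \<Rightarrow> complex poly \<Rightarrow> complex poly \<Rightarrow> bool" where
  "jfrac_curve g F A R \<longleftrightarrow>
     F = A\<^sup>2 + smult 4 R \<and>
     degree A = g + 1 \<and> lead_coeff A = 1 \<and> coeff A g = 0 \<and> R \<noteq> 0 \<and> degree R \<le> g"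

text \<open>
  The limit at \<open>Inf 1\<close> says that \<open>\<alpha>\<^sub>n\<close> is the polynomial part of the expansion of \<open>Y\<^sub>n\<close> at
  \<open>\<infinity>\<^sub>1\<close>.  The relations \<open>u\<^sub>n u\<^sub>n\<^sub>-\<^sub>1 = -4 d\<^sub>n \<noteq> 0\<close> are consequences of these conditions.
\<close>

definition jfrac_orbit ::
    "nat \<Rightarrow> complex poly \<Rightarrow> complex poly \<Rightarrow> (int \<Rightarrow> complex) \<Rightarrow> (int \<Rightarrow> jstate) \<Rightarrow> bool" where
  "jfrac_orbit g F A u S \<longleftrightarrow>
     (\<forall>n. u n \<noteq> 0 \<and>
        (\<forall>k\<ge>g. coeff (jP S n) k = coeff A k) \<and>
        degree (snd (S n)) = g \<and> lead_coeff (snd (S n)) = 1 \<and>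
        (jP S n)\<^sup>2 + jQ u S n * jQ u S (n - 1) = F \<and>
        ((\<lambda>(X, Y). Yn u S n (X, Y) - jalpha g u S n X) \<longlongrightarrow> 0) (point_filter g F (Inf 1)) \<and>
        (\<forall>(X, Y)\<in>affine_curve F.
           poly (jQ u S n) X \<noteq> 0 \<and> poly (jQ u S (n + 1)) X \<noteq> 0 \<and> Yn u S (n + 1) (X, Y) \<noteq> 0 \<longrightarrow>
           Yn u S n (X, Y) = jalpha g u S n X + 1 / Yn u S (n + 1) (X, Y)))"

text \<open>
  The degree-zero normalisation by \<open>g \<infinity>\<^sub>1\<close> is immaterial for translations.
\<close>

definition jfrac_class :: "nat \<Rightarrow> complex poly \<Rightarrow> jstate \<Rightarrow> (cpoint \<Rightarrow>\<^sub>0 int) set" where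
  "jfrac_class g F s = (case s of (P, q) \<Rightarrow>
     jac_class g F (root_divisor P q - frag_cmul (int g) (frag_of (Inf 1))))"

definition jfrac_shift :: "nat \<Rightarrow> complex poly \<Rightarrow> (cpoint \<Rightarrow>\<^sub>0 int) set" where
  "jfrac_shift g F = jac_class g F (frag_of (Inf (- 1)) - frag_of (Inf 1))"


section \<open>Contraction\<close>

text \<open>\<open>(x, y) \<mapsto> (X, Y)\<close> with \<open>X = 1/x + \<sigma>\<close>, \<open>Y = y / x^(g+1)\<close>.\<close>

definition curve_map :: "nat \<Rightarrow> complex \<Rightarrow> complex \<times> complex \<Rightarrow> complex \<times> complex" where
  "curve_map g \<sigma> = (\<lambda>(x, y). (1 / x + \<sigma>, y / x ^ (g + 1)))"

text \<open>
  The S-fraction of \<open>F\<^sub>e\<close> (with \<open>e = 0\<close> or \<open>e = 1\<close>) is contracted to the J-fraction orbit \<open>S\<close>.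
  Two successive lines of the S-fraction of \<open>G\<^sub>j = F\<^sub>2\<^sub>j\<^sub>+\<^sub>e / x - w\<^sub>2\<^sub>j\<^sub>+\<^sub>e\<close> combine to
  \<open>G\<^sub>j = X + v\<^sub>j\<^sub>+\<^sub>1 - d\<^sub>j\<^sub>+\<^sub>2 / G\<^sub>j\<^sub>+\<^sub>1\<close>, and \<open>Y\<^sub>j\<^sub>+\<^sub>1 = (2 / u\<^sub>j\<^sub>+\<^sub>1) G\<^sub>j\<close>.
\<close>

definition contracted_line ::
    "int \<Rightarrow> (int \<Rightarrow> triplet) \<Rightarrow> int \<Rightarrow> complex \<times> complex \<Rightarrow> complex" where
  "contracted_line e T j = (\<lambda>(x, y). Fn T (2 * j + e) (x, y) / x - wn T (2 * j + e))"

definition contraction ::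
    "nat \<Rightarrow> complex poly \<Rightarrow> complex poly \<Rightarrow> complex \<Rightarrow> int \<Rightarrow> (int \<Rightarrow> triplet) \<Rightarrow>
      (int \<Rightarrow> complex) \<Rightarrow> (int \<Rightarrow> jstate) \<Rightarrow> bool" where
  "contraction g f A \<sigma> e T u S \<longleftrightarrow>
     (\<forall>j. jd g A S (j + 1) = wn T (2 * j - 1 + e) * wn T (2 * j + e) \<and>
          jv g S (j + 1) = - wn T (2 * j + e) - wn T (2 * j + 1 + e) - \<sigma>) \<and>
     (\<forall>j. \<forall>(x, y)\<in>affine_curve f.
        x \<noteq> 0 \<and> poly (tQ T (2 * j + e)) x \<noteq> 0 \<longrightarrow>
        Yn u S (j + 1) (curve_map g \<sigma> (x, y)) = 2 / u (j + 1) * contracted_line e T j (x, y)) \<and>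
     (\<forall>j. \<forall>(x, y)\<in>affine_curve f.
        x \<noteq> 0 \<and> poly (tQ T (2 * j + e)) x \<noteq> 0 \<and> poly (tQ T (2 * (j + 1) + e)) x \<noteq> 0 \<and>
        contracted_line e T (j + 1) (x, y) \<noteq> 0 \<longrightarrow>
        contracted_line e T j (x, y) =
          (1 / x + \<sigma>) + jv g S (j + 1) - jd g A S (j + 2) / contracted_line e T (j + 1) (x, y))"

end

theory Submission
  imports Defs
begin

text \<open>
  In the coordinates \<open>z = 1/x\<close>, \<open>s = y/x^(g+1)\<close> the odd curve becomes the even one up to the shift
  of \<open>z\<close> by \<open>\<sigma>\<close>, which removes the subleading coefficient.  Both the birational map and the charts
  at infinity are Moebius transformations, so every local question reduces to affine points, where
  the order of \<open>y - P\<close> is read off from its norm \<open>f - P\<^sup>2\<close>.  With \<open>P = P\<^sub>n\<^sub>+\<^sub>1\<close>, the function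
  \<open>(y - P)/(x Q\<^sub>n)\<close>, respectively \<open>(Y - P)/Q\<^sub>n\<close>, gives the linear equivalence that turns one step of
  the map into a translation of the Jacobian.  The point \<open>\<infinity>\<close> goes to the Weierstrass point \<open>(\<sigma>,0)\<close>
  and \<open>(0,\<plusminus>1)\<close> to the two points at infinity; since \<open>div x = (0,1) + (0,-1) - 2\<infinity>\<close>, twice
  \<open>(0,-1) - \<infinity>\<close> is equivalent to \<open>(0,-1) - (0,1)\<close>, which goes to \<open>\<infinity>\<^sub>2 - \<infinity>\<^sub>1\<close>.
\<close>

section \<open>Polynomials\<close>

text \<open>Contraction is possible because the line \<open>F(m)/x - w(m)\<close> equals
  \<open>(y + p(m)) / (x Q(m))\<close> with \<open>p(m) = P(m) - w(m) x Q(m)\<close>, and these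
  \<open>p(m)\<close> satisfy two identities from which the intermediate triplet has disappeared:
  \<open>p(m)^2 - f = w(m) w(m-1) x^2 Q(m) Q(m-2)\<close> and
  \<open>p(m) + p(m+2) = Q(m) (1 - (w(m) + w(m+1)) x)\<close>. Written in \<open>X\<close> they are
  the norm relation and the recurrence of a J-fraction orbit, from which \<open>d\<close> and
  \<open>v\<close> can be read off. The prefactors \<open>u\<close> are any solution of
  \<open>u n u(n-1) = -4 d n\<close>. Orders are limits here, not valuations of a function field.
  Hence the group structure of principal divisors and their invariance under the curve map have to
  be obtained from the normal form \<open>(A + B y)/C\<close>. That the two orbits differ at equal
  indices rests on \<open>f\<close> being square-free. States with different indices can coincide,
  but then the two triplets have the same class, and an odd multiple of the Volterra shift
  vanishes.\<close>

lemma poly_eqI_cofinite: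
  fixes p q :: "complex poly"
  assumes "finite S" "\<And>x. x \<notin> S \<Longrightarrow> poly p x = poly q x"
  shows "p = q"
proof (rule ccontr)
  assume "p \<noteq> q"
  then have "finite {x. poly (p - q) x = 0}" by (intro poly_roots_finite) simp
  moreover have "- S \<subseteq> {x. poly (p - q) x = 0}" using assms(2) by auto
  ultimately have "finite (- S)" by (rule finite_subset[rotated])
  with assms(1) show False by (metis finite_compl infinite_UNIV_char_0)
qed

lemma squarefree_imp_order_le_1:
  fixes p :: "complex poly"
  assumes "squarefree p"
  shows "order a p \<le> 1"
proof (rule ccontr)
  assume "\<not> order a p \<le> 1"
  then have "[:- a, 1:] ^ 2 dvd p" by (simp add: order_divides)
  then have "is_unit [:- a, 1:]" using squarefreeD[OF assms] by blast
  then show False by (simp add: is_unit_pCons_iff)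
qed

text \<open>Over the complex numbers every nonzero non-unit has a root, so a square divisor that is
  not a unit contains the square of a linear factor.\<close>

lemma squarefreeI_order_le_1:
  fixes p :: "complex poly"
  assumes "p \<noteq> 0" "\<And>a. order a p \<le> 1"
  shows "squarefree p"
proof (rule squarefreeI)
  fix d assume d: "d\<^sup>2 dvd p"
  then have "d \<noteq> 0" using assms(1) by auto
  show "d dvd 1"
  proof (rule ccontr)
    assume "\<not> d dvd 1"
    then have "\<not> constant (poly d)"
      using \<open>d \<noteq> 0\<close> by (simp add: constant_degree is_unit_iff_degree)
    then obtain a where "poly d a = 0"
      using fundamental_theorem_of_algebra by blast
    then have "[:- a, 1:] ^ 2 dvd d\<^sup>2" by (simp add: poly_eq_0_iff_dvd dvd_power_same)
    then have "[:- a, 1:] ^ 2 dvd p" using d by (rule dvd_trans)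
    then show False using assms by (simp add: order_divides) (metis not_less_eq_eq numeral_2_eq_2 One_nat_def)
  qed
qed

lemma squarefree_simple_root:
  fixes f :: "complex poly"
  assumes "squarefree f" "poly f a = 0"
  obtains f1 where "f = [:- a, 1:] * f1" "poly f1 a \<noteq> 0"
proof -
  obtain f1 where f1: "f = [:- a, 1:] * f1"
    using assms(2) by (auto simp: poly_eq_0_iff_dvd)
  have "poly f1 a \<noteq> 0"
  proof
    assume "poly f1 a = 0"
    then have "[:- a, 1:] ^ 2 dvd f"
      unfolding f1 power2_eq_square by (intro mult_dvd_mono) (auto simp: poly_eq_0_iff_dvd)
    moreover have "f \<noteq> 0" using assms(1) by auto
    ultimately show False
      using squarefree_imp_order_le_1[OF assms(1), of a] by (simp add: order_divides)
  qed
  with f1 show ?thesis by (rule that)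
qed

text \<open>The polynomial \<open>x^N p(1/x)\<close>. \<open>reflect_poly\<close> reverses relative
  to the actual degree; the monomial pads up to \<open>N\<close>, because the odd curve is reversed
  with \<open>N = 2 g + 2\<close>, one more than its degree.\<close>

definition recip :: "nat \<Rightarrow> complex poly \<Rightarrow> complex poly" where
  "recip N p = monom 1 (N - degree p) * reflect_poly p"

lemma poly_recip:
  assumes "degree p \<le> N" "x \<noteq> 0"
  shows "poly (recip N p) x = x ^ N * poly p (1 / x)"
proof -
  have "x ^ N = x ^ (N - degree p) * x ^ degree p"
    using assms(1) by (simp flip: power_add)
  then show ?thesis
    using assms(2) by (simp add: recip_def poly_monom poly_reflect_poly_nz inverse_eq_divide)
qed

lemma coeff_recip:
  assumes "degree p \<le> N" "k \<le> N"
  shows "coeff (recip N p) k = coeff p (N - k)"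
  using assms by (auto simp: recip_def coeff_monom_mult coeff_reflect_poly coeff_eq_0
      intro!: arg_cong[where f="coeff p"])

lemma degree_recip_le:
  assumes "degree p \<le> N"
  shows "degree (recip N p) \<le> N"
proof -
  have "degree (recip N p) \<le> degree (monom (1::complex) (N - degree p)) + degree (reflect_poly p)"
    unfolding recip_def by (rule degree_mult_le)
  also have "\<dots> \<le> (N - degree p) + degree p"
    by (intro add_mono degree_monom_le degree_reflect_poly_le)
  finally show ?thesis using assms by simp
qed

lemma recip_eq_0_iff [simp]: "recip N p = 0 \<longleftrightarrow> p = 0"
  by (simp add: recip_def)

text \<open>A degree below \<open>N\<close> turns into a zero at the origin; this is how orders at
  infinity are read off.\<close>

lemma order_recip_0:
  assumes "p \<noteq> 0"
  shows "order 0 (recip N p) = N - degree p"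
proof -
  have "order 0 (reflect_poly p) = 0"
    using assms by (intro order_0I) simp
  then show ?thesis using assms unfolding recip_def by (subst order_mult) auto
qed

lemma recip_recip:
  assumes "degree p \<le> N"
  shows "recip N (recip N p) = p"
  using assms degree_recip_le[OF assms]
  by (intro poly_eqI_cofinite[of "{0}"]) (auto simp: poly_recip field_simps)

lemma recip_mult:
  assumes "degree p \<le> N" "degree q \<le> M"
  shows "recip (N + M) (p * q) = recip N p * recip M q"
proof -
  have "degree (p * q) \<le> N + M" using degree_mult_le[of p q] assms by simp
  then show ?thesis using assms
    by (intro poly_eqI_cofinite[of "{0}"]) (auto simp: poly_recip power_add)
qed

lemma recip_diff:
  assumes "degree p \<le> N" "degree q \<le> N"
  shows "recip N (p - q) = recip N p - recip N q"
  using assms degree_diff_le[OF assms]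
  by (intro poly_eqI_cofinite[of "{0}"]) (auto simp: poly_recip algebra_simps)

text \<open>At 0 the order is \<open>N - degree f\<close>, at most 1 by the degree bounds. Away from
  0 a double factor would reverse into a double factor of \<open>f\<close>.\<close>

lemma squarefree_recip:
  assumes sqf: "squarefree f" and deg: "N \<le> Suc (degree f)" "degree f \<le> N"
  shows "squarefree (recip N f)"
proof (rule squarefreeI_order_le_1)
  show nz: "recip N f \<noteq> 0" using sqf by auto
  fix a
  show "order a (recip N f) \<le> 1"
  proof (cases "a = 0")
    case True
    have "f \<noteq> 0" using sqf by auto
    then show ?thesis using True deg by (simp add: order_recip_0)
  next
    case False
    show ?thesis
    proof (rule ccontr)
      assume "\<not> ?thesis"
      then have "[:- a, 1:] ^ 2 dvd recip N f" by (simp add: order_divides)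
      then obtain k where k: "recip N f = [:- a, 1:]\<^sup>2 * k" by (auto simp: dvd_def)
      have kz: "k \<noteq> 0" using nz k by auto
      have "degree ([:- a, 1:]\<^sup>2 * k) = 2 + degree k"
        using kz by (subst degree_mult_eq) (auto simp: degree_power_eq)
      then have dk: "2 + degree k \<le> N"
        using degree_recip_le[OF deg(2)] k by simp
      \<comment> \<open>Reversing back with the degree split as \<open>2 + (N - 2)\<close>: the
        square is reversed on its own and becomes \<open>(1 - a x)^2\<close>, nonconstant since
        \<open>a\<close> is nonzero.\<close>
      have "f = recip (2 + (N - 2)) ([:- a, 1:]\<^sup>2 * k)"
        using recip_recip[OF deg(2)] k dk by (metis le_add_diff_inverse le_trans le_add1)
      also have "\<dots> = recip 2 ([:- a, 1:]\<^sup>2) * recip (N - 2) k"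
        using dk by (intro recip_mult) (auto simp: degree_power_eq)
      also have "recip 2 ([:- a, 1:]\<^sup>2) = (recip 1 [:- a, 1:])\<^sup>2"
        using recip_mult[of "[:- a, 1:]" 1 "[:- a, 1:]" 1]
        by (simp add: power2_eq_square numeral_2_eq_2)
      also have "recip 1 [:- a, 1:] = [:1, - a:]"
        by (intro poly_eqI_cofinite[of "{0}"]) (auto simp: poly_recip field_simps)
      finally have "[:1, - a:]\<^sup>2 dvd f" by auto
      then have "is_unit [:1, - a:]" using squarefreeD[OF sqf] by blast
      then show False using False by (simp add: is_unit_pCons_iff)
    qed
  qed
qed


section \<open>Orders of vanishing\<close>

text \<open>Filter and parameter are arbitrary, so that a change of chart acts by
  \<open>filtermap\<close> and by substitution in the parameter.\<close>

definition has_ord :: "'a filter \<Rightarrow> ('a \<Rightarrow> complex) \<Rightarrow> ('a \<Rightarrow> complex) \<Rightarrow> int \<Rightarrow> bool" where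
  "has_ord F \<pi> h n \<longleftrightarrow> (\<exists>l. l \<noteq> 0 \<and> ((\<lambda>q. h q / \<pi> q powi n) \<longlongrightarrow> l) F)"

lemma has_order_iff_has_ord:
  "has_order g f h p n \<longleftrightarrow> has_ord (point_filter g f p) (local_param g p) h n"
  by (simp add: has_order_def has_ord_def)

lemma has_ord_0I:
  assumes "(h \<longlongrightarrow> l) F" "l \<noteq> 0"
  shows "has_ord F \<pi> h 0"
  using assms by (auto simp: has_ord_def)

lemma has_ord_param:
  assumes "eventually (\<lambda>q. \<pi> q \<noteq> 0) F"
  shows "has_ord F \<pi> \<pi> 1"
  unfolding has_ord_def
  by (intro exI[of _ 1] conjI tendsto_eventually eventually_mono[OF assms]) auto

lemma has_ord_cong:
  assumes "eventually (\<lambda>q. h q = k q) F" "has_ord F \<pi> h n"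
  shows "has_ord F \<pi> k n"
proof -
  obtain l where l: "l \<noteq> 0" "((\<lambda>q. h q / \<pi> q powi n) \<longlongrightarrow> l) F"
    using assms(2) by (auto simp: has_ord_def)
  have "((\<lambda>q. k q / \<pi> q powi n) \<longlongrightarrow> l) F"
    by (rule Lim_transform_eventually[OF l(2)]) (use assms(1) in eventually_elim, simp)
  with l(1) show ?thesis by (auto simp: has_ord_def)
qed

lemma has_ord_eventually_nonzero:
  assumes "has_ord F \<pi> h n"
  shows "eventually (\<lambda>q. h q \<noteq> 0) F"
proof -
  obtain l where l: "l \<noteq> 0" "((\<lambda>q. h q / \<pi> q powi n) \<longlongrightarrow> l) F"
    using assms by (auto simp: has_ord_def)
  show ?thesis
    using tendsto_imp_eventually_ne[OF l(2,1)] by eventually_elim auto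
qed

lemma has_ord_mult:
  assumes "eventually (\<lambda>q. \<pi> q \<noteq> 0) F" "has_ord F \<pi> h m" "has_ord F \<pi> k n"
  shows "has_ord F \<pi> (\<lambda>q. h q * k q) (m + n)"
proof -
  obtain l l' where l: "l \<noteq> 0" "((\<lambda>q. h q / \<pi> q powi m) \<longlongrightarrow> l) F"
    and l': "l' \<noteq> 0" "((\<lambda>q. k q / \<pi> q powi n) \<longlongrightarrow> l') F"
    using assms(2,3) by (auto simp: has_ord_def)
  have "((\<lambda>q. h q * k q / \<pi> q powi (m + n)) \<longlongrightarrow> l * l') F"
    by (rule Lim_transform_eventually[OF tendsto_mult[OF l(2) l'(2)]])
      (use assms(1) in eventually_elim, simp add: power_int_add)
  with l(1) l'(1) show ?thesis
    unfolding has_ord_def by (intro exI[of _ "l * l'"]) simp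
qed

lemma has_ord_inverse:
  assumes "has_ord F \<pi> h m"
  shows "has_ord F \<pi> (\<lambda>q. inverse (h q)) (- m)"
proof -
  obtain l where l: "l \<noteq> 0" "((\<lambda>q. h q / \<pi> q powi m) \<longlongrightarrow> l) F"
    using assms by (auto simp: has_ord_def)
  have "((\<lambda>q. inverse (h q) / \<pi> q powi (- m)) \<longlongrightarrow> inverse l) F"
    using tendsto_inverse[OF l(2,1)] by (simp add: power_int_minus divide_inverse)
  with l(1) show ?thesis
    unfolding has_ord_def by (intro exI[of _ "inverse l"]) simp
qed

lemma has_ord_divide:
  assumes "eventually (\<lambda>q. \<pi> q \<noteq> 0) F" "has_ord F \<pi> h m" "has_ord F \<pi> k n"
  shows "has_ord F \<pi> (\<lambda>q. h q / k q) (m - n)"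
  using has_ord_mult[OF assms(1,2) has_ord_inverse[OF assms(3)]]
  by (simp add: divide_inverse)

lemma has_ord_power:
  assumes "eventually (\<lambda>q. \<pi> q \<noteq> 0) F" "has_ord F \<pi> h m"
  shows "has_ord F \<pi> (\<lambda>q. h q ^ k) (int k * m)"
proof (induction k)
  case 0
  show ?case by (simp add: has_ord_0I[OF tendsto_const])
next
  case (Suc k)
  show ?case using has_ord_mult[OF assms Suc] by (simp add: algebra_simps)
qed

text \<open>The quotient for \<open>h\<close> composed with \<open>m\<close> is the old quotient
  along \<open>m\<close>, times the \<open>n\<close>-th power of the ratio of the two parameters;
  both factors have nonzero limits.\<close>

lemma has_ord_transport:
  assumes m: "filterlim m F2 F1" and \<pi>: "has_ord F1 \<pi>1 (\<lambda>q. \<pi>2 (m q)) 1"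
    and nz: "eventually (\<lambda>q. \<pi>1 q \<noteq> 0) F1" and h: "has_ord F2 \<pi>2 h n"
  shows "has_ord F1 \<pi>1 (\<lambda>q. h (m q)) n"
proof -
  obtain l where l: "l \<noteq> 0" "((\<lambda>q. h q / \<pi>2 q powi n) \<longlongrightarrow> l) F2"
    using h by (auto simp: has_ord_def)
  obtain k where k: "k \<noteq> 0" "((\<lambda>q. \<pi>2 (m q) / \<pi>1 q) \<longlongrightarrow> k) F1"
    using \<pi> by (auto simp: has_ord_def)
  have "((\<lambda>q. h (m q) / \<pi>2 (m q) powi n * (\<pi>2 (m q) / \<pi>1 q) powi n) \<longlongrightarrow> l * k powi n) F1"
    using l(2) k by (intro tendsto_mult tendsto_power_int filterlim_compose[OF l(2) m]) auto
  then have "((\<lambda>q. h (m q) / \<pi>1 q powi n) \<longlongrightarrow> l * k powi n) F1"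
    by (rule Lim_transform_eventually)
      (use has_ord_eventually_nonzero[OF \<pi>] nz in eventually_elim, simp add: power_int_divide_distrib)
  with l(1) k(1) show ?thesis
    unfolding has_ord_def by (intro exI[of _ "l * k powi n"]) simp
qed


subsection \<open>Affine points\<close>

lemma eventually_on_curve:
  "eventually (\<lambda>p. p \<in> affine_curve f) (at (a, b) within affine_curve f)"
  by (simp add: eventually_at_filter)

lemma tendsto_fst_curve: "((\<lambda>p. fst p) \<longlongrightarrow> a) (at (a, b) within S)"
  using tendsto_fst[OF tendsto_ident_at, of "(a, b)" S] by simp

lemma tendsto_snd_curve: "((\<lambda>p. snd p) \<longlongrightarrow> b) (at (a, b) within S)"
  using tendsto_snd[OF tendsto_ident_at, of "(a, b)" S] by simp

lemma tendsto_poly_curve: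
  fixes C :: "complex poly"
  shows "((\<lambda>p. poly C (fst p)) \<longlongrightarrow> poly C a) (at (a, b) within S)"
  by (intro tendsto_poly tendsto_fst_curve)

text \<open>Over \<open>x = a\<close> lie only the points with \<open>y = b\<close> and
  \<open>y = - b\<close>. The former is the puncture, and the latter, if different, is not near
  \<open>(a, b)\<close>.\<close>

lemma eventually_x_neq:
  assumes "b\<^sup>2 = poly f a"
  shows "eventually (\<lambda>p. fst p \<noteq> a) (at (a, b) within affine_curve f)"
proof -
  have "eventually (\<lambda>p. snd p \<noteq> - b \<or> b = 0) (at (a, b) within affine_curve f)"
  proof (cases "b = 0")
    case False
    then have "b \<noteq> - b" by simp
    from tendsto_imp_eventually_ne[OF tendsto_snd_curve this] show ?thesis
      by (rule eventually_mono) simp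
  qed simp
  moreover have "eventually (\<lambda>p. p \<noteq> (a, b)) (at (a, b) within affine_curve f)"
    by (rule eventually_neq_at_within)
  ultimately show ?thesis
    using eventually_on_curve
  proof eventually_elim
    case (elim p)
    then show ?case using assms
      by (cases p) (auto simp: affine_curve_def, metis power2_eq_iff)
  qed
qed

text \<open>Since \<open>y^2 = (x - a) f1(x)\<close> with \<open>f1\<close> nonzero near the simple
  root \<open>a\<close>, a zero of \<open>y\<close> nearby can only be the puncture.\<close>

lemma eventually_y_nonzero:
  assumes "squarefree f" "poly f a = 0"
  shows "eventually (\<lambda>p. snd p \<noteq> 0) (at (a, 0) within affine_curve f)"
proof -
  obtain f1 where f1: "f = [:- a, 1:] * f1" "poly f1 a \<noteq> 0"
    using squarefree_simple_root[OF assms] .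
  from tendsto_imp_eventually_ne[OF tendsto_poly_curve f1(2)]
  have "eventually (\<lambda>p. poly f1 (fst p) \<noteq> 0) (at (a, 0) within affine_curve f)" .
  moreover have "eventually (\<lambda>p. p \<noteq> (a, 0)) (at (a, 0) within affine_curve f)"
    by (rule eventually_neq_at_within)
  ultimately show ?thesis
    using eventually_on_curve
  proof eventually_elim
    case (elim p)
    then show ?case by (cases p) (auto simp: affine_curve_def f1(1))
  qed
qed

lemma eventually_local_param_Aff:
  assumes "squarefree f" "b\<^sup>2 = poly f a"
  shows "eventually (\<lambda>p. local_param g (Aff a b) p \<noteq> 0) (at (a, b) within affine_curve f)"
proof (cases "b = 0")
  case True
  then have "poly f a = 0" using assms(2) by simp
  then show ?thesis
    using eventually_y_nonzero[OF assms(1)] True by (auto simp: case_prod_unfold)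
next
  case False
  then show ?thesis using eventually_x_neq[OF assms(2)] by (auto simp: case_prod_unfold)
qed

text \<open>The ramification index of the projection to the x-line; at infinity it is applied to the
  chart coordinate \<open>s\<close>.\<close>

definition ramification :: "complex \<Rightarrow> int" where
  "ramification b = (if b = 0 then 2 else 1)"

text \<open>At a Weierstrass point the parameter is \<open>y\<close>, and
  \<open>(x - a)/y^2 = 1/f1(x)\<close> has a nonzero limit because the root of \<open>f\<close> is
  simple.\<close>

lemma has_ord_x_Aff:
  assumes sqf: "squarefree f" and on: "b\<^sup>2 = poly f a"
  shows "has_ord (at (a, b) within affine_curve f) (local_param g (Aff a b))
           (\<lambda>p. fst p - a) (ramification b)"
proof (cases "b = 0")
  case False
  then have "(\<lambda>p. fst p - a) = local_param g (Aff a b)" by (auto simp: case_prod_unfold)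
  then show ?thesis
    using has_ord_param[OF eventually_local_param_Aff[OF sqf on]] False
    by (simp add: ramification_def)
next
  case True
  with on have fa: "poly f a = 0" by simp
  obtain f1 where f1: "f = [:- a, 1:] * f1" "poly f1 a \<noteq> 0"
    using squarefree_simple_root[OF sqf fa] .
  have "((\<lambda>p. 1 / poly f1 (fst p)) \<longlongrightarrow> 1 / poly f1 a) (at (a, b) within affine_curve f)"
    by (intro tendsto_intros tendsto_poly_curve f1(2))
  then have "((\<lambda>p. (fst p - a) / local_param g (Aff a b) p powi 2) \<longlongrightarrow> 1 / poly f1 a)
      (at (a, b) within affine_curve f)"
  proof (rule Lim_transform_eventually)
    from eventually_y_nonzero[OF sqf fa] True
    have "eventually (\<lambda>p. snd p \<noteq> 0) (at (a, b) within affine_curve f)" by simp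
    then show "eventually (\<lambda>p. 1 / poly f1 (fst p) = (fst p - a) / local_param g (Aff a b) p powi 2)
        (at (a, b) within affine_curve f)"
      using eventually_on_curve
    proof eventually_elim
      case (elim p)
      then have "(snd p)\<^sup>2 = (fst p - a) * poly f1 (fst p)"
        by (auto simp: affine_curve_def f1(1) algebra_simps)
      moreover have "fst p - a \<noteq> 0 \<and> poly f1 (fst p) \<noteq> 0" using calculation elim(1) by auto
      ultimately show ?case using True elim(1)
        by (simp add: case_prod_unfold nonzero_divide_eq_eq nonzero_eq_divide_eq mult.commute)
    qed
  qed
  then show ?thesis using True f1(2) unfolding has_ord_def ramification_def
    by (intro exI[of _ "1 / poly f1 a"]) simp
qed

lemma has_ord_poly_Aff:
  assumes sqf: "squarefree f" and on: "b\<^sup>2 = poly f a" and C: "C \<noteq> 0"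
  shows "has_ord (at (a, b) within affine_curve f) (local_param g (Aff a b))
           (\<lambda>p. poly C (fst p)) (ramification b * int (order a C))"
proof -
  obtain D where D: "C = [:- a, 1:] ^ order a C * D" "\<not> [:- a, 1:] dvd D"
    using order_decomp[OF C] by blast
  have "has_ord (at (a, b) within affine_curve f) (local_param g (Aff a b))
      (\<lambda>p. (fst p - a) ^ order a C * poly D (fst p)) (int (order a C) * ramification b + 0)"
    using D(2) by (intro has_ord_mult has_ord_power has_ord_x_Aff eventually_local_param_Aff sqf on
        has_ord_0I[OF tendsto_poly_curve]) (auto simp: poly_eq_0_iff_dvd)
  moreover have "poly C x = (x - a) ^ order a C * poly D x" for x
    by (subst D(1)) (simp add: poly_power)
  ultimately show ?thesis by (simp add: mult.commute)
qed

text \<open>The factors \<open>y - P\<close> and \<open>y + P\<close> multiply to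
  \<open>f - P^2\<close>. If \<open>b = P(a)\<close> is nonzero, \<open>y + P\<close> is a unit and
  \<open>y - P\<close> takes the whole order. If \<open>b = P(a) = 0\<close>, both vanish, but the
  norm has a simple zero in \<open>x\<close>, which is order 2 on the curve and is shared
  equally.\<close>

lemma has_ord_y_minus_Aff:
  assumes sqf: "squarefree f" and on: "b\<^sup>2 = poly f a" and N: "f - P\<^sup>2 \<noteq> 0"
  shows "has_ord (at (a, b) within affine_curve f) (local_param g (Aff a b))
           (\<lambda>p. snd p - poly P (fst p)) (if b = poly P a then int (order a (f - P\<^sup>2)) else 0)"
proof -
  let ?F = "at (a, b) within affine_curve f" and ?\<pi> = "local_param g (Aff a b)"
  note lim = tendsto_snd_curve[of b a] tendsto_poly_curve[of P a b]
  consider "b \<noteq> poly P a" | "b = poly P a" "b \<noteq> 0" | "b = poly P a" "b = 0" by blast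
  then show ?thesis
  proof cases
    case 1
    have "((\<lambda>p. snd p - poly P (fst p)) \<longlongrightarrow> b - poly P a) ?F"
      by (intro tendsto_diff lim)
    from has_ord_0I[OF this] 1 show ?thesis by simp
  next
    case 2
    have plus: "((\<lambda>p. snd p + poly P (fst p)) \<longlongrightarrow> b + poly P a) ?F"
      by (intro tendsto_add lim)
    have nz: "b + poly P a \<noteq> 0" using 2 by simp
    have "has_ord ?F ?\<pi> (\<lambda>p. poly (f - P\<^sup>2) (fst p) / (snd p + poly P (fst p)))
        (ramification b * int (order a (f - P\<^sup>2)) - 0)"
      by (intro has_ord_divide eventually_local_param_Aff has_ord_poly_Aff sqf on N
          has_ord_0I[OF plus nz])
    then have "has_ord ?F ?\<pi> (\<lambda>p. snd p - poly P (fst p))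
        (ramification b * int (order a (f - P\<^sup>2)) - 0)"
    proof (rule has_ord_cong[rotated])
      show "eventually (\<lambda>p. poly (f - P\<^sup>2) (fst p) / (snd p + poly P (fst p)) =
          snd p - poly P (fst p)) ?F"
        using tendsto_imp_eventually_ne[OF plus nz] eventually_on_curve
      proof eventually_elim
        case (elim p)
        then have "poly f (fst p) = (snd p)\<^sup>2" by (auto simp: affine_curve_def)
        with elim show ?case by (simp add: field_simps power2_eq_square)
      qed
    qed
    then show ?thesis using 2 by (simp add: ramification_def)
  next
    case 3
    then have fa: "poly f a = 0" using on by simp
    obtain f1 where f1: "f = [:- a, 1:] * f1" "poly f1 a \<noteq> 0"
      using squarefree_simple_root[OF sqf fa] .
    obtain P1 where P1: "P = [:- a, 1:] * P1"
      using 3 by (auto simp: poly_eq_0_iff_dvd)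
    \<comment> \<open>\<open>f\<close> has a simple zero at \<open>a\<close> and \<open>P^2\<close>
      at least a double one, so the norm has a simple zero.\<close>
    have fac: "f - P\<^sup>2 = [:- a, 1:] * (f1 - [:- a, 1:] * P1\<^sup>2)"
      by (simp add: f1(1) P1 power2_eq_square algebra_simps)
    have "order a (f - P\<^sup>2) = order a [:- a, 1:] + order a (f1 - [:- a, 1:] * P1\<^sup>2)"
      using N unfolding fac by (intro order_mult)
    also have "\<dots> = 1"
      using f1(2) order_power_n_n[of a 1] by (simp add: order_0I)
    finally have ord: "order a (f - P\<^sup>2) = 1" .
    have ynz: "eventually (\<lambda>p. snd p \<noteq> 0) ?F"
      using eventually_y_nonzero[OF sqf fa] 3 by simp
    \<comment> \<open>On the curve \<open>(x - a)/y = y/f1\<close>, hence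
      \<open>(y - P)/y = 1 - (y/f1) P1\<close>, which tends to 1.\<close>
    have "((\<lambda>p. 1 - snd p / poly f1 (fst p) * poly P1 (fst p)) \<longlongrightarrow> 1 - 0 / poly f1 a * poly P1 a) ?F"
      using 3(2) f1(2) by (intro tendsto_intros tendsto_poly_curve tendsto_snd_curve) (auto intro: tendsto_snd_curve)
    then have "((\<lambda>p. (snd p - poly P (fst p)) / ?\<pi> p powi 1) \<longlongrightarrow>
        1 - 0 / poly f1 a * poly P1 a) ?F"
    proof (rule Lim_transform_eventually)
      show "eventually (\<lambda>p. 1 - snd p / poly f1 (fst p) * poly P1 (fst p) =
          (snd p - poly P (fst p)) / ?\<pi> p powi 1) ?F"
        using ynz eventually_on_curve
      proof eventually_elim
        case (elim p)
        then have *: "(snd p)\<^sup>2 = (fst p - a) * poly f1 (fst p)"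
          by (auto simp: affine_curve_def f1(1) algebra_simps)
        moreover have "fst p - a \<noteq> 0 \<and> poly f1 (fst p) \<noteq> 0" using calculation elim(1) by auto
        ultimately have "snd p / poly f1 (fst p) = (fst p - a) / snd p"
          using elim(1) by (simp add: field_simps power2_eq_square)
        moreover have "poly P (fst p) = (fst p - a) * poly P1 (fst p)"
          by (simp add: P1 algebra_simps)
        ultimately show ?case using 3 elim(1)
          by (simp add: case_prod_unfold diff_divide_distrib left_diff_distrib)
      qed
    qed
    then show ?thesis using 3 ord unfolding has_ord_def
      by (intro exI[of _ 1]) simp
  qed
qed

section \<open>Points at infinity\<close>

lemma power_Suc_square: "(v ^ (g + 1))\<^sup>2 = (v :: complex) ^ (2 * g + 2)"
  unfolding power_mult[symmetric] by (rule arg_cong[of _ _ "power v"]) simp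

definition infinity_chart :: "nat \<Rightarrow> complex \<times> complex \<Rightarrow> complex \<times> complex" where
  "infinity_chart g = (\<lambda>(x, y). (1 / x, y / x ^ (g + 1)))"

lemma infinity_chart_involution:
  "fst p \<noteq> 0 \<Longrightarrow> infinity_chart g (infinity_chart g p) = p"
  by (cases p) (simp add: infinity_chart_def field_simps)

lemma fst_infinity_chart [simp]: "fst (infinity_chart g p) = 1 / fst p"
  by (simp add: infinity_chart_def case_prod_unfold)

lemma snd_infinity_chart [simp]: "snd (infinity_chart g p) = snd p / fst p ^ (g + 1)"
  by (simp add: infinity_chart_def case_prod_unfold)

lemma has_ord_filtermap:
  "has_ord (filtermap c F) \<pi> h n \<longleftrightarrow> has_ord F (\<lambda>q. \<pi> (c q)) (\<lambda>q. h (c q)) n"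
  by (simp add: has_ord_def filterlim_filtermap)

lemma has_ord_cong_param:
  assumes "eventually (\<lambda>q. \<pi> q = \<pi>' q) F"
  shows "has_ord F \<pi> h n \<longleftrightarrow> has_ord F \<pi>' h n"
proof -
  have "((\<lambda>q. h q / \<pi> q powi n) \<longlongrightarrow> l) F \<longleftrightarrow> ((\<lambda>q. h q / \<pi>' q powi n) \<longlongrightarrow> l) F" for l
    by (rule tendsto_cong) (use assms in eventually_elim, simp)
  then show ?thesis by (simp add: has_ord_def)
qed

text \<open>The two degree bounds cover the odd curve, with one point at infinity, and the even one,
  with two, so that orders are computed once for both.\<close>

locale hyperelliptic =
  fixes g :: nat and f :: "complex poly"
  assumes sqf: "squarefree f"
    and degree_ge: "2 * g + 1 \<le> degree f" and degree_le: "degree f \<le> 2 * g + 2"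
begin

text \<open>The right-hand side of the curve equation in the chart at infinity. In odd degree it
  vanishes at 0, which makes infinity a Weierstrass point.\<close>

definition frecip :: "complex poly" where
  "frecip = recip (2 * g + 2) f"

lemma f_nonzero: "f \<noteq> 0"
  using sqf by auto

lemma squarefree_frecip: "squarefree frecip"
  unfolding frecip_def using degree_ge degree_le by (intro squarefree_recip sqf) auto

lemma poly_frecip: "x \<noteq> 0 \<Longrightarrow> poly frecip x = x ^ (2 * g + 2) * poly f (1 / x)"
  unfolding frecip_def using degree_le by (rule poly_recip)

lemma poly_frecip_0: "poly frecip 0 = coeff f (2 * g + 2)"
  unfolding frecip_def poly_0_coeff_0 using degree_le by (simp add: coeff_recip)

lemma infinity_chart_on_curve:
  assumes "fst p \<noteq> 0"
  shows "infinity_chart g p \<in> affine_curve f \<longleftrightarrow> p \<in> affine_curve frecip"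
proof -
  obtain x y where p: "p = (x, y)" "x \<noteq> 0" using assms by (cases p) auto
  have "(x ^ (g + 1))\<^sup>2 = x ^ (2 * g + 2)" by (rule power_Suc_square)
  then show ?thesis using p
    by (simp add: affine_curve_def infinity_chart_def poly_frecip power_divide field_simps)
qed

text \<open>The chart is an involution off \<open>x = 0\<close>, so the neighbourhoods of
  \<open>Inf s\<close> are the images of those of \<open>(0, s)\<close> on the curve of
  \<open>frecip\<close>. This turns every order at infinity into an order at an affine
  point.\<close>

lemma point_filter_Inf:
  assumes s: "s\<^sup>2 = coeff f (2 * g + 2)"
  shows "point_filter g f (Inf s) =
    filtermap (infinity_chart g) (at (0, s) within affine_curve frecip)"
proof -
  let ?c = "infinity_chart g"
  have pf: "point_filter g f (Inf s) = inf (filtercomap ?c (at (0, s))) (principal (affine_curve f))"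
    by (simp add: infinity_chart_def)
  have xne: "eventually (\<lambda>q. fst q \<noteq> 0) (at (0, s) within affine_curve frecip)"
    by (rule eventually_x_neq) (simp add: s poly_frecip_0)
  have "eventually P (point_filter g f (Inf s)) \<longleftrightarrow>
      eventually P (filtermap ?c (at (0, s) within affine_curve frecip))" for P
  proof
    assume "eventually P (point_filter g f (Inf s))"
    then obtain Q where Q: "eventually Q (at (0, s))" "\<And>p. Q (?c p) \<Longrightarrow> p \<in> affine_curve f \<Longrightarrow> P p"
      unfolding pf eventually_inf_principal eventually_filtercomap by blast
    have "eventually Q (at (0, s) within affine_curve frecip)"
      by (rule filter_leD[OF at_le Q(1)]) simp
    then have "eventually (\<lambda>q. P (?c q)) (at (0, s) within affine_curve frecip)"
      using xne eventually_on_curve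
    proof eventually_elim
      case (elim q)
      then show ?case
        using infinity_chart_on_curve[of q] by (intro Q(2)) (simp_all add: infinity_chart_involution)
    qed
    then show "eventually P (filtermap ?c (at (0, s) within affine_curve frecip))"
      by (simp add: eventually_filtermap)
  next
    assume "eventually P (filtermap ?c (at (0, s) within affine_curve frecip))"
    then have "eventually (\<lambda>q. q \<in> affine_curve frecip \<longrightarrow> P (?c q)) (at (0, s))"
      by (simp add: eventually_filtermap eventually_at_filter)
    \<comment> \<open>Division by zero yields 0, so the chart sends points with \<open>x = 0\<close>
      to \<open>(0, 0)\<close>. That point has to be kept out: it is the puncture if
      \<open>s = 0\<close>, and away from \<open>(0, s)\<close> otherwise.\<close>
    moreover have "eventually (\<lambda>q. q \<noteq> (0, 0)) (at (0 :: complex, s))"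
      by (rule eventually_neq_at_within)
    ultimately have Q: "eventually (\<lambda>q. (q \<in> affine_curve frecip \<longrightarrow> P (?c q)) \<and> q \<noteq> (0, 0)) (at (0, s))"
      by (rule eventually_conj)
    show "eventually P (point_filter g f (Inf s))"
      unfolding pf eventually_inf_principal eventually_filtercomap
    proof (intro exI conjI allI impI)
      fix p assume p: "(?c p \<in> affine_curve frecip \<longrightarrow> P (?c (?c p))) \<and> ?c p \<noteq> (0, 0)"
        and on: "p \<in> affine_curve f"
      have x: "fst p \<noteq> 0" using p by (auto simp: infinity_chart_def case_prod_unfold)
      have "?c p \<in> affine_curve frecip"
        using infinity_chart_on_curve[of "?c p"] x on by (simp add: infinity_chart_involution)
      then show "P p" using p x by (simp add: infinity_chart_involution)
    qed (rule Q)
  qed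
  then show ?thesis by (simp add: filter_eq_iff)
qed

lemma eventually_infinity_param:
  assumes s: "s\<^sup>2 = coeff f (2 * g + 2)"
  shows "eventually (\<lambda>q. local_param g (Inf s) (infinity_chart g q) = local_param g (Aff 0 s) q)
     (at (0, s) within affine_curve frecip)"
proof -
  have "eventually (\<lambda>q. fst q \<noteq> 0) (at (0, s) within affine_curve frecip)"
    by (rule eventually_x_neq) (simp add: s poly_frecip_0)
  then show ?thesis
    by eventually_elim (auto simp: case_prod_unfold field_simps)
qed

lemma has_order_Inf:
  assumes s: "s\<^sup>2 = coeff f (2 * g + 2)"
  shows "has_order g f h (Inf s) n \<longleftrightarrow>
    has_ord (at (0, s) within affine_curve frecip) (local_param g (Aff 0 s)) (\<lambda>q. h (infinity_chart g q)) n"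
  unfolding has_order_iff_has_ord point_filter_Inf[OF s] has_ord_filtermap
  by (rule has_ord_cong_param[OF eventually_infinity_param[OF s]])

lemma completed_curve_cases:
  assumes "p \<in> completed_curve g f"
  obtains a b where "p = Aff a b" "b\<^sup>2 = poly f a" | s where "p = Inf s" "s\<^sup>2 = coeff f (2 * g + 2)"
  using assms by (auto simp: completed_curve_def affine_curve_def)

lemma eventually_local_param:
  assumes "p \<in> completed_curve g f"
  shows "eventually (\<lambda>q. local_param g p q \<noteq> 0) (point_filter g f p)"
  using assms
proof (cases rule: completed_curve_cases)
  case (1 a b)
  then show ?thesis using eventually_local_param_Aff[OF sqf] by simp
next
  case (2 s)
  have "eventually (\<lambda>q. local_param g (Aff 0 s) q \<noteq> 0) (at (0, s) within affine_curve frecip)"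
    using 2 by (intro eventually_local_param_Aff squarefree_frecip) (simp add: poly_frecip_0)
  then show ?thesis
    using eventually_infinity_param[OF 2(2)]
    unfolding 2(1) point_filter_Inf[OF 2(2)] eventually_filtermap by eventually_elim simp
qed

lemma eventually_on_curve_point:
  assumes "p \<in> completed_curve g f"
  shows "eventually (\<lambda>q. q \<in> affine_curve f) (point_filter g f p)"
  using assms
proof (cases rule: completed_curve_cases)
  case (1 a b)
  then show ?thesis by (simp add: eventually_on_curve)
next
  case (2 s)
  then show ?thesis by (simp add: eventually_inf_principal)
qed

lemma has_order_divide:
  assumes "p \<in> completed_curve g f" "has_order g f h p m" "has_order g f k p n"
  shows "has_order g f (\<lambda>q. h q / k q) p (m - n)"
  using has_ord_divide[OF eventually_local_param[OF assms(1)]] assms(2,3)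
  by (simp add: has_order_iff_has_ord)

lemma has_order_cong:
  assumes "p \<in> completed_curve g f" "has_order g f h p n"
    and "eventually (\<lambda>q. q \<in> affine_curve f \<longrightarrow> h q = k q) (point_filter g f p)"
  shows "has_order g f k p n"
  unfolding has_order_iff_has_ord
proof (rule has_ord_cong)
  show "eventually (\<lambda>q. h q = k q) (point_filter g f p)"
    using eventually_on_curve_point[OF assms(1)] assms(3) by eventually_elim blast
  show "has_ord (point_filter g f p) (local_param g p) h n"
    using assms(2) by (simp add: has_order_iff_has_ord)
qed

text \<open>At infinity \<open>x\<close> has a pole, double at a branch point and simple
  otherwise.\<close>

definition poly_order :: "complex poly \<Rightarrow> cpoint \<Rightarrow> int" where
  "poly_order C p = (case p of
      Aff a b \<Rightarrow> ramification b * int (order a C)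
    | Inf s \<Rightarrow> - ramification s * int (degree C))"

lemma has_order_poly:
  assumes "p \<in> completed_curve g f" "C \<noteq> 0"
  shows "has_order g f (\<lambda>q. poly C (fst q)) p (poly_order C p)"
  using assms(1)
proof (cases rule: completed_curve_cases)
  case (1 a b)
  then show ?thesis
    using has_ord_poly_Aff[OF sqf 1(2) assms(2)] by (simp add: has_order_iff_has_ord poly_order_def)
next
  case (2 s)
  let ?F = "at (0, s) within affine_curve frecip" and ?\<pi> = "local_param g (Aff 0 s)"
  have s0: "s\<^sup>2 = poly frecip 0" using 2 by (simp add: poly_frecip_0)
  have "has_ord ?F ?\<pi> (\<lambda>q. poly (recip (degree C) C) (fst q) / (fst q - 0) ^ degree C)
      (ramification s * int (order 0 (recip (degree C) C)) - int (degree C) * ramification s)"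
    using assms(2) by (intro has_ord_divide has_ord_power has_ord_x_Aff has_ord_poly_Aff
        eventually_local_param_Aff squarefree_frecip s0) simp
  then have "has_ord ?F ?\<pi> (\<lambda>q. poly (recip (degree C) C) (fst q) / (fst q - 0) ^ degree C)
      (poly_order C p)"
    using 2 assms(2) by (simp add: order_recip_0 poly_order_def mult.commute)
  then have "has_ord ?F ?\<pi> (\<lambda>q. poly C (fst (infinity_chart g q))) (poly_order C p)"
  proof (rule has_ord_cong[rotated])
    show "eventually (\<lambda>q. poly (recip (degree C) C) (fst q) / (fst q - 0) ^ degree C =
        poly C (fst (infinity_chart g q))) ?F"
      using eventually_x_neq[OF s0] by eventually_elim (simp add: poly_recip)
  qed
  then show ?thesis using 2 by (simp add: has_order_Inf)
qed

lemma eventually_poly_nonzero: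
  assumes "p \<in> completed_curve g f" "C \<noteq> 0"
  shows "eventually (\<lambda>q. poly C (fst q) \<noteq> 0) (point_filter g f p)"
  using has_ord_eventually_nonzero has_order_poly[OF assms] unfolding has_order_iff_has_ord by blast

text \<open>At infinity \<open>y - P\<close> is \<open>s - recip (g+1) P\<close>, as a function in
  the chart, divided by \<open>z^(g+1)\<close>. The first summand is the order of the numerator by
  the affine formula, its norm being the reversal of \<open>f - P^2\<close> relative to degree
  \<open>2 g + 2\<close>; the second is the order of the denominator.\<close>

definition y_minus_order :: "complex poly \<Rightarrow> cpoint \<Rightarrow> int" where
  "y_minus_order P p = (case p of
      Aff a b \<Rightarrow> (if b = poly P a then int (order a (f - P\<^sup>2)) else 0)
    | Inf s \<Rightarrow> (if s = coeff P (g + 1) then 2 * int g + 2 - int (degree (f - P\<^sup>2)) else 0)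
        - ramification s * (int g + 1))"

lemma has_order_y_minus:
  assumes "p \<in> completed_curve g f" "degree P \<le> g + 1" "f - P\<^sup>2 \<noteq> 0"
  shows "has_order g f (\<lambda>q. snd q - poly P (fst q)) p (y_minus_order P p)"
  using assms(1)
proof (cases rule: completed_curve_cases)
  case (1 a b)
  then show ?thesis
    using has_ord_y_minus_Aff[OF sqf 1(2) assms(3)]
    by (simp add: has_order_iff_has_ord y_minus_order_def)
next
  case (2 s)
  let ?F = "at (0, s) within affine_curve frecip" and ?\<pi> = "local_param g (Aff 0 s)"
  let ?P = "recip (g + 1) P"
  have s0: "s\<^sup>2 = poly frecip 0" using 2 by (simp add: poly_frecip_0)
  have dP2: "degree (P\<^sup>2) \<le> 2 * g + 2"
    using degree_power_le[of P 2] assms(2) by simp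
  have dN: "degree (f - P\<^sup>2) \<le> 2 * g + 2"
    using degree_le dP2 by (rule degree_diff_le)
  have "recip (2 * g + 2) (P\<^sup>2) = ?P\<^sup>2"
    using recip_mult[OF assms(2,2)] by (simp add: power2_eq_square algebra_simps flip: mult_2)
  then have N: "frecip - ?P\<^sup>2 = recip (2 * g + 2) (f - P\<^sup>2)"
    using recip_diff[OF degree_le dP2] by (simp add: frecip_def)
  have "has_ord ?F ?\<pi> (\<lambda>q. (snd q - poly ?P (fst q)) / (fst q - 0) ^ (g + 1))
      ((if s = poly ?P 0 then int (order 0 (frecip - ?P\<^sup>2)) else 0) - int (g + 1) * ramification s)"
    using N assms(3)
    by (intro has_ord_divide has_ord_power has_ord_x_Aff has_ord_y_minus_Aff
        eventually_local_param_Aff squarefree_frecip s0) simp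
  moreover have "poly ?P 0 = coeff P (g + 1)"
    unfolding poly_0_coeff_0 using assms(2) by (simp add: coeff_recip)
  moreover have "int (order 0 (frecip - ?P\<^sup>2)) = 2 * int g + 2 - int (degree (f - P\<^sup>2))"
    using dN assms(3) unfolding N by (simp add: order_recip_0 of_nat_diff)
  ultimately have "has_ord ?F ?\<pi> (\<lambda>q. (snd q - poly ?P (fst q)) / (fst q - 0) ^ (g + 1))
      ((if s = coeff P (g + 1) then 2 * int g + 2 - int (degree (f - P\<^sup>2)) else 0)
        - int (g + 1) * ramification s)"
    by (simp only:)
  moreover have "(if s = coeff P (g + 1) then 2 * int g + 2 - int (degree (f - P\<^sup>2)) else 0)
      - int (g + 1) * ramification s = y_minus_order P p"
    using 2 by (simp add: y_minus_order_def algebra_simps)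
  ultimately have "has_ord ?F ?\<pi> (\<lambda>q. (snd q - poly ?P (fst q)) / (fst q - 0) ^ (g + 1))
      (y_minus_order P p)"
    by (simp only:)
  then have "has_ord ?F ?\<pi> (\<lambda>q. snd (infinity_chart g q) - poly P (fst (infinity_chart g q)))
      (y_minus_order P p)"
  proof (rule has_ord_cong[rotated])
    show "eventually (\<lambda>q. (snd q - poly ?P (fst q)) / (fst q - 0) ^ (g + 1) =
        snd (infinity_chart g q) - poly P (fst (infinity_chart g q))) ?F"
      using eventually_x_neq[OF s0]
      by eventually_elim (simp add: poly_recip[OF assms(2)[unfolded Suc_eq_plus1[symmetric]]]
          diff_divide_distrib)
  qed
  then show ?thesis using 2 by (simp add: has_order_Inf)
qed

end

section \<open>Moebius transformations of hyperelliptic curves\<close>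

text \<open>The right-hand side of the curve equation is treated as a binary form of degree
  \<open>2 g + 2\<close>, so \<open>y\<close> has weight \<open>g + 1\<close>.\<close>

definition moebius ::
    "nat \<Rightarrow> complex \<Rightarrow> complex \<Rightarrow> complex \<Rightarrow> complex \<Rightarrow> complex \<times> complex \<Rightarrow> complex \<times> complex" where
  "moebius g \<alpha> \<beta> \<gamma> \<delta> =
     (\<lambda>(x, y). ((\<alpha> * x + \<beta>) / (\<gamma> * x + \<delta>), y / (\<gamma> * x + \<delta>) ^ (g + 1)))"

text \<open>The parameter pulls back to order one: at a Weierstrass point \<open>y\<close> is only
  multiplied by a nonvanishing factor, and elsewhere the difference of first coordinates is
  \<open>x - a\<close> times the determinant over
  \<open>(\<gamma> x + \<delta>)(\<gamma> a + \<delta>)\<close>.\<close>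

lemma moebius_local:
  assumes sqf: "squarefree f1" "squarefree f2" and on: "b\<^sup>2 = poly f1 a"
    and det: "\<alpha> * \<delta> - \<beta> * \<gamma> \<noteq> 0" and den: "\<gamma> * a + \<delta> \<noteq> 0"
    and rel: "\<And>x. \<gamma> * x + \<delta> \<noteq> 0 \<Longrightarrow>
        poly f1 x = (\<gamma> * x + \<delta>) ^ (2 * g + 2) * poly f2 ((\<alpha> * x + \<beta>) / (\<gamma> * x + \<delta>))"
    and ab': "(a', b') = moebius g \<alpha> \<beta> \<gamma> \<delta> (a, b)"
  shows "b'\<^sup>2 = poly f2 a'"
    and "filterlim (moebius g \<alpha> \<beta> \<gamma> \<delta>) (at (a', b') within affine_curve f2) (at (a, b) within affine_curve f1)"
    and "has_ord (at (a, b) within affine_curve f1) (local_param g (Aff a b))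
          (\<lambda>q. local_param g (Aff a' b') (moebius g \<alpha> \<beta> \<gamma> \<delta> q)) 1"
proof -
  let ?F = "at (a, b) within affine_curve f1" and ?m = "moebius g \<alpha> \<beta> \<gamma> \<delta>"
  have sq: "(v ^ (g + 1))\<^sup>2 = v ^ (2 * g + 2)" for v :: complex
    by (rule power_Suc_square)
  have on2: "?m (x, y) \<in> affine_curve f2" if "(x, y) \<in> affine_curve f1" "\<gamma> * x + \<delta> \<noteq> 0" for x y
  proof -
    have "(y / (\<gamma> * x + \<delta>) ^ (g + 1))\<^sup>2 = poly f1 x / (\<gamma> * x + \<delta>) ^ (2 * g + 2)"
      using that(1) sq[of "\<gamma> * x + \<delta>"] by (simp add: power_divide affine_curve_def)
    then show ?thesis using rel[OF that(2)] that(2) by (simp add: moebius_def affine_curve_def)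
  qed
  have ab: "a' = (\<alpha> * a + \<beta>) / (\<gamma> * a + \<delta>)" "b' = b / (\<gamma> * a + \<delta>) ^ (g + 1)"
    using ab' by (simp_all add: moebius_def)
  show "b'\<^sup>2 = poly f2 a'"
    using on2[of a b] on den ab'[symmetric] by (simp add: affine_curve_def)
  have den_lim: "((\<lambda>q. \<gamma> * fst q + \<delta>) \<longlongrightarrow> \<gamma> * a + \<delta>) ?F"
    by (intro tendsto_intros tendsto_fst_curve)
  have den_nz: "eventually (\<lambda>q. \<gamma> * fst q + \<delta> \<noteq> 0) ?F"
    using tendsto_imp_eventually_ne[OF den_lim den] .
  have lim: "(?m \<longlongrightarrow> (a', b')) ?F"
    unfolding ab moebius_def case_prod_unfold
    by (intro tendsto_intros tendsto_fst_curve tendsto_snd_curve) (use den in auto)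
  have b0: "b' = 0 \<longleftrightarrow> b = 0" using den by (simp add: ab)
  have par: "eventually (\<lambda>q. local_param g (Aff a b) q \<noteq> 0) ?F"
    using sqf(1) on by (rule eventually_local_param_Aff)
  show ord: "has_ord ?F (local_param g (Aff a b)) (\<lambda>q. local_param g (Aff a' b') (?m q)) 1"
  proof (cases "b = 0")
    case True
    have "((\<lambda>q. 1 / (\<gamma> * fst q + \<delta>) ^ (g + 1)) \<longlongrightarrow> 1 / (\<gamma> * a + \<delta>) ^ (g + 1)) ?F"
      using den by (intro tendsto_intros den_lim) auto
    then have "has_ord ?F (local_param g (Aff a b)) (\<lambda>q. 1 / (\<gamma> * fst q + \<delta>) ^ (g + 1)) 0"
      by (rule has_ord_0I) (use den in auto)
    from has_ord_mult[OF par has_ord_param[OF par] this] show ?thesis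
      using True b0 by (simp add: moebius_def case_prod_unfold)
  next
    case False
    have "((\<lambda>q. (\<alpha> * \<delta> - \<beta> * \<gamma>) / ((\<gamma> * fst q + \<delta>) * (\<gamma> * a + \<delta>))) \<longlongrightarrow>
        (\<alpha> * \<delta> - \<beta> * \<gamma>) / ((\<gamma> * a + \<delta>) * (\<gamma> * a + \<delta>))) ?F"
      using den by (intro tendsto_intros den_lim) auto
    then have "has_ord ?F (local_param g (Aff a b))
        (\<lambda>q. (\<alpha> * \<delta> - \<beta> * \<gamma>) / ((\<gamma> * fst q + \<delta>) * (\<gamma> * a + \<delta>))) 0"
      by (rule has_ord_0I) (use den det in auto)
    from has_ord_mult[OF par has_ord_param[OF par] this]
    have "has_ord ?F (local_param g (Aff a b)) (\<lambda>q. local_param g (Aff a b) q *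
        ((\<alpha> * \<delta> - \<beta> * \<gamma>) / ((\<gamma> * fst q + \<delta>) * (\<gamma> * a + \<delta>)))) 1" by simp
    then show ?thesis
    proof (rule has_ord_cong[rotated])
      show "eventually (\<lambda>q. local_param g (Aff a b) q *
          ((\<alpha> * \<delta> - \<beta> * \<gamma>) / ((\<gamma> * fst q + \<delta>) * (\<gamma> * a + \<delta>))) =
          local_param g (Aff a' b') (?m q)) ?F"
        using den_nz
      proof eventually_elim
        case (elim q)
        have "(fst q - a) * (\<alpha> * \<delta> - \<beta> * \<gamma>) =
            (\<alpha> * fst q + \<beta>) * (\<gamma> * a + \<delta>) - (\<alpha> * a + \<beta>) * (\<gamma> * fst q + \<delta>)"
          by algebra
        with elim den False b0 show ?case
          by (simp add: moebius_def case_prod_unfold ab(1) diff_frac_eq mult.commute)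
      qed
    qed
  qed
  show "filterlim ?m (at (a', b') within affine_curve f2) ?F"
    unfolding filterlim_at
  proof (intro conjI lim)
    show "eventually (\<lambda>q. ?m q \<in> affine_curve f2 \<and> ?m q \<noteq> (a', b')) ?F"
      using den_nz eventually_on_curve has_ord_eventually_nonzero[OF ord]
    proof eventually_elim
      case (elim q)
      have "?m q \<noteq> (a', b')" using elim(3) by (auto split: if_splits)
      then show ?case using on2[of "fst q" "snd q"] elim by simp
    qed
  qed
qed

section \<open>Groups\<close>

lemma FactGroup_iso_image:
  assumes h: "h \<in> iso G H" and G: "group G" and H: "group H"
    and N: "N \<lhd> G" and M: "M \<lhd> H" and NM: "h ` N = M"
  shows "(\<lambda>z. h ` z) \<in> iso (G Mod N) (H Mod M)"
    and "x \<in> carrier G \<Longrightarrow> h ` (N #>\<^bsub>G\<^esub> x) = M #>\<^bsub>H\<^esub> h x"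
proof -
  interpret N: normal N G by (rule N)
  interpret M: normal M H by (rule M)
  have hom: "h \<in> hom G H" and bij: "bij_betw h (carrier G) (carrier H)"
    using h by (auto simp: iso_def)
  have hc: "h y \<in> carrier H" if "y \<in> carrier G" for y
    using hom_in_carrier[OF hom that] .
  have coset: "h ` (N #>\<^bsub>G\<^esub> y) = M #>\<^bsub>H\<^esub> h y" if y: "y \<in> carrier G" for y
  proof -
    have "h ` (N #>\<^bsub>G\<^esub> y) = (\<lambda>n. h (n \<otimes>\<^bsub>G\<^esub> y)) ` N"
      by (auto simp: r_coset_def)
    also have "\<dots> = (\<lambda>n. h n \<otimes>\<^bsub>H\<^esub> h y) ` N"
      using y hom_mult[OF hom] N.subset by (intro image_cong) auto
    also have "\<dots> = M #>\<^bsub>H\<^esub> h y" by (auto simp: r_coset_def simp flip: NM)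
    finally show ?thesis .
  qed
  then show "x \<in> carrier G \<Longrightarrow> h ` (N #>\<^bsub>G\<^esub> x) = M #>\<^bsub>H\<^esub> h x" .
  have "(\<lambda>z. h ` z) \<in> hom (G Mod N) (H Mod M)"
  proof (rule homI)
    fix z assume "z \<in> carrier (G Mod N)"
    then show "h ` z \<in> carrier (H Mod M)"
      by (auto simp: carrier_FactGroup coset hc)
  next
    fix z w assume "z \<in> carrier (G Mod N)" "w \<in> carrier (G Mod N)"
    then obtain x y where xy: "x \<in> carrier G" "y \<in> carrier G" "z = N #>\<^bsub>G\<^esub> x" "w = N #>\<^bsub>G\<^esub> y"
      by (auto simp: carrier_FactGroup)
    then show "h ` (z \<otimes>\<^bsub>G Mod N\<^esub> w) = h ` z \<otimes>\<^bsub>H Mod M\<^esub> h ` w"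
      by (simp add: N.rcos_sum M.rcos_sum coset hc hom_mult[OF hom])
  qed
  moreover have "bij_betw (\<lambda>z. h ` z) (carrier (G Mod N)) (carrier (H Mod M))"
  proof (rule bij_betw_imageI)
    have "z \<subseteq> carrier G" if "z \<in> carrier (G Mod N)" for z
      using that N.r_coset_subset_G[OF N.subset] by (auto simp: carrier_FactGroup)
    then show "inj_on (\<lambda>z. h ` z) (carrier (G Mod N))"
      using bij_betw_imp_inj_on[OF bij] by (intro inj_onI) (metis inj_on_image_eq_iff)
    have "(\<lambda>z. h ` z) ` carrier (G Mod N) = (\<lambda>x. M #>\<^bsub>H\<^esub> h x) ` carrier G"
      by (simp add: carrier_FactGroup image_image coset)
    also have "\<dots> = (\<lambda>y. M #>\<^bsub>H\<^esub> y) ` (h ` carrier G)" by (simp add: image_image)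
    also have "h ` carrier G = carrier H" using bij by (rule bij_betw_imp_surj_on)
    finally show "(\<lambda>z. h ` z) ` carrier (G Mod N) = carrier (H Mod M)"
      by (simp add: carrier_FactGroup)
  qed
  ultimately show "(\<lambda>z. h ` z) \<in> iso (G Mod N) (H Mod M)" by (simp add: iso_def)
qed

text \<open>Turns a coincidence of two classes along an orbit into a torsion relation for the shift.
  The orbit formula is needed for negative steps too, where it follows by cancellation.\<close>

lemma (in group) translation_orbit_period:
  fixes c :: "int \<Rightarrow> 'a"
  assumes c: "\<And>n. c n \<in> carrier G" and s: "s \<in> carrier G"
    and step: "\<And>n. c (n + 1) = c n \<otimes> s" and eq: "c n = c m"
  shows "s [^] (m - n) = \<one>"
proof -
  have orbit: "c (n + k) = c n \<otimes> s [^] k" for k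
  proof (induction k rule: int_induct[where k = 0])
    case base
    show ?case using c by simp
  next
    case (step1 k)
    have "c (n + (k + 1)) = c (n + k) \<otimes> s" using step[of "n + k"] by (simp add: add.assoc)
    then show ?case using step1 c s by (simp add: int_pow_mult m_assoc)
  next
    case (step2 k)
    have "c n \<otimes> s [^] (k - 1) \<otimes> s = c n \<otimes> s [^] k"
      using int_pow_mult[OF s, of "k - 1" 1] c s by (simp add: m_assoc)
    also have "\<dots> = c (n + (k - 1)) \<otimes> s" using step2 step[of "n + (k - 1)"] by simp
    finally show ?case using c s by (metis int_pow_closed m_closed right_cancel)
  qed
  have "c n \<otimes> s [^] (m - n) = c n" using orbit[of "m - n"] eq by simp
  then show ?thesis using c s by (metis int_pow_closed l_cancel_one')
qed


section \<open>Divisors and Jacobians\<close>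

definition div_deg :: "(cpoint \<Rightarrow>\<^sub>0 int) \<Rightarrow> int" where
  "div_deg D = (\<Sum>p\<in>Poly_Mapping.keys D. Poly_Mapping.lookup D p)"

lemma div_deg_superset:
  "finite K \<Longrightarrow> Poly_Mapping.keys D \<subseteq> K \<Longrightarrow> div_deg D = (\<Sum>p\<in>K. Poly_Mapping.lookup D p)"
  unfolding div_deg_def by (rule sum.mono_neutral_left) (auto simp: in_keys_iff)

lemma div_deg_add: "div_deg (D + E) = div_deg D + div_deg E"
proof -
  let ?K = "Poly_Mapping.keys D \<union> Poly_Mapping.keys E"
  show ?thesis
    using Poly_Mapping.keys_add[of D E]
    by (simp add: div_deg_superset[of ?K] lookup_add sum.distrib)
qed

lemma div_deg_minus: "div_deg (- D) = - div_deg D"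
  by (simp add: div_deg_def sum_negf)

lemma div_deg_diff: "div_deg (D - E) = div_deg D - div_deg E"
  using div_deg_add[of D "- E"] by (simp add: div_deg_minus)

lemma div_deg_0 [simp]: "div_deg 0 = 0"
  by (simp add: div_deg_def)

lemma div_deg_frag_of [simp]: "div_deg (frag_of p) = 1"
  by (simp add: div_deg_def)

lemma div_deg_frag_cmul: "div_deg (frag_cmul k D) = k * div_deg D"
proof (cases "k = 0")
  case False
  then have "Poly_Mapping.keys (frag_cmul k D) = Poly_Mapping.keys D" by auto
  then show ?thesis by (simp add: div_deg_def sum_distrib_left)
qed simp

lemma div_deg_sum: "div_deg (\<Sum>i\<in>I. D i) = (\<Sum>i\<in>I. div_deg (D i))"
  by (induction I rule: infinite_finite_induct) (simp_all add: div_deg_add)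

lemma carrier_div0_group:
  "D \<in> carrier (div0_group g f) \<longleftrightarrow> Poly_Mapping.keys D \<subseteq> completed_curve g f \<and> div_deg D = 0"
  by (simp add: div0_group_def div_deg_def)

lemma mult_div0_group [simp]: "D \<otimes>\<^bsub>div0_group g f\<^esub> E = D + E"
  by (simp add: div0_group_def free_Abelian_group_def)

lemma one_div0_group [simp]: "\<one>\<^bsub>div0_group g f\<^esub> = 0"
  by (simp add: div0_group_def free_Abelian_group_def)

lemma comm_group_div0_group: "comm_group (div0_group g f)"
proof (rule comm_groupI)
  fix D E assume "D \<in> carrier (div0_group g f)" "E \<in> carrier (div0_group g f)"
  then show "D \<otimes>\<^bsub>div0_group g f\<^esub> E \<in> carrier (div0_group g f)"
    using Poly_Mapping.keys_add[of D E] by (auto simp: carrier_div0_group div_deg_add)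
next
  fix D assume "D \<in> carrier (div0_group g f)"
  then show "\<exists>E\<in>carrier (div0_group g f). E \<otimes>\<^bsub>div0_group g f\<^esub> D = \<one>\<^bsub>div0_group g f\<^esub>"
    by (intro bexI[of _ "- D"]) (auto simp: carrier_div0_group div_deg_minus)
qed (auto simp: carrier_div0_group ac_simps)

lemma inv_div0_group:
  assumes "D \<in> carrier (div0_group g f)"
  shows "inv\<^bsub>div0_group g f\<^esub> D = - D"
proof -
  interpret comm_group "div0_group g f" by (rule comm_group_div0_group)
  show ?thesis
    using assms by (intro inv_equality) (auto simp: carrier_div0_group div_deg_minus)
qed

lemma div0_group_diff:
  assumes "D \<in> carrier (div0_group g f)" "E \<in> carrier (div0_group g f)"
  shows "D - E \<in> carrier (div0_group g f)"
  using assms Poly_Mapping.keys_diff[of D E] by (auto simp: carrier_div0_group div_deg_diff)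

lemma lookup_root_divisor:
  assumes "Q \<noteq> 0"
  shows "Poly_Mapping.lookup (root_divisor P Q) p =
    (case p of Aff a b \<Rightarrow> if b = poly P a then int (order a Q) else 0 | Inf s \<Rightarrow> 0)"
proof -
  have fin: "finite {a. poly Q a = 0}" using assms by (rule poly_roots_finite)
  have "Poly_Mapping.lookup (root_divisor P Q) p =
      (\<Sum>a | poly Q a = 0. int (order a Q) * (if p = Aff a (poly P a) then 1 else 0))"
    unfolding root_divisor_def lookup_sum by simp
  also have "\<dots> = (case p of Aff a b \<Rightarrow> if b = poly P a then int (order a Q) else 0 | Inf s \<Rightarrow> 0)"
  proof (cases p)
    case (Aff a b)
    have "(\<Sum>x | poly Q x = 0. int (order x Q) * (if p = Aff x (poly P x) then 1 else 0)) =
        (\<Sum>x | poly Q x = 0. if x = a then (if b = poly P a then int (order a Q) else 0) else 0)"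
      using Aff by (intro sum.cong) auto
    also have "\<dots> = (if b = poly P a then int (order a Q) else 0)"
      using fin by (auto simp: order_0I)
    finally show ?thesis using Aff by simp
  qed simp
  finally show ?thesis .
qed

lemma keys_root_divisor:
  assumes "Q \<noteq> 0" "\<And>a. poly Q a = 0 \<Longrightarrow> (poly P a)\<^sup>2 = poly f a"
  shows "Poly_Mapping.keys (root_divisor P Q) \<subseteq> completed_curve g f"
proof
  fix p assume "p \<in> Poly_Mapping.keys (root_divisor P Q)"
  then have *: "Poly_Mapping.lookup (root_divisor P Q) p \<noteq> 0" by (simp add: in_keys_iff)
  then obtain a where "p = Aff a (poly P a)" "order a Q \<noteq> 0"
    unfolding lookup_root_divisor[OF assms(1)] by (cases p) (auto split: if_splits)
  moreover have "poly Q a = 0" using calculation(2) by (simp add: order_root)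
  ultimately show "p \<in> completed_curve g f"
    using assms(2) by (auto simp: completed_curve_def affine_curve_def)
qed

lemma div_deg_root_divisor: "Q \<noteq> 0 \<Longrightarrow> div_deg (root_divisor P Q) = int (degree Q)"
proof -
  assume Q: "Q \<noteq> 0"
  have "div_deg (root_divisor P Q) = int (\<Sum>a | poly Q a = 0. order a Q)"
    unfolding root_divisor_def div_deg_sum by (simp add: div_deg_frag_cmul)
  also have "(\<Sum>a | poly Q a = 0. order a Q) = size (proots Q)"
    using Q by (simp add: size_multiset_overloaded_eq)
  also have "\<dots> = degree Q" by (rule size_proots_complex)
  finally show ?thesis .
qed

section \<open>Principal divisors as a subgroup, and classes in the Jacobian\<close>

context hyperelliptic
begin

text \<open>At a root of \<open>f\<close>, which is simple, \<open>A^2\<close> has even and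
  \<open>f B^2\<close> has odd order.\<close>

lemma norm_nonzero:
  assumes "A \<noteq> 0 \<or> B \<noteq> 0"
  shows "A\<^sup>2 - f * B\<^sup>2 \<noteq> 0"
proof
  assume eq: "A\<^sup>2 - f * B\<^sup>2 = 0"
  then have nz: "A \<noteq> 0" "B \<noteq> 0" using assms f_nonzero by auto
  have "\<not> constant (poly f)" using degree_ge by (simp add: constant_degree)
  then obtain a where a: "poly f a = 0" using fundamental_theorem_of_algebra by blast
  then have "order a f = 1"
    using squarefree_imp_order_le_1[OF sqf, of a] f_nonzero order_root[of f a] by simp
  then have "order a (f * B\<^sup>2) = 1 + 2 * order a B"
    using nz f_nonzero by (simp add: order_mult power2_eq_square)
  moreover have "order a (A\<^sup>2) = 2 * order a A"
    using nz by (simp add: order_mult power2_eq_square)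
  moreover have "A\<^sup>2 = f * B\<^sup>2" using eq by simp
  ultimately have "2 * order a A = 1 + 2 * order a B" by simp
  then show False by presburger
qed

lemma principal_divisorsI:
  assumes "D \<in> carrier (div0_group g f)" "C \<noteq> 0" "A \<noteq> 0 \<or> B \<noteq> 0"
    and "\<And>p. p \<in> completed_curve g f \<Longrightarrow> has_order g f (ratfun A B C) p (Poly_Mapping.lookup D p)"
  shows "D \<in> principal_divisors g f"
  using assms unfolding principal_divisors_def by blast

text \<open>A quotient of two functions is brought back to the normal form by multiplying with the
  conjugate \<open>A' - B' y\<close>, which replaces the denominator by the norm
  \<open>n\<close>.\<close>

lemma principal_divisors_diff:
  assumes D: "D \<in> principal_divisors g f" and E: "E \<in> principal_divisors g f"
  shows "D - E \<in> principal_divisors g f"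
proof -
  obtain A B C where ABC: "C \<noteq> 0" "A \<noteq> 0 \<or> B \<noteq> 0" "D \<in> carrier (div0_group g f)"
    "\<And>p. p \<in> completed_curve g f \<Longrightarrow> has_order g f (ratfun A B C) p (Poly_Mapping.lookup D p)"
    using D unfolding principal_divisors_def by blast
  obtain A' B' C' where ABC': "C' \<noteq> 0" "A' \<noteq> 0 \<or> B' \<noteq> 0" "E \<in> carrier (div0_group g f)"
    "\<And>p. p \<in> completed_curve g f \<Longrightarrow> has_order g f (ratfun A' B' C') p (Poly_Mapping.lookup E p)"
    using E unfolding principal_divisors_def by blast
  define n where "n = A'\<^sup>2 - f * B'\<^sup>2"
  have n: "n \<noteq> 0" unfolding n_def using ABC'(2) by (rule norm_nonzero)
  define A2 B2 where "A2 = C' * (A * A' - f * B * B')" and "B2 = C' * (B * A' - A * B')"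
  show ?thesis
  proof (rule principal_divisorsI)
    show "D - E \<in> carrier (div0_group g f)"
      using ABC(3) ABC'(3) by (rule div0_group_diff)
    show "C * n \<noteq> 0" using ABC(1) n by simp
    \<comment> \<open>Multiplicativity of the norm excludes that the new numerator is identically
      zero.\<close>
    have "A2\<^sup>2 - f * B2\<^sup>2 = C'\<^sup>2 * (A\<^sup>2 - f * B\<^sup>2) * n"
      unfolding A2_def B2_def n_def by algebra
    also have "\<dots> \<noteq> 0" using ABC'(1) n norm_nonzero[OF ABC(2)] by simp
    finally show "A2 \<noteq> 0 \<or> B2 \<noteq> 0" by auto
    fix p assume p: "p \<in> completed_curve g f"
    have "has_order g f (\<lambda>q. ratfun A B C q / ratfun A' B' C' q) p
        (Poly_Mapping.lookup D p - Poly_Mapping.lookup E p)"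
      using p ABC(4) ABC'(4) by (intro has_order_divide) auto
    then have "has_order g f (ratfun A2 B2 (C * n)) p
        (Poly_Mapping.lookup D p - Poly_Mapping.lookup E p)"
    proof (rule has_order_cong[OF p])
      show "eventually (\<lambda>q. q \<in> affine_curve f \<longrightarrow>
          ratfun A B C q / ratfun A' B' C' q = ratfun A2 B2 (C * n) q) (point_filter g f p)"
        using eventually_poly_nonzero[OF p n] eventually_poly_nonzero[OF p ABC'(1)]
          eventually_poly_nonzero[OF p ABC(1)]
      proof eventually_elim
        case (elim q)
        show ?case
        proof
          assume "q \<in> affine_curve f"
          then obtain x y where q: "q = (x, y)" "y\<^sup>2 = poly f x"
            by (auto simp: affine_curve_def)
          have norm: "(poly A' x + poly B' x * y) * (poly A' x - poly B' x * y) = poly n x"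
            unfolding n_def poly_diff poly_mult poly_power q(2)[symmetric] by algebra
          then have nz: "poly A' x + poly B' x * y \<noteq> 0" using elim(1) q by auto
          have "(poly A x + poly B x * y) * poly C' x * poly n x =
              (poly A2 x + poly B2 x * y) * (poly A' x + poly B' x * y)"
            unfolding A2_def B2_def n_def poly_diff poly_mult poly_power q(2)[symmetric] by algebra
          then show "ratfun A B C q / ratfun A' B' C' q = ratfun A2 B2 (C * n) q"
            using nz elim q by (simp add: ratfun_def divide_simps) (simp add: ac_simps)
        qed
      qed
    qed
    then show "has_order g f (ratfun A2 B2 (C * n)) p (Poly_Mapping.lookup (D - E) p)"
      by (simp add: lookup_minus)
  qed
qed

lemma subgroup_principal_divisors: "subgroup (principal_divisors g f) (div0_group g f)"
proof -
  interpret div: comm_group "div0_group g f" by (rule comm_group_div0_group)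
  have zero: "0 \<in> principal_divisors g f"
  proof (rule principal_divisorsI)
    fix p
    have "ratfun 1 0 1 = (\<lambda>_. 1)" by (auto simp: ratfun_def)
    then show "has_order g f (ratfun 1 0 1) p (Poly_Mapping.lookup 0 p)"
      by (simp add: has_order_iff_has_ord has_ord_0I[OF tendsto_const])
  qed (auto simp: carrier_div0_group)
  have sub: "principal_divisors g f \<subseteq> carrier (div0_group g f)"
    unfolding principal_divisors_def by blast
  have neg: "- D \<in> principal_divisors g f" if "D \<in> principal_divisors g f" for D
    using principal_divisors_diff[OF zero that] by simp
  show ?thesis
  proof (rule div.subgroupI)
    fix D E assume "D \<in> principal_divisors g f" "E \<in> principal_divisors g f"
    then show "D \<otimes>\<^bsub>div0_group g f\<^esub> E \<in> principal_divisors g f"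
      using principal_divisors_diff[of D "- E"] neg by simp
  next
    fix D assume "D \<in> principal_divisors g f"
    then show "inv\<^bsub>div0_group g f\<^esub> D \<in> principal_divisors g f"
      using neg sub by (auto simp: inv_div0_group)
  qed (use zero sub in auto)
qed

lemma normal_principal_divisors: "principal_divisors g f \<lhd> div0_group g f"
  using subgroup_principal_divisors comm_group.normal_iff_subgroup[OF comm_group_div0_group] by blast

lemma group_Jac: "group (Jac g f)"
  unfolding Jac_def by (rule normal.factorgroup_is_group[OF normal_principal_divisors])

lemma carrier_Jac: "carrier (Jac g f) = jac_class g f ` carrier (div0_group g f)"
  by (simp add: Jac_def carrier_FactGroup jac_class_def[abs_def])

lemma jac_class_mult:
  assumes "D \<in> carrier (div0_group g f)" "E \<in> carrier (div0_group g f)"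
  shows "jac_class g f D \<otimes>\<^bsub>Jac g f\<^esub> jac_class g f E = jac_class g f (D + E)"
  using normal.rcos_sum[OF normal_principal_divisors assms]
  by (simp add: Jac_def jac_class_def)

lemma jac_class_eqI:
  assumes "D \<in> carrier (div0_group g f)" "E \<in> carrier (div0_group g f)"
    and "D - E \<in> principal_divisors g f"
  shows "jac_class g f D = jac_class g f E"
proof -
  interpret div: comm_group "div0_group g f" by (rule comm_group_div0_group)
  have "D = (D - E) \<otimes>\<^bsub>div0_group g f\<^esub> E" by simp
  then have "D \<in> principal_divisors g f #>\<^bsub>div0_group g f\<^esub> E"
    unfolding r_coset_def using assms(3) by blast
  from div.repr_independence[OF this assms(2) subgroup_principal_divisors]
  show ?thesis by (simp add: jac_class_def)
qed

text \<open>The divisor of \<open>(y - P) / Q\<close>: the zeros of \<open>y - P\<close> over the roots of \<open>Q\<close> cancel one of the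
  two conjugate points in the divisor of \<open>Q\<close>.\<close>

lemma has_order_quotient_Aff:
  assumes f: "f = P\<^sup>2 + smult k (Q * Q')" and nz: "k \<noteq> 0" "Q \<noteq> 0" "Q' \<noteq> 0"
    and on: "b\<^sup>2 = poly f a"
  shows "y_minus_order P (Aff a b) - poly_order Q (Aff a b) =
    Poly_Mapping.lookup (root_divisor P Q' - root_divisor (- P) Q) (Aff a b)"
proof -
  have ord: "order a (f - P\<^sup>2) = order a Q + order a Q'"
    using nz by (simp add: f order_smult order_mult)
  show ?thesis
  proof (cases "poly Q a = 0")
    case False
    then show ?thesis using nz ord
      by (simp add: y_minus_order_def poly_order_def lookup_minus lookup_root_divisor order_0I)
  next
    case True
    then have "b\<^sup>2 = (poly P a)\<^sup>2" using on f by simp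
    then have "b = poly P a \<or> b = - poly P a" by (simp add: power2_eq_iff)
    then show ?thesis using nz ord
      by (auto simp: y_minus_order_def poly_order_def lookup_minus lookup_root_divisor
          ramification_def)
  qed
qed

text \<open>Serves both maps. Only the points at infinity distinguish the odd from the even curve,
  so their orders remain a condition on \<open>D\<close>; the scalar \<open>k\<close> absorbs the
  factor \<open>- w\<close> or \<open>u (n + 1) u n\<close> in the norm.\<close>

lemma quotient_principal:
  assumes f: "f = P\<^sup>2 + smult k (Q * Q')" and nz: "k \<noteq> 0" "Q \<noteq> 0" "Q' \<noteq> 0"
    and dP: "degree P \<le> g + 1" and D: "D \<in> carrier (div0_group g f)"
    and aff: "\<And>a b. Poly_Mapping.lookup D (Aff a b) =
        Poly_Mapping.lookup (root_divisor P Q' - root_divisor (- P) Q) (Aff a b)"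
    and inf: "\<And>s. s\<^sup>2 = coeff f (2 * g + 2) \<Longrightarrow> Poly_Mapping.lookup D (Inf s) =
        y_minus_order P (Inf s) - poly_order Q (Inf s)"
  shows "D \<in> principal_divisors g f"
proof (rule principal_divisorsI[OF D nz(2)])
  show "- P \<noteq> 0 \<or> (1 :: complex poly) \<noteq> 0" by simp
  fix p assume p: "p \<in> completed_curve g f"
  have "has_order g f (\<lambda>q. (snd q - poly P (fst q)) / poly Q (fst q)) p
      (y_minus_order P p - poly_order Q p)"
    using nz dP by (intro has_order_divide p has_order_y_minus has_order_poly) (auto simp: f)
  moreover have "(\<lambda>q. (snd q - poly P (fst q)) / poly Q (fst q)) = ratfun (- P) 1 Q"
    by (auto simp: ratfun_def)
  moreover have "y_minus_order P p - poly_order Q p = Poly_Mapping.lookup D p"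
    using p
  proof (cases rule: completed_curve_cases)
    case (1 a b)
    then show ?thesis using has_order_quotient_Aff[OF f nz 1(2)] aff by simp
  next
    case (2 s)
    then show ?thesis using inf by simp
  qed
  ultimately show "has_order g f (ratfun (- P) 1 Q) p (Poly_Mapping.lookup D p)" by simp
qed

end

section \<open>Local isomorphisms and transport of divisors\<close>

text \<open>Exactly what the transport of orders requires; the condition on the parameter says that
  \<open>m\<close> is unramified at \<open>p\<close>.\<close>

definition local_map ::
    "nat \<Rightarrow> complex poly \<Rightarrow> cpoint \<Rightarrow> complex poly \<Rightarrow> cpoint \<Rightarrow>
      (complex \<times> complex \<Rightarrow> complex \<times> complex) \<Rightarrow> bool" where
  "local_map g f1 p f2 q m \<longleftrightarrow>
     filterlim m (point_filter g f2 q) (point_filter g f1 p) \<and>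
     has_ord (point_filter g f1 p) (local_param g p) (\<lambda>r. local_param g q (m r)) 1"

lemma has_ord_eventually_eq:
  assumes "eventually (\<lambda>r. m r = m' r) F" "has_ord F \<pi> (\<lambda>r. h (m r)) n"
  shows "has_ord F \<pi> (\<lambda>r. h (m' r)) n"
  by (rule has_ord_cong[OF _ assms(2)]) (use assms(1) in eventually_elim, simp)

lemma filterlim_eventually_eq:
  assumes "eventually (\<lambda>r. m r = m' r) F" "filterlim m G F"
  shows "filterlim m' G F"
  using assms(2) filterlim_cong[OF refl refl assms(1)] by blast

lemma local_map_AffI:
  assumes "squarefree f1" "squarefree f2" "b\<^sup>2 = poly f1 a"
    and "\<alpha> * \<delta> - \<beta> * \<gamma> \<noteq> 0" "\<gamma> * a + \<delta> \<noteq> 0"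
    and "\<And>x. \<gamma> * x + \<delta> \<noteq> 0 \<Longrightarrow>
        poly f1 x = (\<gamma> * x + \<delta>) ^ (2 * g + 2) * poly f2 ((\<alpha> * x + \<beta>) / (\<gamma> * x + \<delta>))"
    and "(a', b') = moebius g \<alpha> \<beta> \<gamma> \<delta> (a, b)"
    and eq: "eventually (\<lambda>r. moebius g \<alpha> \<beta> \<gamma> \<delta> r = m r) (at (a, b) within affine_curve f1)"
  shows "b'\<^sup>2 = poly f2 a' \<and> local_map g f1 (Aff a b) f2 (Aff a' b') m"
  using moebius_local[OF assms(1-7)] filterlim_eventually_eq[OF eq]
    has_ord_eventually_eq[OF eq, of _ "local_param g (Aff a' b')"]
  by (simp add: local_map_def)

context hyperelliptic
begin

lemma point_in_completed_curve [simp]: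
  "Aff a b \<in> completed_curve g f \<longleftrightarrow> b\<^sup>2 = poly f a"
  "Inf s \<in> completed_curve g f \<longleftrightarrow> s\<^sup>2 = coeff f (2 * g + 2)"
  by (auto simp: completed_curve_def affine_curve_def)

lemma local_map_to_Inf:
  assumes m: "local_map g f1 p frecip (Aff 0 s) m"
    and eq: "eventually (\<lambda>r. infinity_chart g (m r) = m' r) (point_filter g f1 p)"
    and s: "s\<^sup>2 = coeff f (2 * g + 2)"
  shows "local_map g f1 p f (Inf s) m'"
  unfolding local_map_def
proof
  let ?F = "point_filter g f1 p" and ?G = "at (0, s) within affine_curve frecip"
  have lim: "filterlim m ?G ?F" using m by (simp add: local_map_def)
  have "filterlim (\<lambda>r. infinity_chart g (m r)) (filtermap (infinity_chart g) ?G) ?F"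
    by (rule filterlim_compose[OF _ lim]) (simp add: filterlim_def)
  then show "filterlim m' (point_filter g f (Inf s)) ?F"
    unfolding point_filter_Inf[OF s] by (rule filterlim_eventually_eq[OF eq])
  have "eventually (\<lambda>r. local_param g (Inf s) (infinity_chart g (m r)) =
      local_param g (Aff 0 s) (m r)) ?F"
    using eventually_compose_filterlim[OF eventually_infinity_param[OF s] lim] .
  then have "eventually (\<lambda>r. local_param g (Aff 0 s) (m r) = local_param g (Inf s) (m' r)) ?F"
    using eq by eventually_elim simp
  moreover have "has_ord ?F (local_param g p) (\<lambda>r. local_param g (Aff 0 s) (m r)) 1"
    using m by (simp add: local_map_def)
  ultimately show "has_ord ?F (local_param g p) (\<lambda>r. local_param g (Inf s) (m' r)) 1"
    by (rule has_ord_cong)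
qed

lemma local_map_from_Inf:
  assumes m: "local_map g frecip (Aff 0 s) f2 q m"
    and eq: "eventually (\<lambda>r. m r = m' (infinity_chart g r)) (at (0, s) within affine_curve frecip)"
    and s: "s\<^sup>2 = coeff f (2 * g + 2)"
  shows "local_map g f (Inf s) f2 q m'"
  unfolding local_map_def point_filter_Inf[OF s]
proof
  let ?F = "at (0, s) within affine_curve frecip"
  have "filterlim (\<lambda>r. m' (infinity_chart g r)) (point_filter g f2 q) ?F"
    using m by (intro filterlim_eventually_eq[OF eq]) (simp add: local_map_def)
  then show "filterlim m' (point_filter g f2 q) (filtermap (infinity_chart g) ?F)"
    by (simp add: filterlim_filtermap)
  have "has_ord ?F (local_param g (Aff 0 s)) (\<lambda>r. local_param g q (m' (infinity_chart g r))) 1"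
    using m by (intro has_ord_eventually_eq[OF eq]) (simp add: local_map_def)
  then show "has_ord (filtermap (infinity_chart g) ?F) (local_param g (Inf s))
      (\<lambda>r. local_param g q (m' r)) 1"
    using has_ord_cong_param[OF eventually_infinity_param[OF s]] by (simp add: has_ord_filtermap)
qed

lemma has_order_local_map:
  assumes "p \<in> completed_curve g f" "local_map g f p f2 q m" "has_order g f2 h q n"
  shows "has_order g f (\<lambda>r. h (m r)) p n"
  using assms has_ord_transport[OF _ _ eventually_local_param[OF assms(1)]]
  unfolding has_order_iff_has_ord local_map_def by blast

end

lemma push_divisor_of [simp]: "push_divisor \<Phi> (frag_of p) = frag_of (\<Phi> p)"
  by (simp add: push_divisor_def)

lemma push_divisor_diff: "push_divisor \<Phi> (D - E) = push_divisor \<Phi> D - push_divisor \<Phi> E"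
  by (simp add: push_divisor_def frag_extend_diff)

lemma push_divisor_add: "push_divisor \<Phi> (D + E) = push_divisor \<Phi> D + push_divisor \<Phi> E"
  by (simp add: push_divisor_def frag_extend_add)

lemma push_divisor_0 [simp]: "push_divisor \<Phi> 0 = 0"
  by (simp add: push_divisor_def)

lemma div_deg_push_divisor: "div_deg (push_divisor \<Phi> D) = div_deg D"
  by (rule frag_induction[of D UNIV]) (simp_all add: push_divisor_diff div_deg_diff)

lemma keys_push_divisor: "Poly_Mapping.keys (push_divisor \<Phi> D) \<subseteq> \<Phi> ` Poly_Mapping.keys D"
  using keys_frag_extend[of "\<lambda>p. frag_of (\<Phi> p)" D] by (auto simp: push_divisor_def)

lemma push_divisor_inverse:
  assumes "\<And>p. \<Phi> (\<Psi> p) = p"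
  shows "push_divisor \<Phi> (push_divisor \<Psi> D) = D"
  by (rule frag_induction[of D UNIV]) (simp_all add: push_divisor_diff assms)

lemma lookup_push_divisor:
  assumes "\<And>p. \<Phi> (\<Psi> p) = p" "\<And>p. \<Psi> (\<Phi> p) = p"
  shows "Poly_Mapping.lookup (push_divisor \<Psi> D) p = Poly_Mapping.lookup D (\<Phi> p)"
  by (rule frag_induction[of D UNIV])
    (use assms in \<open>auto simp: push_divisor_diff lookup_minus\<close>)

lemma push_divisor_carrier:
  assumes "\<And>p. p \<in> completed_curve g f1 \<Longrightarrow> \<Phi> p \<in> completed_curve g f2"
    and "D \<in> carrier (div0_group g f1)"
  shows "push_divisor \<Phi> D \<in> carrier (div0_group g f2)"
  using assms keys_push_divisor[of \<Phi> D]
  by (auto simp: carrier_div0_group div_deg_push_divisor)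

text \<open>The polynomial \<open>d\<close> is the denominator of the map \<open>m\<close>, and \<open>tr N A\<close> is the polynomial
  \<open>d^N (A \<circ> m)\<close>.\<close>

lemma pull_principal_divisor:
  assumes h1: "hyperelliptic g f1"
    and inv: "\<And>p. \<Phi> (\<Psi> p) = p" "\<And>p. \<Psi> (\<Phi> p) = p"
    and cc: "\<And>p. p \<in> completed_curve g f1 \<Longrightarrow> \<Phi> p \<in> completed_curve g f2"
      "\<And>p. p \<in> completed_curve g f2 \<Longrightarrow> \<Psi> p \<in> completed_curve g f1"
    and loc: "\<And>p. p \<in> completed_curve g f1 \<Longrightarrow> local_map g f1 p f2 (\<Phi> p) m"
    and d: "d \<noteq> 0"
    and tr: "\<And>N A x y. degree A \<le> N \<Longrightarrow> poly d x \<noteq> 0 \<Longrightarrow>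
        poly (tr N A) x = poly d x ^ N * poly A (fst (m (x, y)))"
    and tr0: "\<And>N A. A \<noteq> 0 \<Longrightarrow> tr N A \<noteq> 0"
    and snd: "\<And>x y. poly d x \<noteq> 0 \<Longrightarrow> snd (m (x, y)) = y / poly d x ^ (g + 1)"
    and E: "E \<in> principal_divisors g f2"
  shows "push_divisor \<Psi> E \<in> principal_divisors g f1"
proof -
  interpret hyperelliptic g f1 by (rule h1)
  obtain A B C where ABC: "C \<noteq> 0" "A \<noteq> 0 \<or> B \<noteq> 0" "E \<in> carrier (div0_group g f2)"
    "\<And>p. p \<in> completed_curve g f2 \<Longrightarrow> has_order g f2 (ratfun A B C) p (Poly_Mapping.lookup E p)"
    using E unfolding principal_divisors_def by blast
  define N where "N = max (degree A) (max (degree B) (degree C))"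
  have N: "degree A \<le> N" "degree B \<le> N" "degree C \<le> N" by (auto simp: N_def)
  \<comment> \<open>Substituting \<open>Y = y / d^(g+1)\<close> and clearing denominators with
    \<open>d^(N+g+1)\<close>: the term with \<open>B\<close> has already used up the factor
    \<open>d^(g+1)\<close>. The bound \<open>N\<close> is common, so that the powers of
    \<open>d\<close> cancel.\<close>
  let ?A = "d ^ (g + 1) * tr N A" and ?B = "tr N B" and ?C = "d ^ (g + 1) * tr N C"
  show ?thesis
  proof (rule principal_divisorsI)
    show "push_divisor \<Psi> E \<in> carrier (div0_group g f1)"
      using cc(2) ABC(3) by (rule push_divisor_carrier)
    show "?C \<noteq> 0" using d ABC(1) tr0 by simp
    show "?A \<noteq> 0 \<or> ?B \<noteq> 0" using d ABC(2) tr0 by auto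
    fix p assume p: "p \<in> completed_curve g f1"
    have "has_order g f1 (\<lambda>r. ratfun A B C (m r)) p (Poly_Mapping.lookup E (\<Phi> p))"
      using p loc[OF p] ABC(4)[OF cc(1)[OF p]] by (rule has_order_local_map)
    then have "has_order g f1 (ratfun ?A ?B ?C) p (Poly_Mapping.lookup E (\<Phi> p))"
    proof (rule has_order_cong[OF p])
      show "eventually (\<lambda>q. q \<in> affine_curve f1 \<longrightarrow> ratfun A B C (m q) = ratfun ?A ?B ?C q)
          (point_filter g f1 p)"
        using eventually_poly_nonzero[OF p d]
      proof eventually_elim
        case (elim q)
        obtain x y where q: "q = (x, y)" by (cases q)
        have dx: "poly d x \<noteq> 0" using elim q by simp
        let ?u = "fst (m (x, y))" and ?v = "poly d x"
        have "ratfun A B C (m q) = (poly A ?u + poly B ?u * (y / ?v ^ (g + 1))) / poly C ?u"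
          using snd[OF dx, of y] by (simp add: ratfun_def case_prod_unfold q)
        also have "\<dots> = (?v ^ (g + 1) * ?v ^ N * (poly A ?u + poly B ?u * (y / ?v ^ (g + 1)))) /
            (?v ^ (g + 1) * ?v ^ N * poly C ?u)"
          using dx by (intro mult_divide_mult_cancel_left[symmetric]) auto
        also have "?v ^ (g + 1) * ?v ^ N * (poly A ?u + poly B ?u * (y / ?v ^ (g + 1))) =
            ?v ^ (g + 1) * (?v ^ N * poly A ?u) + ?v ^ N * poly B ?u * y"
          using dx by (simp add: field_simps)
        also have "(\<dots>) / (?v ^ (g + 1) * ?v ^ N * poly C ?u) = ratfun ?A ?B ?C q"
          using tr[OF N(1) dx, of y] tr[OF N(2) dx, of y] tr[OF N(3) dx, of y]
          by (simp add: ratfun_def q mult.assoc)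
        finally show ?case by simp
      qed
    qed
    then show "has_order g f1 (ratfun ?A ?B ?C) p (Poly_Mapping.lookup (push_divisor \<Psi> E) p)"
      by (simp add: lookup_push_divisor[of \<Phi> \<Psi>, OF inv])
  qed
qed


section \<open>The even curve\<close>

lemma squarefree_pcompose_shift:
  fixes p :: "complex poly"
  assumes "squarefree p"
  shows "squarefree (pcompose p [:s, 1:])"
proof (rule squarefreeI)
  fix d assume d: "d\<^sup>2 dvd pcompose p [:s, 1:]"
  have unshift: "pcompose (pcompose q [:s, 1:]) [:- s, 1:] = q" for q :: "complex poly"
    by (rule poly_eqI_cofinite[of "{}"]) (simp_all add: poly_pcompose)
  from d obtain k where k: "pcompose p [:s, 1:] = d\<^sup>2 * k" by (auto simp: dvd_def)
  have "p = (pcompose d [:- s, 1:])\<^sup>2 * pcompose k [:- s, 1:]"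
    using unshift[of p] unfolding k by (simp add: pcompose_mult power2_eq_square)
  then have "(pcompose d [:- s, 1:])\<^sup>2 dvd p" by simp
  then have "is_unit (pcompose d [:- s, 1:])" using squarefreeD[OF assms] by blast
  moreover have "d \<noteq> 0"
    using k assms unshift[of p] by auto
  ultimately show "is_unit d"
    by (simp add: is_unit_iff_degree pcompose_eq_0_iff degree_pcompose)
qed

text \<open>The even curve is \<open>F(X) = (X - \<sigma>)^(2g+2) f(1/(X - \<sigma>))\<close>. The
  value of \<open>\<sigma>\<close> enters in \<open>coeff_F_subleading\<close>.\<close>

locale odd_even_pair =
  fixes g :: nat and f :: "complex poly" and \<sigma> :: complex and F :: "complex poly"
  assumes sqf_f: "squarefree f" and degree_f: "degree f = 2 * g + 1" and f_0: "coeff f 0 = 1"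
    and F_def: "F = pcompose (recip (2 * g + 2) f) [:- \<sigma>, 1:]"
begin

lemma hyperelliptic_f: "hyperelliptic g f"
  by unfold_locales (simp_all add: sqf_f degree_f)

sublocale dom: hyperelliptic g f by (rule hyperelliptic_f)

lemma poly_F: "poly F x = poly dom.frecip (x - \<sigma>)"
  by (simp add: F_def dom.frecip_def poly_pcompose)

lemma degree_F: "degree F = 2 * g + 2"
proof -
  have "coeff dom.frecip (2 * g + 2) = 1"
    unfolding dom.frecip_def using degree_f f_0 by (subst coeff_recip) auto
  then have "2 * g + 2 \<le> degree dom.frecip" by (intro le_degree) simp
  moreover have "degree dom.frecip \<le> 2 * g + 2"
    unfolding dom.frecip_def using degree_f by (intro degree_recip_le) simp
  ultimately show ?thesis by (simp add: F_def dom.frecip_def degree_pcompose)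
qed

lemma lead_coeff_F: "coeff F (2 * g + 2) = 1"
proof -
  have "degree dom.frecip = 2 * g + 2"
    using degree_F by (simp add: F_def dom.frecip_def degree_pcompose)
  moreover have "coeff dom.frecip (2 * g + 2) = 1"
    unfolding dom.frecip_def using degree_f f_0 by (subst coeff_recip) auto
  moreover have "lead_coeff F = lead_coeff dom.frecip"
    by (simp add: F_def dom.frecip_def lead_coeff_comp)
  ultimately show ?thesis using degree_F by metis
qed

lemma squarefree_F: "squarefree F"
  unfolding F_def using degree_f by (intro squarefree_pcompose_shift squarefree_recip sqf_f) auto

lemma hyperelliptic_F: "hyperelliptic g F"
  by unfold_locales (simp_all add: squarefree_F degree_F)

sublocale cod: hyperelliptic g F by (rule hyperelliptic_F)

lemma coeff_f_top: "coeff f (2 * g + 2) = 0"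
  using degree_f by (simp add: coeff_eq_0)

lemma poly_f_eq: "x \<noteq> 0 \<Longrightarrow> poly f x = x ^ (2 * g + 2) * poly F (1 / x + \<sigma>)"
  by (simp add: poly_F dom.poly_frecip field_simps)

lemma poly_F_eq: "x \<noteq> \<sigma> \<Longrightarrow> poly F x = (x - \<sigma>) ^ (2 * g + 2) * poly f (1 / (x - \<sigma>))"
  by (simp add: poly_F dom.poly_frecip)

text \<open>Both values are 1: the points over \<open>x = 0\<close> on the odd curve match the two
  points at infinity of the even one.\<close>

lemma poly_Frecip_0: "poly cod.frecip 0 = poly f 0"
  using cod.poly_frecip_0 lead_coeff_F f_0 by (metis poly_0_coeff_0)

definition curve_inv :: "complex \<times> complex \<Rightarrow> complex \<times> complex" where
  "curve_inv = (\<lambda>(x, y). (1 / (x - \<sigma>), y / (x - \<sigma>) ^ (g + 1)))"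

text \<open>Over \<open>x = 0\<close> the quotient
  \<open>Y/X^(g+1) = y/(1 + \<sigma> x)^(g+1)\<close> tends to \<open>b\<close>, which gives
  \<open>Inf b\<close>. With \<open>point_inv\<close> this is a bijection of the whole type, so
  \<open>push_divisor\<close> is invertible without conditions on supports.\<close>

definition point_map :: "cpoint \<Rightarrow> cpoint" where
  "point_map p = (case p of
      Aff a b \<Rightarrow> if a = 0 then Inf b else Aff (1 / a + \<sigma>) (b / a ^ (g + 1))
    | Inf s \<Rightarrow> Aff \<sigma> s)"

definition point_inv :: "cpoint \<Rightarrow> cpoint" where
  "point_inv p = (case p of
      Aff a b \<Rightarrow> if a = \<sigma> then Inf b else Aff (1 / (a - \<sigma>)) (b / (a - \<sigma>) ^ (g + 1))
    | Inf s \<Rightarrow> Aff 0 s)"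

lemma point_inv_map [simp]: "point_inv (point_map p) = p"
  by (cases p) (auto simp: point_inv_def point_map_def power_divide)

lemma point_map_inv [simp]: "point_map (point_inv p) = p"
  by (cases p) (auto simp: point_inv_def point_map_def power_divide)

section \<open>The curve map and its inverse as local isomorphisms at every point\<close>

lemma eventually_x_nonzero:
  assumes "p \<in> completed_curve g f"
  shows "eventually (\<lambda>r. fst r \<noteq> 0) (point_filter g f p)"
  using dom.eventually_poly_nonzero[OF assms, of "[:0, 1:]"] by simp

text \<open>One map in three pairs of charts: \<open>X = (\<sigma> x + 1)/x\<close> between affine
  points, \<open>1/X = x/(\<sigma> x + 1)\<close> over \<open>x = 0\<close>, and
  \<open>X = z + \<sigma>\<close> with \<open>z = 1/x\<close> at infinity.\<close>

lemma local_map_forward: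
  assumes p: "p \<in> completed_curve g f"
  shows "point_map p \<in> completed_curve g F \<and> local_map g f p F (point_map p) (curve_map g \<sigma>)"
  using p
proof (cases rule: dom.completed_curve_cases)
  case (1 a b)
  show ?thesis
  proof (cases "a = 0")
    case False
    have "(b / a ^ (g + 1))\<^sup>2 = poly F (1 / a + \<sigma>) \<and>
        local_map g f (Aff a b) F (Aff (1 / a + \<sigma>) (b / a ^ (g + 1))) (curve_map g \<sigma>)"
    proof (rule local_map_AffI[where \<alpha> = \<sigma> and \<beta> = 1 and \<gamma> = 1 and \<delta> = 0])
      show "eventually (\<lambda>r. moebius g \<sigma> 1 1 0 r = curve_map g \<sigma> r) (at (a, b) within affine_curve f)"
        using eventually_x_nonzero[OF p] unfolding 1 point_filter.simps
        by eventually_elim (auto simp: moebius_def curve_map_def field_simps)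
      fix x assume "1 * x + 0 \<noteq> (0 :: complex)"
      moreover have "(\<sigma> * x + 1) / x = 1 / x + \<sigma>" using calculation by (simp add: field_simps)
      ultimately show "poly f x = (1 * x + 0) ^ (2 * g + 2) * poly F ((\<sigma> * x + 1) / (1 * x + 0))"
        using poly_f_eq[of x] by simp
    qed (use False 1(2) in \<open>simp_all add: sqf_f squarefree_F moebius_def field_simps\<close>)
    then show ?thesis using False 1 by (simp add: point_map_def)
  next
    case True
    have "b\<^sup>2 = poly cod.frecip 0 \<and>
        local_map g f (Aff a b) cod.frecip (Aff 0 b) (moebius g 1 0 \<sigma> 1)"
    proof (rule local_map_AffI[where \<alpha> = 1 and \<beta> = 0 and \<gamma> = \<sigma> and \<delta> = 1])
      fix x assume x: "\<sigma> * x + 1 \<noteq> 0"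
      show "poly f x = (\<sigma> * x + 1) ^ (2 * g + 2) * poly cod.frecip ((1 * x + 0) / (\<sigma> * x + 1))"
      proof (cases "x = 0")
        case True
        then show ?thesis by (simp add: poly_Frecip_0)
      next
        case False
        have "(\<sigma> * x + 1) / x = 1 / x + \<sigma>" using False by (simp add: field_simps)
        then show ?thesis using False x poly_f_eq[OF False]
          by (simp add: cod.poly_frecip power_divide)
      qed
    qed (use True 1(2) in \<open>simp_all add: sqf_f cod.squarefree_frecip moebius_def\<close>)
    moreover have "b\<^sup>2 = coeff F (2 * g + 2)"
      using True 1(2) poly_Frecip_0 by (simp only: cod.poly_frecip_0)
    moreover have "eventually (\<lambda>r. infinity_chart g (moebius g 1 0 \<sigma> 1 r) = curve_map g \<sigma> r)
        (point_filter g f (Aff a b))"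
    proof -
      have "((\<lambda>r. \<sigma> * fst r + 1) \<longlongrightarrow> \<sigma> * a + 1) (at (a, b) within affine_curve f)"
        by (intro tendsto_intros tendsto_fst_curve)
      then have "eventually (\<lambda>r. \<sigma> * fst r + 1 \<noteq> 0) (at (a, b) within affine_curve f)"
        by (rule tendsto_imp_eventually_ne) (simp add: True)
      then show ?thesis
        using eventually_x_nonzero[OF p] unfolding 1 point_filter.simps
      proof eventually_elim
        case (elim r)
        then have "(\<sigma> * fst r + 1) / fst r = 1 / fst r + \<sigma>" by (simp add: field_simps)
        then show ?case using elim
          by (simp add: infinity_chart_def moebius_def curve_map_def case_prod_unfold power_divide)
      qed
    qed
    ultimately have "local_map g f (Aff a b) F (Inf b) (curve_map g \<sigma>)"
      using cod.local_map_to_Inf by blast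
    then show ?thesis using True 1(1) \<open>b\<^sup>2 = coeff F (2 * g + 2)\<close>
      by (simp add: point_map_def)
  qed
next
  case (2 s)
  have "s\<^sup>2 = poly F \<sigma> \<and>
      local_map g dom.frecip (Aff 0 s) F (Aff \<sigma> s) (moebius g 1 \<sigma> 0 1)"
  proof (rule local_map_AffI[where \<alpha> = 1 and \<beta> = \<sigma> and \<gamma> = 0 and \<delta> = 1])
    show "s\<^sup>2 = poly dom.frecip 0" using 2(2) by (simp only: dom.poly_frecip_0)
  qed (simp_all add: squarefree_F dom.squarefree_frecip moebius_def poly_F)
  moreover have "eventually (\<lambda>r. moebius g 1 \<sigma> 0 1 r = curve_map g \<sigma> (infinity_chart g r))
      (at (0, s) within affine_curve dom.frecip)"
  proof -
    have "eventually (\<lambda>r. fst r \<noteq> 0) (at (0, s) within affine_curve dom.frecip)"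
      using 2(2) by (intro eventually_x_neq) (simp only: dom.poly_frecip_0)
    then show ?thesis
      by eventually_elim (auto simp: moebius_def infinity_chart_def curve_map_def field_simps)
  qed
  ultimately show ?thesis
    using dom.local_map_from_Inf[OF _ _ 2(2)] 2(1) by (auto simp: point_map_def)
qed

text \<open>The matrices are the inverses, up to a scalar, of those in
  \<open>local_map_forward\<close>.\<close>

lemma local_map_backward:
  assumes p: "p \<in> completed_curve g F"
  shows "point_inv p \<in> completed_curve g f \<and> local_map g F p f (point_inv p) curve_inv"
  using p
proof (cases rule: cod.completed_curve_cases)
  case (1 a b)
  show ?thesis
  proof (cases "a = \<sigma>")
    case False
    have "(b / (a - \<sigma>) ^ (g + 1))\<^sup>2 = poly f (1 / (a - \<sigma>)) \<and>
        local_map g F (Aff a b) f (Aff (1 / (a - \<sigma>)) (b / (a - \<sigma>) ^ (g + 1))) curve_inv"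
    proof (rule local_map_AffI[where \<alpha> = 0 and \<beta> = 1 and \<gamma> = 1 and \<delta> = "- \<sigma>"])
      show "eventually (\<lambda>r. moebius g 0 1 1 (- \<sigma>) r = curve_inv r) (at (a, b) within affine_curve F)"
        by (simp add: moebius_def curve_inv_def)
    qed (use False 1(2) in \<open>simp_all add: sqf_f squarefree_F moebius_def poly_F_eq\<close>)
    then show ?thesis using False 1 by (simp add: point_inv_def)
  next
    case True
    have "b\<^sup>2 = poly dom.frecip 0 \<and>
        local_map g F (Aff a b) dom.frecip (Aff 0 b) (moebius g 1 (- \<sigma>) 0 1)"
      by (rule local_map_AffI[where \<alpha> = 1 and \<beta> = "- \<sigma>" and \<gamma> = 0 and \<delta> = 1])
        (use True 1(2) in \<open>simp_all add: squarefree_F dom.squarefree_frecip moebius_def poly_F\<close>)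
    moreover have "b\<^sup>2 = coeff f (2 * g + 2)"
      using calculation by (simp only: dom.poly_frecip_0)
    moreover have "eventually (\<lambda>r. infinity_chart g (moebius g 1 (- \<sigma>) 0 1 r) = curve_inv r)
        (point_filter g F (Aff a b))"
      by (simp add: moebius_def curve_inv_def infinity_chart_def case_prod_unfold)
    ultimately have "local_map g F (Aff a b) f (Inf b) curve_inv"
      using dom.local_map_to_Inf by blast
    then show ?thesis using True 1(1) \<open>b\<^sup>2 = coeff f (2 * g + 2)\<close>
      by (simp add: point_inv_def)
  qed
next
  case (2 s)
  have "s\<^sup>2 = poly f 0 \<and>
      local_map g cod.frecip (Aff 0 s) f (Aff 0 s) (moebius g 1 0 (- \<sigma>) 1)"
  proof (rule local_map_AffI[where \<alpha> = 1 and \<beta> = 0 and \<gamma> = "- \<sigma>" and \<delta> = 1])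
    show "s\<^sup>2 = poly cod.frecip 0" using 2(2) by (simp only: cod.poly_frecip_0)
    fix x assume x: "- \<sigma> * x + 1 \<noteq> 0"
    show "poly cod.frecip x = (- \<sigma> * x + 1) ^ (2 * g + 2) * poly f ((1 * x + 0) / (- \<sigma> * x + 1))"
    proof (cases "x = 0")
      case True
      then show ?thesis by (simp add: poly_Frecip_0)
    next
      case False
      have "1 / x - \<sigma> = (- \<sigma> * x + 1) / x" using False by (simp add: field_simps)
      moreover have "1 / x \<noteq> \<sigma>" using x False by (auto simp: field_simps)
      ultimately show ?thesis using False x
        by (simp add: cod.poly_frecip poly_F_eq power_divide)
    qed
  qed (simp_all add: sqf_f cod.squarefree_frecip moebius_def)
  moreover have "eventually (\<lambda>r. moebius g 1 0 (- \<sigma>) 1 r = curve_inv (infinity_chart g r))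
      (at (0, s) within affine_curve cod.frecip)"
  proof -
    have "eventually (\<lambda>r. fst r \<noteq> 0) (at (0, s) within affine_curve cod.frecip)"
      using 2(2) by (intro eventually_x_neq) (simp only: cod.poly_frecip_0)
    moreover have "((\<lambda>r. - \<sigma> * fst r + 1) \<longlongrightarrow> - \<sigma> * 0 + 1) (at (0, s) within affine_curve cod.frecip)"
      by (intro tendsto_intros tendsto_fst_curve)
    then have "eventually (\<lambda>r. - \<sigma> * fst r + 1 \<noteq> 0) (at (0, s) within affine_curve cod.frecip)"
      by (rule tendsto_imp_eventually_ne) simp
    ultimately show ?thesis
    proof eventually_elim
      case (elim r)
      have "1 / fst r - \<sigma> = (- \<sigma> * fst r + 1) / fst r" using elim by (simp add: field_simps)
      then show ?case using elim
        by (simp add: moebius_def infinity_chart_def curve_inv_def case_prod_unfold power_divide)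
    qed
  qed
  ultimately show ?thesis
    using cod.local_map_from_Inf[OF _ _ 2(2)] 2(1) by (auto simp: point_inv_def)
qed

lemma point_map_completed: "p \<in> completed_curve g f \<Longrightarrow> point_map p \<in> completed_curve g F"
  using local_map_forward by blast

lemma point_inv_completed: "p \<in> completed_curve g F \<Longrightarrow> point_inv p \<in> completed_curve g f"
  using local_map_backward by blast

lemma extends_to_completion_curve_map:
  "extends_to_completion g f F (curve_map g \<sigma>) point_map"
  unfolding extends_to_completion_def
proof (intro conjI ballI)
  show "bij_betw point_map (completed_curve g f) (completed_curve g F)"
    by (rule bij_betw_byWitness[where f' = point_inv])
      (auto intro: point_map_completed point_inv_completed)
qed (use local_map_forward in \<open>auto simp: local_map_def\<close>)

text \<open>Pushing forward along \<open>point_map\<close> is pulling functions back along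
  \<open>curve_inv\<close>, so the inverse maps play the roles of \<open>\<Phi>\<close> and
  \<open>m\<close>; the cleared polynomials are
  \<open>(X - \<sigma>)^N A(1/(X - \<sigma>))\<close>.\<close>

lemma push_principal_forward:
  assumes "D \<in> principal_divisors g f"
  shows "push_divisor point_map D \<in> principal_divisors g F"
proof (rule pull_principal_divisor[where \<Phi> = point_inv and m = curve_inv and d = "[:- \<sigma>, 1:]"
      and tr = "\<lambda>N A. pcompose (recip N A) [:- \<sigma>, 1:]", OF hyperelliptic_F _ _ _ _ _ _ _ _ _ assms])
  fix N x y and A :: "complex poly" assume "degree A \<le> N" "poly [:- \<sigma>, 1:] x \<noteq> 0"
  then show "poly (pcompose (recip N A) [:- \<sigma>, 1:]) x =
      poly [:- \<sigma>, 1:] x ^ N * poly A (fst (curve_inv (x, y)))"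
    by (simp add: poly_pcompose poly_recip curve_inv_def)
qed (use local_map_backward point_map_completed in
    \<open>auto simp: curve_inv_def pcompose_eq_0_iff\<close>)

lemma push_principal_backward:
  assumes "D \<in> principal_divisors g F"
  shows "push_divisor point_inv D \<in> principal_divisors g f"
proof (rule pull_principal_divisor[where \<Phi> = point_map and m = "curve_map g \<sigma>" and d = "[:0, 1:]"
      and tr = "\<lambda>N A. recip N (pcompose A [:\<sigma>, 1:])", OF hyperelliptic_f _ _ _ _ _ _ _ _ _ assms])
  fix N x y and A :: "complex poly" assume "degree A \<le> N" "poly [:0, 1:] x \<noteq> (0 :: complex)"
  then show "poly (recip N (pcompose A [:\<sigma>, 1:])) x =
      poly [:0, 1:] x ^ N * poly A (fst (curve_map g \<sigma> (x, y)))"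
    by (simp add: poly_pcompose poly_recip curve_map_def degree_pcompose add.commute)
qed (use local_map_forward point_inv_completed in
    \<open>auto simp: curve_map_def pcompose_eq_0_iff\<close>)

section \<open>The induced isomorphism of Jacobians\<close>

definition jac_map :: "(cpoint \<Rightarrow>\<^sub>0 int) set \<Rightarrow> (cpoint \<Rightarrow>\<^sub>0 int) set" where
  "jac_map z = push_divisor point_map ` z"

lemma push_iso: "push_divisor point_map \<in> iso (div0_group g f) (div0_group g F)"
proof -
  have "push_divisor point_map \<in> hom (div0_group g f) (div0_group g F)"
    by (rule homI) (auto simp: push_divisor_add intro: push_divisor_carrier[OF point_map_completed])
  moreover have "bij_betw (push_divisor point_map) (carrier (div0_group g f)) (carrier (div0_group g F))"
    by (rule bij_betw_byWitness[where f' = "push_divisor point_inv"])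
      (auto simp: push_divisor_inverse intro: push_divisor_carrier[OF point_map_completed]
        push_divisor_carrier[OF point_inv_completed])
  ultimately show ?thesis by (simp add: iso_def)
qed

lemma push_principal: "push_divisor point_map ` principal_divisors g f = principal_divisors g F"
proof (intro equalityI subsetI)
  fix D assume "D \<in> principal_divisors g F"
  then show "D \<in> push_divisor point_map ` principal_divisors g f"
    using push_principal_backward push_divisor_inverse[of point_map point_inv D]
    by (metis imageI point_map_inv)
qed (use push_principal_forward in auto)

lemma jac_map_iso: "jac_map \<in> iso (Jac g f) (Jac g F)"
  unfolding jac_map_def[abs_def] Jac_def
  by (intro FactGroup_iso_image push_iso push_principal dom.normal_principal_divisors
      cod.normal_principal_divisors comm_group.axioms(2) comm_group_div0_group)

lemma jac_map_class:
  assumes "D \<in> carrier (div0_group g f)"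
  shows "jac_map (jac_class g f D) = jac_class g F (push_divisor point_map D)"
  unfolding jac_map_def jac_class_def
  by (intro FactGroup_iso_image push_iso push_principal dom.normal_principal_divisors
      cod.normal_principal_divisors comm_group.axioms(2) comm_group_div0_group assms)

section \<open>Comparison of the two shift classes\<close>

lemma volterra_shift_div: "frag_of (Aff 0 (- 1)) - frag_of (Inf 0) \<in> carrier (div0_group g f)"
  using Poly_Mapping.keys_diff[of "frag_of (Aff 0 (- 1))" "frag_of (Inf 0)"] coeff_f_top f_0
  by (auto simp: carrier_div0_group div_deg_diff poly_0_coeff_0)

lemma jfrac_shift_div: "frag_of (Inf (- 1)) - frag_of (Inf 1) \<in> carrier (div0_group g F)"
  using Poly_Mapping.keys_diff[of "frag_of (Inf (- 1))" "frag_of (Inf 1)"] lead_coeff_F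
  by (auto simp: carrier_div0_group div_deg_diff)

lemma double_shift:
  "jac_map (volterra_shift g f \<otimes>\<^bsub>Jac g f\<^esub> volterra_shift g f) = jfrac_shift g F"
proof -
  let ?D = "frag_of (Aff 0 (- 1)) - frag_of (Inf 0) :: cpoint \<Rightarrow>\<^sub>0 int"
  let ?E = "frag_of (Aff 0 (- 1)) - frag_of (Aff 0 1) :: cpoint \<Rightarrow>\<^sub>0 int"
  interpret div: comm_group "div0_group g f" by (rule comm_group_div0_group)
  have DD: "?D + ?D \<in> carrier (div0_group g f)"
    using div.m_closed[OF volterra_shift_div volterra_shift_div] by simp
  have E: "?E \<in> carrier (div0_group g f)"
    using Poly_Mapping.keys_diff[of "frag_of (Aff 0 (- 1))" "frag_of (Aff 0 1)"] f_0
    by (auto simp: carrier_div0_group div_deg_diff poly_0_coeff_0)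
  have "(?D + ?D) - ?E \<in> principal_divisors g f"
  proof (rule dom.principal_divisorsI[where A = "[:0, 1:]" and B = 0 and C = 1])
    show "(?D + ?D) - ?E \<in> carrier (div0_group g f)"
      using DD E by (rule div0_group_diff)
    fix p assume p: "p \<in> completed_curve g f"
    have "has_order g f (\<lambda>q. poly [:0, 1:] (fst q)) p (dom.poly_order [:0, 1:] p)"
      by (rule dom.has_order_poly[OF p]) simp
    moreover have "dom.poly_order [:0, 1:] p = Poly_Mapping.lookup ((?D + ?D) - ?E) p"
      using p
    proof (cases rule: dom.completed_curve_cases)
      case (1 a b)
      show ?thesis
      proof (cases "a = 0")
        case True
        then have "b = 1 \<or> b = - 1"
          using 1(2) f_0 by (simp add: poly_0_coeff_0 power2_eq_1_iff)
        moreover have "order 0 [:0, 1 :: complex:] = 1"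
          using order_power_n_n[of "0 :: complex" 1] by simp
        ultimately show ?thesis using True 1(1)
          by (auto simp: dom.poly_order_def lookup_minus lookup_add ramification_def)
      next
        case False
        then show ?thesis using 1(1)
          by (simp add: dom.poly_order_def lookup_minus lookup_add order_0I)
      qed
    next
      case (2 s)
      then show ?thesis using coeff_f_top
        by (simp add: dom.poly_order_def lookup_minus lookup_add ramification_def)
    qed
    moreover have "ratfun [:0, 1:] 0 1 = (\<lambda>q. poly [:0, 1:] (fst q))"
      by (auto simp: ratfun_def)
    ultimately show "has_order g f (ratfun [:0, 1:] 0 1) p (Poly_Mapping.lookup ((?D + ?D) - ?E) p)"
      by simp
  qed simp_all
  then have "volterra_shift g f \<otimes>\<^bsub>Jac g f\<^esub> volterra_shift g f = jac_class g f ?E"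
    using dom.jac_class_eqI[OF DD E] dom.jac_class_mult[OF volterra_shift_div volterra_shift_div]
    by (simp add: volterra_shift_def)
  also have "jac_map \<dots> = jfrac_shift g F"
    by (simp add: jac_map_class[OF E] push_divisor_diff point_map_def jfrac_shift_def)
  finally show ?thesis .
qed

lemma volterra_shift_carrier: "volterra_shift g f \<in> carrier (Jac g f)"
  unfolding volterra_shift_def dom.carrier_Jac by (rule imageI) (rule volterra_shift_div)

lemma jfrac_shift_carrier: "jfrac_shift g F \<in> carrier (Jac g F)"
  unfolding jfrac_shift_def cod.carrier_Jac by (rule imageI) (rule jfrac_shift_div)

lemma jac_map_double_translation:
  assumes z: "z \<in> carrier (Jac g f)"
  shows "jac_map (translation (Jac g f) (volterra_shift g f)
      (translation (Jac g f) (volterra_shift g f) z)) =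
    translation (Jac g F) (jfrac_shift g F) (jac_map z)"
proof -
  interpret J: group "Jac g f" by (rule dom.group_Jac)
  note s = volterra_shift_carrier
  have "jac_map (z \<otimes>\<^bsub>Jac g f\<^esub> (volterra_shift g f \<otimes>\<^bsub>Jac g f\<^esub> volterra_shift g f)) =
      jac_map z \<otimes>\<^bsub>Jac g F\<^esub> jfrac_shift g F"
    using jac_map_iso z s hom_mult[of jac_map "Jac g f" "Jac g F" z]
    by (simp add: iso_def double_shift)
  then show ?thesis using z s by (simp add: translation_def J.m_assoc)
qed

lemma birational_curve_map: "birational_equivalence f F (curve_map g \<sigma>)"
  unfolding birational_equivalence_def
proof (intro exI conjI)
  let ?U = "{p \<in> affine_curve f. fst p \<noteq> 0}" and ?V = "{p \<in> affine_curve F. fst p \<noteq> \<sigma>}"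
  let ?\<phi> = "curve_map g \<sigma>"
  have fin: "finite {p \<in> affine_curve h. fst p = a}" for h a
  proof -
    have "{y. y\<^sup>2 = poly h a} = {y. poly [:- poly h a, 0, 1:] y = 0}"
      by (auto simp: power2_eq_square)
    also have "finite \<dots>" by (rule poly_roots_finite) simp
    finally have "finite (Pair a ` {y. y\<^sup>2 = poly h a})" by blast
    then show ?thesis by (rule finite_subset[rotated]) (auto simp: affine_curve_def)
  qed
  show "?U \<subseteq> affine_curve f" "?V \<subseteq> affine_curve F" by auto
  show "finite (affine_curve f - ?U)" by (rule finite_subset[OF _ fin[of f 0]]) auto
  show "finite (affine_curve F - ?V)" by (rule finite_subset[OF _ fin[of F \<sigma>]]) auto
  show "rational_on ?U (fst \<circ> ?\<phi>)" unfolding rational_on_def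
    by (rule exI[of _ "[:1, \<sigma>:]"], rule exI[of _ 0], rule exI[of _ "[:0, 1:]"])
      (auto simp: ratfun_def curve_map_def field_simps)
  show "rational_on ?U (snd \<circ> ?\<phi>)" unfolding rational_on_def
    by (rule exI[of _ 0], rule exI[of _ 1], rule exI[of _ "[:0, 1:] ^ (g + 1)"])
      (auto simp: ratfun_def curve_map_def)
  show "rational_on ?V (fst \<circ> curve_inv)" unfolding rational_on_def
    by (rule exI[of _ 1], rule exI[of _ 0], rule exI[of _ "[:- \<sigma>, 1:]"])
      (auto simp: ratfun_def curve_inv_def)
  show "rational_on ?V (snd \<circ> curve_inv)" unfolding rational_on_def
    by (rule exI[of _ 0], rule exI[of _ 1], rule exI[of _ "[:- \<sigma>, 1:] ^ Suc g"])
      (auto simp: ratfun_def curve_inv_def poly_power simp del: power_Suc)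
  have *: "?\<phi> p \<in> ?V \<and> curve_inv (?\<phi> p) = p" if "p \<in> ?U" for p
  proof -
    obtain x y where p: "p = (x, y)" by (cases p)
    have xy: "x \<noteq> 0" "y\<^sup>2 = poly f x" using that p by (auto simp: affine_curve_def)
    have "(y / x ^ (g + 1))\<^sup>2 = poly F (1 / x + \<sigma>)"
      using xy power_Suc_square[of x g] poly_f_eq[of x] by (simp add: power_divide)
    then show ?thesis using xy p
      by (simp add: affine_curve_def curve_map_def curve_inv_def power_divide)
  qed
  have **: "curve_inv q \<in> ?U \<and> ?\<phi> (curve_inv q) = q" if "q \<in> ?V" for q
  proof -
    obtain x y where q: "q = (x, y)" by (cases q)
    have xy: "x \<noteq> \<sigma>" "y\<^sup>2 = poly F x" using that q by (auto simp: affine_curve_def)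
    have "(y / (x - \<sigma>) ^ (g + 1))\<^sup>2 = poly f (1 / (x - \<sigma>))"
      using xy power_Suc_square[of "x - \<sigma>" g] poly_F_eq[of x] by (simp add: power_divide)
    then show ?thesis using xy q
      by (simp add: affine_curve_def curve_map_def curve_inv_def power_divide)
  qed
  show "?\<phi> ` ?U = ?V" using * ** by (metis (no_types, lifting) image_subset_iff subset_antisym image_eqI subsetI)
  show "curve_inv ` ?V = ?U" using * ** by (metis (no_types, lifting) image_subset_iff subset_antisym image_eqI subsetI)
  show "\<forall>p\<in>?U. curve_inv (?\<phi> p) = p" "\<forall>q\<in>?V. ?\<phi> (curve_inv q) = q"
    using * ** by auto
qed

end

section \<open>The polynomial part of the square root\<close>

lemma coeff_mult_top:
  fixes p q :: "complex poly"
  assumes "degree p \<le> m" "degree q \<le> n"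
  shows "coeff (p * q) (m + n) = coeff p m * coeff q n"
proof (cases "degree p = m \<and> degree q = n")
  case True
  then show ?thesis using coeff_mult_degree_sum[of p q] by simp
next
  case False
  then have "degree p < m \<or> degree q < n" using assms by auto
  then have "degree (p * q) < m + n" using degree_mult_le[of p q] assms by linarith
  then show ?thesis using False assms by (auto simp: coeff_eq_0)
qed

text \<open>In \<open>(P - A)(P + A)\<close> the second factor has leading coefficient 2. Thus the
  highest coefficient in which \<open>P\<close> and \<open>A\<close> may differ can be read off the
  difference of squares.\<close>

lemma coeff_diff_squares:
  fixes P A :: "complex poly"
  assumes "degree P \<le> m" "degree A \<le> m" "coeff P m = 1" "coeff A m = 1" "degree (P - A) \<le> n"
  shows "coeff (P\<^sup>2 - A\<^sup>2) (n + m) = 2 * (coeff P n - coeff A n)"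
proof -
  have "P\<^sup>2 - A\<^sup>2 = (P - A) * (P + A)" by (simp add: power2_eq_square algebra_simps)
  then show ?thesis
    using coeff_mult_top[OF assms(5) degree_add_le[OF assms(1,2)]] assms(3,4) by simp
qed

lemma degree_diff_Suc:
  assumes "degree p \<le> Suc n" "degree q \<le> Suc n" "coeff p (Suc n) = coeff q (Suc n)"
  shows "degree (p - q) \<le> n"
proof (rule degree_le, intro allI impI)
  fix i assume "n < i"
  then show "coeff (p - q) i = 0"
    using assms by (cases "i = Suc n") (auto simp: coeff_eq_0)
qed

text \<open>The polynomial part of the square root, one coefficient per step. Adding
  \<open>c X^i\<close> to the monic \<open>A\<close> changes \<open>A^2\<close> by
  \<open>2 c X^(i+m)\<close> and lower terms, so half of the offending coefficient removes it
  without disturbing the higher ones.\<close>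

lemma poly_sqrt_approx:
  fixes F :: "complex poly"
  assumes "degree F = 2 * m" "lead_coeff F = 1" "j \<le> m"
  shows "\<exists>A. degree A = m \<and> lead_coeff A = 1 \<and> (\<forall>k\<ge>2 * m - j. coeff (F - A\<^sup>2) k = 0)"
  using assms(3)
proof (induction j)
  case 0
  show ?case
  proof (intro exI[of _ "monom 1 m"] conjI allI impI)
    fix k assume "k \<ge> 2 * m - 0"
    moreover have "(monom 1 m :: complex poly)\<^sup>2 = monom 1 (2 * m)"
      by (simp add: power2_eq_square mult_monom mult_2)
    ultimately show "coeff (F - (monom 1 m)\<^sup>2) k = 0"
      using assms(1,2) by (cases "k = 2 * m") (auto simp: coeff_eq_0)
  qed (simp_all add: degree_monom_eq)
next
  case (Suc j)
  then obtain A where A: "degree A = m" "lead_coeff A = 1"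
    "\<And>k. k \<ge> 2 * m - j \<Longrightarrow> coeff (F - A\<^sup>2) k = 0" by auto
  define i where "i = m - Suc j"
  have m: "m = i + Suc j" using Suc.prems by (simp add: i_def)
  define c where "c = coeff (F - A\<^sup>2) (i + m) / 2"
  define A' where "A' = A + monom c i"
  have dc: "degree (monom c i) < m" using degree_monom_le[of c i] m by simp
  have "degree A' = m" unfolding A'_def using dc A(1) by (subst degree_add_eq_left) auto
  moreover have "coeff A' m = 1" using A m by (simp add: A'_def coeff_monom)
  moreover have "coeff (F - A'\<^sup>2) k = 0" if k: "k \<ge> 2 * m - Suc j" for k
  proof -
    have dbl: "smult 2 p = p + p" for p :: "complex poly"
      by (metis one_add_one smult_1_left smult_add_left)
    have eq: "F - A'\<^sup>2 = (F - A\<^sup>2) - smult 2 (monom c i * A) - monom (c\<^sup>2) (i + i)"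
      unfolding dbl by (simp add: A'_def power2_eq_square algebra_simps mult_monom)
    have "k \<noteq> i + i" using k m by simp
    moreover have "coeff (monom c i * A) k = c * coeff A (k - i)"
      using k m by (simp add: coeff_monom_mult)
    ultimately have *: "coeff (F - A'\<^sup>2) k = coeff (F - A\<^sup>2) k - 2 * (c * coeff A (k - i))"
      unfolding eq by simp
    show ?thesis
    proof (cases "k = i + m")
      case True
      then show ?thesis using * A by (simp add: c_def)
    next
      case False
      then have "k \<ge> 2 * m - j" "k - i > degree A" using k m A(1) by auto
      then show ?thesis using * A(3) by (simp add: coeff_eq_0)
    qed
  qed
  ultimately show ?case by auto
qed

text \<open>The two highest terms of the binomial expansion, obtained by splitting off the constant
  coefficient, which affects neither of them for \<open>n > 0\<close>.\<close>

lemma coeff_pcompose_shift: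
  fixes p :: "complex poly"
  assumes "degree p \<le> Suc n"
  shows "coeff (pcompose p [:s, 1:]) n = coeff p n + of_nat (Suc n) * s * coeff p (Suc n) \<and>
    coeff (pcompose p [:s, 1:]) (Suc n) = coeff p (Suc n)"
  using assms
proof (induction n arbitrary: p)
  case 0
  obtain a q where p: "p = pCons a q" by (cases p)
  then have "degree q = 0" using 0 by (cases "q = 0") auto
  then obtain b where q: "q = [:b:]" by (rule degree_eq_zeroE)
  show ?case by (simp add: p q pcompose_pCons)
next
  case (Suc n)
  obtain a q where p: "p = pCons a q" by (cases p)
  then have dq: "degree q \<le> Suc n" using Suc.prems by (cases "q = 0") auto
  then have "coeff (pcompose q [:s, 1:]) (Suc (Suc n)) = 0"
    by (intro coeff_eq_0) (simp add: degree_pcompose)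
  then show ?case using Suc.IH[OF dq]
    by (simp add: p pcompose_pCons coeff_pCons algebra_simps)
qed

context odd_even_pair
begin

text \<open>Reversal makes the linear coefficient of \<open>f\<close> the subleading one, and the
  shift subtracts \<open>(2 g + 2) \<sigma>\<close> from it. This is the origin of the constant
  \<open>\<sigma>\<close>.\<close>

lemma coeff_F_subleading:
  assumes "\<sigma> = coeff f 1 / (2 * (of_nat g + 1))"
  shows "coeff F (2 * g + 1) = 0"
proof -
  let ?h = "recip (2 * g + 2) f"
  have dh: "degree ?h \<le> Suc (2 * g + 1)"
    using degree_recip_le[of f "2 * g + 2"] degree_f by simp
  have "coeff ?h (2 * g + 1) = coeff f 1" "coeff ?h (Suc (2 * g + 1)) = 1"
    using degree_f f_0 by (simp_all add: coeff_recip)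
  then have "coeff F (2 * g + 1) = coeff f 1 + of_nat (Suc (2 * g + 1)) * (- \<sigma>)"
    using coeff_pcompose_shift[OF dh, of "- \<sigma>"] unfolding F_def by simp
  also have "of_nat (Suc (2 * g + 1)) * (- \<sigma>) = - (2 * (of_nat g + 1) * \<sigma>)"
    by (simp add: algebra_simps)
  also have "2 * (of_nat g + 1) * \<sigma> = coeff f 1"
  proof -
    have "of_nat (Suc g) \<noteq> (0 :: complex)" by (rule of_nat_neq_0)
    then have "of_nat g + 1 \<noteq> (0 :: complex)" by (simp add: add.commute)
    then have "2 * (of_nat g + 1) \<noteq> (0 :: complex)" by (intro no_zero_divisors) simp_all
    then show ?thesis unfolding assms
      by (metis nonzero_mult_div_cancel_left times_divide_eq_right)
  qed
  finally show ?thesis by simp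
qed

text \<open>\<open>A\<close> is the polynomial part of the square root of \<open>F\<close>.
  Comparing \<open>A^2\<close> with \<open>X^(2g+2)\<close> at \<open>X^(2g+1)\<close> shows that
  \<open>A\<close> has no term in \<open>X^g\<close>; and \<open>R = 0\<close> would make
  \<open>F\<close> a square.\<close>

lemma ex_jfrac_curve:
  assumes "\<sigma> = coeff f 1 / (2 * (of_nat g + 1))"
  shows "\<exists>A R. jfrac_curve g F A R"
proof -
  obtain A where A: "degree A = g + 1" "lead_coeff A = 1"
    "\<And>k. k \<ge> g + 1 \<Longrightarrow> coeff (F - A\<^sup>2) k = 0"
    using poly_sqrt_approx[of F "g + 1" "g + 1"] degree_F lead_coeff_F by auto
  let ?R = "smult (1 / 4) (F - A\<^sup>2)"
  have "coeff A g = 0"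
  proof -
    let ?M = "monom 1 (g + 1) :: complex poly"
    have d: "degree (A - ?M) \<le> g"
      by (rule degree_diff_Suc) (use A in \<open>auto simp: degree_monom_eq\<close>)
    have "coeff (A\<^sup>2 - ?M\<^sup>2) (g + (g + 1)) = 2 * (coeff A g - coeff ?M g)"
      by (rule coeff_diff_squares[OF _ _ _ _ d]) (use A in \<open>auto simp: degree_monom_eq\<close>)
    then have "coeff (A\<^sup>2) (2 * g + 1) - coeff (?M\<^sup>2) (2 * g + 1) = 2 * coeff A g"
      by (simp add: mult_2[of g, symmetric])
    moreover have "coeff (A\<^sup>2) (2 * g + 1) = coeff F (2 * g + 1)"
      using A(3)[of "2 * g + 1"] by simp
    moreover have "?M\<^sup>2 = monom 1 (2 * g + 2)"
      by (simp add: power2_eq_square mult_monom mult_2)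
    ultimately show ?thesis using coeff_F_subleading[OF assms] by simp
  qed
  moreover have "?R \<noteq> 0"
  proof
    assume "?R = 0"
    then have "A\<^sup>2 dvd F" by simp
    then have "is_unit A" using squarefreeD[OF squarefree_F] by blast
    then show False using A(1) is_unit_iff_degree[of A] by (cases "A = 0") auto
  qed
  moreover have "degree ?R \<le> g"
    by (rule degree_le) (use A(3) in auto)
  moreover have "F = A\<^sup>2 + smult 4 ?R" by simp
  ultimately show ?thesis using A unfolding jfrac_curve_def by blast
qed

end


section \<open>Orbits of the J-fraction map\<close>

lemma root_divisor_cong:
  assumes "\<And>a. poly Q a = 0 \<Longrightarrow> poly P a = poly P' a"
  shows "root_divisor P Q = root_divisor P' Q"
  unfolding root_divisor_def using assms by (intro sum.cong) auto

locale jfrac_pair = odd_even_pair +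
  fixes A R :: "complex poly"
  assumes g_pos: "1 \<le> g" and jc: "jfrac_curve g F A R"
begin

lemma A_facts: "F = A\<^sup>2 + smult 4 R" "degree A = g + 1" "coeff A (g + 1) = 1" "coeff A g = 0"
    "degree R \<le> g"
  using jc by (auto simp: jfrac_curve_def)

text \<open>The norm has degree \<open>2 g\<close>. At \<open>Inf 1\<close>, where \<open>Y\<close>
  and \<open>P\<close> share the leading term, the order is \<open>2 - (g + 1) + g = 1\<close>; at
  \<open>Inf (- 1)\<close> there is no cancellation and it is
  \<open>- (g + 1) + g = - 1\<close>.\<close>

lemma order_y_minus_Inf_1:
  assumes P: "coeff P (g + 1) = 1" and FP: "F = P\<^sup>2 + smult k (q * q')"
    and k: "k \<noteq> 0" and q: "degree q = g" "degree q' = g" "q \<noteq> 0" "q' \<noteq> 0"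
    and s: "s = 1 \<or> s = - 1"
  shows "cod.y_minus_order P (Inf s) - cod.poly_order q (Inf s) = (if s = 1 then 1 else - 1)"
proof -
  have "degree (F - P\<^sup>2) = 2 * g" using k q by (simp add: FP degree_mult_eq)
  then show ?thesis using s P q
    by (auto simp: cod.y_minus_order_def cod.poly_order_def ramification_def)
qed

lemma tendsto_0_of_has_order_1:
  assumes "has_order g F h (Inf 1) 1"
  shows "(h \<longlongrightarrow> 0) (point_filter g F (Inf 1))"
proof -
  have s: "(1 :: complex)\<^sup>2 = coeff F (2 * g + 2)" using lead_coeff_F by simp
  have \<pi>: "(local_param g (Inf 1) \<longlongrightarrow> 0) (point_filter g F (Inf 1))"
    unfolding cod.point_filter_Inf[OF s] filterlim_filtermap
    using tendsto_fst_curve[of 0 1 "affine_curve cod.frecip"] by (simp add: case_prod_unfold)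
  have nz: "eventually (\<lambda>q. local_param g (Inf 1) q \<noteq> 0) (point_filter g F (Inf 1))"
    using s by (intro cod.eventually_local_param) simp
  obtain l where "((\<lambda>q. h q / local_param g (Inf 1) q powi 1) \<longlongrightarrow> l) (point_filter g F (Inf 1))"
    using assms by (auto simp: has_order_def)
  from tendsto_mult[OF this \<pi>]
  have "((\<lambda>q. h q / local_param g (Inf 1) q powi 1 * local_param g (Inf 1) q) \<longlongrightarrow> 0)
      (point_filter g F (Inf 1))" by simp
  then show ?thesis
    by (rule Lim_transform_eventually) (use nz in eventually_elim, simp)
qed

text \<open>Reduces the analytic definition of an orbit to two polynomial identities, the norm
  relation and the recurrence; comparing top coefficients then forces the given \<open>d\<close> and
  \<open>v\<close> to be those of the orbit.\<close>

lemma jfrac_orbitI: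
  fixes S :: "int \<Rightarrow> jstate" and u d v :: "int \<Rightarrow> complex"
  assumes u: "\<And>n. u n \<noteq> 0" "\<And>n. u n * u (n - 1) = - 4 * d n"
    and P: "\<And>n. degree (fst (S n)) \<le> g + 1" "\<And>n. coeff (fst (S n)) (g + 1) = 1"
    and q: "\<And>n. degree (snd (S n)) = g" "\<And>n. coeff (snd (S n)) g = 1"
    and F: "\<And>n. F = (fst (S n))\<^sup>2 + smult (- 4 * d n) (snd (S n) * snd (S (n - 1)))"
    and step: "\<And>n. fst (S n) + fst (S (n + 1)) = smult 2 ([:v n, 1:] * snd (S n))"
  shows "jfrac_orbit g F A u S" "jd g A S n = d n" "jv g S n = v n"
proof -
  have qnz: "snd (S n) \<noteq> 0" for n using q(2)[of n] by auto
  have dnz: "- 4 * d n \<noteq> 0" for n unfolding u(2)[symmetric] using u(1) by simp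
  have dPA: "degree (fst (S n) - A) \<le> g" for n
    by (rule degree_diff_Suc) (use P A_facts in auto)
  have PA: "(fst (S n))\<^sup>2 - A\<^sup>2 = smult 4 R - smult (- 4 * d n) (snd (S n) * snd (S (n - 1)))" for n
  proof -
    have "A\<^sup>2 + smult 4 R = (fst (S n))\<^sup>2 + smult (- 4 * d n) (snd (S n) * snd (S (n - 1)))"
      using F[of n] A_facts(1) by simp
    then show ?thesis by (simp add: algebra_simps)
  qed
  have dqq: "degree (snd (S n) * snd (S (n - 1))) = 2 * g" for n
    using q qnz by (simp add: degree_mult_eq)
  \<comment> \<open>\<open>P^2 - A^2\<close> has degree at most \<open>2 g\<close>, so its
    coefficient at \<open>X^(2g+1)\<close>, twice the difference of the coefficients at
    \<open>X^g\<close>, vanishes.\<close>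
  have Pg: "coeff (fst (S n)) g = 0" for n
  proof -
    have "coeff ((fst (S n))\<^sup>2 - A\<^sup>2) (g + (g + 1)) = 2 * (coeff (fst (S n)) g - coeff A g)"
      by (rule coeff_diff_squares[OF _ _ _ _ dPA]) (use P A_facts in auto)
    moreover have "coeff ((fst (S n))\<^sup>2 - A\<^sup>2) (g + (g + 1)) = 0"
      using dqq[of n] A_facts(5) unfolding PA by (simp add: coeff_eq_0)
    ultimately show ?thesis using A_facts(4) by simp
  qed
  have dPA': "degree (fst (S n) - A) \<le> g - 1" for n
  proof (rule degree_le, intro allI impI)
    fix i assume "g - 1 < i"
    then consider "i = g" | "i > g" by linarith
    then show "coeff (fst (S n) - A) i = 0"
      using Pg A_facts dPA[of n] by cases (auto intro: coeff_eq_0 simp del: coeff_diff, simp)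
  qed
  \<comment> \<open>Coefficients at \<open>X^(2g)\<close>: the two monic polynomials contribute
    \<open>4 d n\<close>, and \<open>R\<close> nothing because its degree is at most
    \<open>g\<close>, which is less than \<open>2 g\<close>.\<close>
  show "jd g A S n = d n"
  proof -
    have "coeff ((fst (S n))\<^sup>2 - A\<^sup>2) (g - 1 + (g + 1)) = 2 * (coeff (fst (S n)) (g - 1) - coeff A (g - 1))"
      by (rule coeff_diff_squares[OF _ _ _ _ dPA']) (use P A_facts in auto)
    moreover have "g - 1 + (g + 1) = g + g" using g_pos by simp
    moreover have "coeff (snd (S n) * snd (S (n - 1))) (g + g) = 1"
      using q by (subst coeff_mult_top) auto
    moreover have "coeff R (g + g) = 0" using A_facts(5) g_pos by (simp add: coeff_eq_0)
    ultimately have "2 * (coeff (fst (S n)) (g - 1) - coeff A (g - 1)) = 2 * (2 * d n)"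
      unfolding PA by simp
    then show ?thesis by (simp only: mult_left_cancel[OF zero_neq_numeral[symmetric]]) (simp add: jd_def jP_def)
  qed
  show jv: "jv g S n = v n" for n
  proof -
    have "coeff (fst (S n) + fst (S (n + 1))) g = 2 * coeff ([:v n, 1:] * snd (S n)) g"
      unfolding step by simp
    then show ?thesis using Pg q(2)[of n] g_pos
      by (cases g) (auto simp: jv_def coeff_pCons add_eq_0_iff2)
  qed
  have step': "poly (fst (S n)) X + poly (fst (S (n + 1))) X = 2 * (X + v n) * poly (snd (S n)) X"
    for n X
    using arg_cong[OF step[of n], of "\<lambda>p. poly p X"] by (simp add: algebra_simps)
  have Falt: "F = (fst (S (n + 1)))\<^sup>2 + smult (- 4 * d (n + 1)) (snd (S n) * snd (S (n + 1)))" for n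
    using F[of "n + 1"] by (simp add: mult.commute)
  have Fpoly: "poly F X = (poly (fst (S (n + 1))) X)\<^sup>2 +
      u (n + 1) * u n * poly (snd (S n)) X * poly (snd (S (n + 1))) X" for n X
    using arg_cong[OF Falt[of n], of "\<lambda>p. poly p X"] u(2)[of "n + 1"] by simp
  \<comment> \<open>The recurrence turns the remainder into \<open>(Y - P (n+1)) / Q n\<close>. In
    this form it has order one at \<open>Inf 1\<close>, and by the norm relation it is
    \<open>1 / Y (n+1)\<close>.\<close>
  have diff: "Yn u S n (X, Y) - jalpha g u S n X =
      inverse (u n) * ((Y - poly (fst (S (n + 1))) X) / poly (snd (S n)) X)"
    if "poly (snd (S n)) X \<noteq> 0" for n X Y
  proof -
    have p: "poly (fst (S n)) X = 2 * (X + v n) * poly (snd (S n)) X - poly (fst (S (n + 1))) X"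
      using step'[of n X] by (simp add: algebra_simps)
    show ?thesis unfolding Yn_def jalpha_def jv jP_def jQ_def
      using that u(1)[of n] by (simp add: p divide_simps)
  qed
  show "jfrac_orbit g F A u S"
    unfolding jfrac_orbit_def
  proof (intro allI conjI impI)
    fix n
    show "u n \<noteq> 0" by (rule u)
    show "degree (snd (S n)) = g" "lead_coeff (snd (S n)) = 1" using q by auto
    show "(jP S n)\<^sup>2 + jQ u S n * jQ u S (n - 1) = F"
      using F[of n] u(2)[of n] by (simp add: jP_def jQ_def mult.commute)
  next
    fix n k assume "k \<ge> g"
    then consider "k = g" | "k = g + 1" | "k > g + 1" by linarith
    then show "coeff (jP S n) k = coeff A k"
      using Pg A_facts P[of n] by cases (auto simp: jP_def coeff_eq_0)
  next
    fix n
    have p: "Inf 1 \<in> completed_curve g F" using lead_coeff_F by simp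
    have "has_order g F (\<lambda>r. (snd r - poly (fst (S (n + 1))) (fst r)) / poly (snd (S n)) (fst r)) (Inf 1)
        (cod.y_minus_order (fst (S (n + 1))) (Inf 1) - cod.poly_order (snd (S n)) (Inf 1))"
      using dnz qnz by (intro cod.has_order_divide p cod.has_order_y_minus cod.has_order_poly P)
        (subst Falt[of n], simp)
    then have "has_order g F (\<lambda>r. (snd r - poly (fst (S (n + 1))) (fst r)) / poly (snd (S n)) (fst r)) (Inf 1) 1"
      using order_y_minus_Inf_1[OF P(2) Falt dnz q(1) q(1) qnz qnz, of 1 n] by simp
    then have "((\<lambda>r. (snd r - poly (fst (S (n + 1))) (fst r)) / poly (snd (S n)) (fst r)) \<longlongrightarrow> 0)
        (point_filter g F (Inf 1))"
      by (rule tendsto_0_of_has_order_1)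
    from tendsto_mult_right_zero[OF this, of "inverse (u n)"]
    show "((\<lambda>(X, Y). Yn u S n (X, Y) - jalpha g u S n X) \<longlongrightarrow> 0) (point_filter g F (Inf 1))"
    proof (rule Lim_transform_eventually)
      show "eventually (\<lambda>r. inverse (u n) * ((snd r - poly (fst (S (n + 1))) (fst r)) / poly (snd (S n)) (fst r))
          = (case r of (X, Y) \<Rightarrow> Yn u S n (X, Y) - jalpha g u S n X)) (point_filter g F (Inf 1))"
        using cod.eventually_poly_nonzero[OF p qnz[of n]]
      proof eventually_elim
        case (elim r)
        then show ?case using diff[where X = "fst r" and Y = "snd r"] by (simp add: case_prod_unfold)
      qed
    qed
  next
    fix n
    show "\<forall>(X, Y)\<in>affine_curve F.
        poly (jQ u S n) X \<noteq> 0 \<and> poly (jQ u S (n + 1)) X \<noteq> 0 \<and> Yn u S (n + 1) (X, Y) \<noteq> 0 \<longrightarrow>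
        Yn u S n (X, Y) = jalpha g u S n X + 1 / Yn u S (n + 1) (X, Y)"
    proof (intro ballI, clarify)
      fix X Y
      assume on: "(X, Y) \<in> affine_curve F" and nz: "poly (jQ u S n) X \<noteq> 0"
        "poly (jQ u S (n + 1)) X \<noteq> 0" "Yn u S (n + 1) (X, Y) \<noteq> 0"
      have q0: "poly (snd (S n)) X \<noteq> 0" "poly (snd (S (n + 1))) X \<noteq> 0" using nz by (auto simp: jQ_def)
      have Y: "Y + poly (fst (S (n + 1))) X \<noteq> 0" using nz(3) by (auto simp: Yn_def jP_def)
      have "(Y - poly (fst (S (n + 1))) X) * (Y + poly (fst (S (n + 1))) X) =
          u (n + 1) * u n * poly (snd (S n)) X * poly (snd (S (n + 1))) X"
        using on Fpoly[of X n] by (simp add: affine_curve_def power2_eq_square algebra_simps)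
      then have "inverse (u n) * ((Y - poly (fst (S (n + 1))) X) / poly (snd (S n)) X) =
          1 / Yn u S (n + 1) (X, Y)"
        using q0 Y u(1) by (simp add: Yn_def jP_def jQ_def field_simps)
      then show "Yn u S n (X, Y) = jalpha g u S n X + 1 / Yn u S (n + 1) (X, Y)"
        using diff[OF q0(1), of Y] by (simp add: algebra_simps)
    qed
  qed
qed

text \<open>The converse direction, for an arbitrary orbit. Away from the roots of both denominators
  \<open>(Y - P)(Y + P)\<close> is nonzero for any square root \<open>Y\<close> of
  \<open>F(X)\<close>, so the fraction relation applies; \<open>Y\<close> cancels in it, and
  cofinitely many \<open>X\<close> determine the polynomials.\<close>

lemma jfrac_orbit_step:
  assumes orb: "jfrac_orbit g F A u S"
  shows "fst (S n) + fst (S (n + 1)) = smult 2 ([:jv g S n, 1:] * snd (S n))"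
proof -
  have u: "u n \<noteq> 0" for n using orb by (simp add: jfrac_orbit_def)
  have qnz: "snd (S n) \<noteq> 0" for n
  proof -
    have "lead_coeff (snd (S n)) = 1" using orb unfolding jfrac_orbit_def by blast
    then show ?thesis by auto
  qed
  have "(jP S m)\<^sup>2 + jQ u S m * jQ u S (m - 1) = F" for m
    using orb by (simp only: jfrac_orbit_def)
  from this[of "n + 1"] have Fn: "(jP S (n + 1))\<^sup>2 + jQ u S (n + 1) * jQ u S n = F"
    by simp
  have rel: "Yn u S n (X, Y) = jalpha g u S n X + 1 / Yn u S (n + 1) (X, Y)"
    if "(X, Y) \<in> affine_curve F" "poly (jQ u S n) X \<noteq> 0" "poly (jQ u S (n + 1)) X \<noteq> 0"
      "Yn u S (n + 1) (X, Y) \<noteq> 0" for X Y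
    using orb that unfolding jfrac_orbit_def by blast
  show ?thesis
  proof (rule poly_eqI_cofinite)
    show "finite {X. poly (snd (S n) * snd (S (n + 1))) X = 0}"
      using qnz by (intro poly_roots_finite) simp
    fix X assume "X \<notin> {X. poly (snd (S n) * snd (S (n + 1))) X = 0}"
    then have q0: "poly (jQ u S n) X \<noteq> 0" "poly (jQ u S (n + 1)) X \<noteq> 0"
      using u by (auto simp: jQ_def)
    define Y where "Y = csqrt (poly F X)"
    have Y: "Y\<^sup>2 = poly F X" by (simp add: Y_def)
    have prod: "(Y - poly (jP S (n + 1)) X) * (Y + poly (jP S (n + 1)) X) =
        poly (jQ u S (n + 1)) X * poly (jQ u S n) X"
      using arg_cong[OF Fn, of "\<lambda>p. poly p X"] Y by (simp add: power2_eq_square algebra_simps)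
    then have nz: "Y + poly (jP S (n + 1)) X \<noteq> 0" using q0 by auto
    then have "Yn u S (n + 1) (X, Y) \<noteq> 0" using q0 by (simp add: Yn_def)
    then have "Yn u S n (X, Y) = jalpha g u S n X + 1 / Yn u S (n + 1) (X, Y)"
      using Y q0 by (intro rel) (simp_all add: affine_curve_def)
    moreover have "1 / Yn u S (n + 1) (X, Y) = (Y - poly (jP S (n + 1)) X) / poly (jQ u S n) X"
      using prod nz q0 by (simp add: Yn_def divide_simps)
    ultimately have "(Y + poly (jP S n) X) / poly (jQ u S n) X =
        jalpha g u S n X + (Y - poly (jP S (n + 1)) X) / poly (jQ u S n) X"
      by (simp only: Yn_def prod.case)
    then have "poly (jP S n) X = jalpha g u S n X * poly (jQ u S n) X - poly (jP S (n + 1)) X"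
      using q0(1) by (simp add: divide_simps)
    then show "poly (fst (S n) + fst (S (n + 1))) X = poly (smult 2 ([:jv g S n, 1:] * snd (S n))) X"
    proof -
      have "jalpha g u S n X * poly (jQ u S n) X = 2 * (X + jv g S n) * poly (snd (S n)) X"
        using u[of n] by (simp add: jalpha_def jQ_def)
      with \<open>poly (jP S n) X = _\<close> show ?thesis by (simp add: jP_def algebra_simps)
    qed
  qed
qed

lemma jfrac_translation:
  assumes orb: "jfrac_orbit g F A u S"
  shows "jfrac_class g F (S n) \<in> carrier (Jac g F)"
    and "jfrac_class g F (S (n + 1)) = translation (Jac g F) (jfrac_shift g F) (jfrac_class g F (S n))"
proof -
  interpret div: comm_group "div0_group g F" by (rule comm_group_div0_group)
  define E where "E n = root_divisor (fst (S n)) (snd (S n)) - frag_cmul (int g) (frag_of (Inf 1))" for n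
  have cls: "jfrac_class g F (S n) = jac_class g F (E n)" for n
    by (simp add: jfrac_class_def E_def case_prod_unfold)
  have u: "u n \<noteq> 0" for n using orb by (simp add: jfrac_orbit_def)
  have q: "degree (snd (S n)) = g" for n using orb by (simp add: jfrac_orbit_def)
  have qnz: "snd (S n) \<noteq> 0" for n
  proof -
    have "lead_coeff (snd (S n)) = 1" using orb unfolding jfrac_orbit_def by blast
    then show ?thesis by auto
  qed
  have Pk: "coeff (fst (S n)) k = coeff A k" if "k \<ge> g" for n k
    using orb that by (simp add: jfrac_orbit_def jP_def)
  have dP: "degree (fst (S n)) \<le> g + 1" for n
    by (rule degree_le) (use Pk A_facts(2) in \<open>auto simp: coeff_eq_0\<close>)
  have F1: "F = (fst (S n))\<^sup>2 + smult (u n * u (n - 1)) (snd (S n) * snd (S (n - 1)))" for n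
    using orb by (auto simp: jfrac_orbit_def jP_def jQ_def mult.commute)
  have F2: "F = (fst (S (n + 1)))\<^sup>2 + smult (u (n + 1) * u n) (snd (S n) * snd (S (n + 1)))" for n
    using F1[of "n + 1"] by (simp add: mult.commute)
  have p1: "Inf 1 \<in> completed_curve g F" using lead_coeff_F by simp
  have E: "E n \<in> carrier (div0_group g F)" for n
  proof -
    have "(poly (fst (S n)) a)\<^sup>2 = poly F a" if "poly (snd (S n)) a = 0" for a
      using arg_cong[OF F1[of n], of "\<lambda>p. poly p a"] that by simp
    then have "Poly_Mapping.keys (root_divisor (fst (S n)) (snd (S n))) \<subseteq> completed_curve g F"
      using qnz by (intro keys_root_divisor) auto
    moreover have "Poly_Mapping.keys (frag_cmul (int g) (frag_of (Inf 1))) \<subseteq> completed_curve g F"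
      using p1 keys_cmul[of "int g" "frag_of (Inf 1)"] by auto
    ultimately have "Poly_Mapping.keys (E n) \<subseteq> completed_curve g F"
      unfolding E_def by (intro order.trans[OF Poly_Mapping.keys_diff] Un_least)
    then show ?thesis
      using qnz[of n] q[of n]
      by (simp add: carrier_div0_group E_def div_deg_diff div_deg_frag_cmul div_deg_root_divisor)
  qed
  then show "jfrac_class g F (S n) \<in> carrier (Jac g F)" by (simp add: cls cod.carrier_Jac)
  let ?s = "frag_of (Inf (- 1)) - frag_of (Inf 1) :: cpoint \<Rightarrow>\<^sub>0 int"
  have Es: "E n + ?s \<in> carrier (div0_group g F)"
    using div.m_closed[OF E jfrac_shift_div] by simp
  \<comment> \<open>At the roots of the monic polynomial of state \<open>n\<close> the recurrence
    reads \<open>P (n+1) = - P n\<close>, so the conjugate points left over in the denominator are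
    those of the divisor of state \<open>n\<close>.\<close>
  have neg: "root_divisor (- fst (S (n + 1))) (snd (S n)) = root_divisor (fst (S n)) (snd (S n))"
  proof (rule root_divisor_cong)
    fix a assume "poly (snd (S n)) a = 0"
    then show "poly (- fst (S (n + 1))) a = poly (fst (S n)) a"
      using arg_cong[OF jfrac_orbit_step[OF orb, of n], of "\<lambda>p. poly p a"]
      by (simp add: add_eq_0_iff)
  qed
  have "E (n + 1) - (E n + ?s) \<in> principal_divisors g F"
  proof (rule cod.quotient_principal[OF F2 _ qnz qnz dP])
    show "u (n + 1) * u n \<noteq> 0" using u by simp
    show "E (n + 1) - (E n + ?s) \<in> carrier (div0_group g F)"
      using E Es by (rule div0_group_diff)
    show "Poly_Mapping.lookup (E (n + 1) - (E n + ?s)) (Aff a b) =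
        Poly_Mapping.lookup (root_divisor (fst (S (n + 1))) (snd (S (n + 1))) -
          root_divisor (- fst (S (n + 1))) (snd (S n))) (Aff a b)" for a b
      unfolding neg by (simp add: E_def lookup_minus lookup_add)
    fix s assume "s\<^sup>2 = coeff F (2 * g + 2)"
    then have s: "s = 1 \<or> s = - 1" using lead_coeff_F by (simp add: power2_eq_1_iff)
    have "cod.y_minus_order (fst (S (n + 1))) (Inf s) - cod.poly_order (snd (S n)) (Inf s) =
        (if s = 1 then 1 else - 1)"
      using u A_facts(3) by (intro order_y_minus_Inf_1[OF _ F2 _ q q qnz qnz s]) (simp_all add: Pk)
    then show "Poly_Mapping.lookup (E (n + 1) - (E n + ?s)) (Inf s) =
        cod.y_minus_order (fst (S (n + 1))) (Inf s) - cod.poly_order (snd (S n)) (Inf s)"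
      using s qnz by (auto simp: E_def lookup_minus lookup_add lookup_root_divisor)
  qed
  then have "jac_class g F (E (n + 1)) = jac_class g F (E n + ?s)"
    by (rule cod.jac_class_eqI[OF E Es])
  then show "jfrac_class g F (S (n + 1)) =
      translation (Jac g F) (jfrac_shift g F) (jfrac_class g F (S n))"
    by (simp add: cls translation_def jfrac_shift_def cod.jac_class_mult[OF E jfrac_shift_div])
qed

end

section \<open>Orbits of the Volterra map and their contractions\<close>

text \<open>\<open>u 0 = 1\<close> is an arbitrary choice; the relation is solved for
  \<open>u n\<close> going upwards (sequence \<open>a\<close>) and for \<open>u (n - 1)\<close>
  going downwards (sequence \<open>b\<close>, with \<open>b i = u (- i)\<close>).\<close>

lemma ex_alternating_product:
  fixes k :: "int \<Rightarrow> complex"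
  assumes "\<And>n. k n \<noteq> 0"
  shows "\<exists>u. (\<forall>n. u n \<noteq> 0) \<and> (\<forall>n. u n * u (n - 1) = k n)"
proof -
  define a where "a = rec_nat 1 (\<lambda>i x. k (int i + 1) / x)"
  define b where "b = rec_nat 1 (\<lambda>i x. k (- int i) / x)"
  have a: "a 0 = 1" "a (Suc i) = k (int i + 1) / a i" for i by (simp_all add: a_def)
  have b: "b 0 = 1" "b (Suc i) = k (- int i) / b i" for i by (simp_all add: b_def)
  have anz: "a i \<noteq> 0" for i by (induction i) (simp_all add: a assms)
  have bnz: "b i \<noteq> 0" for i by (induction i) (simp_all add: b assms)
  define u where "u n = (if 0 \<le> n then a (nat n) else b (nat (- n)))" for n :: int
  have "u n * u (n - 1) = k n" for n
  proof (cases "n \<le> 0")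
    case True
    then obtain i where i: "n = - int i" by (metis nonpos_int_cases)
    have "u n = b i"
    proof (cases "i = 0")
      case True
      then show ?thesis using i a(1) b(1) by (simp add: u_def)
    next
      case False
      then have "nat (- n) = i" "\<not> 0 \<le> n" using i by auto
      then show ?thesis by (simp only: u_def if_False)
    qed
    moreover have "u (n - 1) = b (Suc i)"
    proof -
      have "nat (- (n - 1)) = Suc i" "\<not> 0 \<le> n - 1" using i by auto
      then show ?thesis by (simp only: u_def if_False)
    qed
    ultimately show ?thesis using i bnz[of i] by (simp add: b)
  next
    case False
    then obtain i where i: "n = int i + 1" by (metis not_le zle_iff_zadd zless_imp_add1_zle add.commute add_0)
    have "nat n = Suc i" "nat (n - 1) = i" using i by auto
    then have "u n = a (Suc i)" "u (n - 1) = a i" using i by (simp_all only: u_def) auto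
    then show ?thesis using i anz[of i] by (simp add: a)
  qed
  moreover have "u n \<noteq> 0" for n using anz bnz by (simp add: u_def)
  ultimately show ?thesis by blast
qed

locale volterra_orbit = jfrac_pair +
  fixes T :: "int \<Rightarrow> triplet"
  assumes orbit: "generic_volterra_orbit g f T"
begin

abbreviation P :: "int \<Rightarrow> complex poly" where "P n \<equiv> tP T n"
abbreviation Q :: "int \<Rightarrow> complex poly" where "Q n \<equiv> tQ T n"
abbreviation w :: "int \<Rightarrow> complex" where "w n \<equiv> wn T n"

section \<open>Polynomial recurrences along a Volterra orbit\<close>

lemma T_eq: "T n = (P n, Q n, tR T n)"
  by (simp add: tP_def tQ_def tR_def)

lemma w_nonzero: "w n \<noteq> 0"
  using orbit by (simp add: generic_volterra_orbit_def)

lemma space: "degree (P n) \<le> g" "coeff (P n) 0 = 1" "degree (Q n) \<le> g" "coeff (Q n) 0 = 2"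
    "coeff (tR T n) 0 = 0"
proof -
  have "T n \<in> volterra_space g"
    using orbit unfolding generic_volterra_orbit_def by blast
  then have "(P n, Q n, tR T n) \<in> volterra_space g" by (simp only: T_eq[symmetric])
  then show "degree (P n) \<le> g" "coeff (P n) 0 = 1" "degree (Q n) \<le> g" "coeff (Q n) 0 = 2"
    "coeff (tR T n) 0 = 0" by (simp_all add: volterra_space_def)
qed

lemma T_Suc: "T (n + 1) = volterra_map (P n, Q n, tR T n)"
  unfolding T_eq[symmetric] using orbit unfolding generic_volterra_orbit_def by blast

lemma P_Suc: "P (n + 1) = Q n - P n"
  using T_Suc[of n] by (simp add: tP_def Let_def)

lemma R_Suc': "tR T (n + 1) = [:0, - volterra_w (P n, Q n, tR T n):] * Q n"
  by (simp add: tR_def[of T "n + 1"] T_Suc Let_def del: mult_pCons_left)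

text \<open>The index moves by one: the \<open>w\<close> used in the step from \<open>n\<close> is
  \<open>w (n + 1)\<close>, since \<open>R (n + 1)\<close> is \<open>- w x Q n\<close> and
  \<open>Q n\<close> has constant term 2.\<close>

lemma w_Suc: "w (n + 1) = volterra_w (P n, Q n, tR T n)"
  unfolding wn_def R_Suc' by (simp add: coeff_pCons space del: volterra_w.simps)

lemma R_eq: "tR T n = [:0, - w n:] * Q (n - 1)"
  using R_Suc'[of "n - 1"] unfolding w_Suc[symmetric] by simp

text \<open>The quotient by \<open>- w x\<close> in the map is exact: the constant terms of the
  numerator are \<open>2 - 2 + 0\<close>.\<close>

lemma Q_Suc: "[:0, - w (n + 1):] * Q (n + 1) = smult 2 (P n) - Q n + [:0, - w n:] * Q (n - 1)"
proof -
  let ?N = "smult 2 (P n) - Q n + tR T n"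
  have "poly ?N 0 = 0" by (simp add: poly_0_coeff_0 space)
  then have "[:- 0, 1:] dvd ?N" by (simp only: poly_eq_0_iff_dvd)
  then have "[:0, 1:] dvd ?N" by (simp only: minus_zero)
  moreover have "[:0, - w (n + 1):] = smult (- w (n + 1)) [:0, 1:]" by simp
  ultimately have "[:0, - w (n + 1):] dvd ?N"
    using w_nonzero by (simp only: smult_dvd_iff) simp
  moreover have "Q (n + 1) = ?N div [:0, - w (n + 1):]"
    unfolding w_Suc by (simp add: tQ_def[of T "n + 1"] T_Suc Let_def del: volterra_w.simps)
  ultimately show ?thesis unfolding R_eq[symmetric] by (simp only: dvd_mult_div_cancel)
qed

lemma f_eq: "f = (P n)\<^sup>2 + smult (- w n) ([:0, 1:] * Q n * Q (n - 1))"
proof -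
  have "(P n)\<^sup>2 + Q n * tR T n = f" using orbit by (simp add: generic_volterra_orbit_def)
  moreover have "Q n * tR T n = smult (- w n) ([:0, 1:] * Q n * Q (n - 1))"
    unfolding R_eq by simp
  ultimately show ?thesis by simp
qed

lemma poly_P_Suc: "poly (P (n + 1)) x = poly (Q n) x - poly (P n) x"
  by (simp add: P_Suc)

lemma poly_Q_Suc:
  "w (n + 1) * x * poly (Q (n + 1)) x = poly (Q n) x - 2 * poly (P n) x + w n * x * poly (Q (n - 1)) x"
  using arg_cong[OF Q_Suc[of n], of "\<lambda>p. poly p x"] by (simp add: algebra_simps)

lemma poly_f: "poly f x = (poly (P n) x)\<^sup>2 - w n * x * poly (Q n) x * poly (Q (n - 1)) x"
  by (subst f_eq[of n]) (simp add: algebra_simps)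

lemma Q_nonzero: "Q n \<noteq> 0"
  using space(4)[of n] by auto

text \<open>\<open>P^2\<close> has degree at most \<open>2 g\<close>, so the degree
  \<open>2 g + 1\<close> of \<open>f\<close> comes from \<open>x Q(n) Q(n-1)\<close>, which leaves
  no room for a factor of degree below \<open>g\<close>.\<close>

lemma degree_Q: "degree (Q n) = g"
proof -
  have "degree ((P n)\<^sup>2) \<le> 2 * g" using degree_power_le[of "P n" 2] space(1)[of n] by simp
  then have "degree (f - (P n)\<^sup>2) = 2 * g + 1"
    using degree_f degree_add_eq_left[of "- (P n)\<^sup>2" f] by simp
  moreover have "f - (P n)\<^sup>2 = smult (- w n) ([:0, 1:] * Q n * Q (n - 1))"
    using f_eq[of n] by simp
  moreover have "degree \<dots> = 1 + degree (Q n) + degree (Q (n - 1))"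
    using Q_nonzero w_nonzero by (simp add: degree_mult_eq del: mult_pCons_left)
  ultimately show ?thesis using space(3)[of n] space(3)[of "n - 1"] by simp
qed

text \<open>By the norm relation at \<open>n + 1\<close> the last term is
  \<open>- (y - P (n+1)) / Q n\<close>, and \<open>P n + P (n+1) = Q n\<close>.\<close>

lemma s_fraction: "s_fraction f T"
  unfolding s_fraction_def
proof (intro allI ballI, clarify)
  fix n x y
  assume on: "(x, y) \<in> affine_curve f" and nz: "poly (Q n) x \<noteq> 0" "poly (Q (n + 1)) x \<noteq> 0"
    "Fn T (n + 1) (x, y) \<noteq> 0"
  have nz': "y + poly (P (n + 1)) x \<noteq> 0" using nz(3) by (auto simp: Fn_def)
  have "(y + poly (P (n + 1)) x) * (y - poly (P (n + 1)) x) =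
      - w (n + 1) * x * poly (Q (n + 1)) x * poly (Q n) x"
    using on poly_f[of x "n + 1"] by (simp add: affine_curve_def power2_eq_square algebra_simps)
  then have eq: "w (n + 1) * x / Fn T (n + 1) (x, y) = - (y - poly (P (n + 1)) x) / poly (Q n) x"
    using nz nz' by (simp add: Fn_def divide_simps) (simp add: algebra_simps)
  show "Fn T n (x, y) = 1 - w (n + 1) * x / Fn T (n + 1) (x, y)"
    unfolding eq using nz(1) by (simp add: Fn_def poly_P_Suc divide_simps)
qed


subsection \<open>The translation on the Jacobian\<close>

lemma volterra_translation:
  shows "volterra_class g f (T n) \<in> carrier (Jac g f)"
    and "volterra_class g f (T (n + 1)) =
      translation (Jac g f) (volterra_shift g f) (volterra_class g f (T n))"
proof -
  interpret div: comm_group "div0_group g f" by (rule comm_group_div0_group)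
  define E where "E n = root_divisor (P n) (Q n) - frag_cmul (int g) (frag_of (Inf 0))" for n
  have cls: "volterra_class g f (T n) = jac_class g f (E n)" for n
    by (subst T_eq) (simp add: volterra_class_def E_def)
  have p0: "Inf 0 \<in> completed_curve g f" using coeff_f_top by simp
  have E: "E n \<in> carrier (div0_group g f)" for n
  proof -
    have "(poly (P n) a)\<^sup>2 = poly f a" if "poly (Q n) a = 0" for a
      using poly_f[of a n] that by simp
    then have "Poly_Mapping.keys (root_divisor (P n) (Q n)) \<subseteq> completed_curve g f"
      using Q_nonzero by (intro keys_root_divisor) auto
    moreover have "Poly_Mapping.keys (frag_cmul (int g) (frag_of (Inf 0))) \<subseteq> completed_curve g f"
      using p0 keys_cmul[of "int g" "frag_of (Inf 0)"] by auto
    ultimately have "Poly_Mapping.keys (E n) \<subseteq> completed_curve g f"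
      unfolding E_def by (intro order.trans[OF Poly_Mapping.keys_diff] Un_least)
    then show ?thesis
      by (simp add: carrier_div0_group E_def div_deg_diff div_deg_frag_cmul div_deg_root_divisor
          Q_nonzero degree_Q)
  qed
  then show "volterra_class g f (T n) \<in> carrier (Jac g f)" by (simp add: cls dom.carrier_Jac)
  let ?s = "frag_of (Aff 0 (- 1)) - frag_of (Inf 0) :: cpoint \<Rightarrow>\<^sub>0 int"
  have Es: "E n + ?s \<in> carrier (div0_group g f)"
    using div.m_closed[OF E volterra_shift_div] by simp
  \<comment> \<open>The factor \<open>x\<close> of the norm is put with \<open>Q n\<close>: over
    \<open>x = 0\<close> it contributes the pole at \<open>(0, -1)\<close>, because
    \<open>- P (n+1)\<close> is \<open>- 1\<close> there.\<close>
  let ?xQ = "[:0, 1:] * Q n"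
  have xQ: "?xQ \<noteq> 0" using Q_nonzero by simp
  have f': "f = (P (n + 1))\<^sup>2 + smult (- w (n + 1)) (?xQ * Q (n + 1))"
    by (subst f_eq[of "n + 1"]) (simp add: ac_simps del: mult_pCons_left mult_pCons_right)
  have ord: "order a ?xQ = (if a = 0 then 1 else 0) + order a (Q n)" for a
  proof -
    have "order a [:0, 1 :: complex:] = (if a = 0 then 1 else 0)"
      using order_power_n_n[of "0 :: complex" 1] by (auto simp: order_0I)
    then show ?thesis unfolding order_mult[OF xQ] by (rule arg_cong)
  qed
  \<comment> \<open>At the roots of \<open>Q n\<close> one has \<open>- P (n+1) = P n\<close>. The
    root 0 is distinct from these, as \<open>Q n\<close> has constant term 2.\<close>
  have aff: "Poly_Mapping.lookup (root_divisor (- P (n + 1)) ?xQ) (Aff a b) =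
      Poly_Mapping.lookup (root_divisor (P n) (Q n) + frag_of (Aff 0 (- 1))) (Aff a b)" for a b
  proof (cases "poly (Q n) a = 0")
    case True
    then have "a \<noteq> 0" using space(4)[of n] by (auto simp: poly_0_coeff_0)
    then show ?thesis using True ord[of a] xQ Q_nonzero[of n] poly_P_Suc[of n a]
      by (simp add: lookup_root_divisor lookup_add del: mult_pCons_left)
  next
    case False
    have "poly (- P (n + 1)) 0 = - 1" by (simp add: poly_0_coeff_0 space)
    then show ?thesis using False ord[of a] xQ Q_nonzero[of n]
      by (auto simp: lookup_root_divisor lookup_add order_0I simp del: mult_pCons_left)
  qed
  have dx: "degree ?xQ = g + 1"
    using Q_nonzero by (simp add: degree_mult_eq degree_Q del: mult_pCons_left)
  have "E (n + 1) - (E n + ?s) \<in> principal_divisors g f"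
  proof (rule dom.quotient_principal[OF f' _ xQ Q_nonzero])
    show "- w (n + 1) \<noteq> 0" using w_nonzero by simp
    show "degree (P (n + 1)) \<le> g + 1" using space(1)[of "n + 1"] by simp
    show "E (n + 1) - (E n + ?s) \<in> carrier (div0_group g f)"
      using E Es by (rule div0_group_diff)
    show "Poly_Mapping.lookup (E (n + 1) - (E n + ?s)) (Aff a b) =
        Poly_Mapping.lookup (root_divisor (P (n + 1)) (Q (n + 1)) - root_divisor (- P (n + 1)) ?xQ) (Aff a b)"
      for a b
      unfolding lookup_minus[of "root_divisor _ _" "root_divisor _ _"] aff
      by (simp add: E_def lookup_minus lookup_add)
    fix s assume "s\<^sup>2 = coeff f (2 * g + 2)"
    then have s: "s = 0" using coeff_f_top by simp
    have "coeff (P (n + 1)) (g + 1) = 0" using space(1)[of "n + 1"] by (intro coeff_eq_0) simp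
    moreover have "degree (f - (P (n + 1))\<^sup>2) = 2 * g + 1"
    proof -
      have "f - (P (n + 1))\<^sup>2 = smult (- w (n + 1)) (?xQ * Q (n + 1))"
        using f' by (metis add_diff_cancel_left')
      then show ?thesis using w_nonzero xQ Q_nonzero dx
        by (simp add: degree_mult_eq degree_Q del: mult_pCons_left)
    qed
    \<comment> \<open>At infinity the order is \<open>1 - 2 (g + 1)\<close> for the numerator and
      \<open>- 2 (g + 1)\<close> for the denominator, so 1 remains, which accounts for
      \<open>- Inf 0\<close> in the shift.\<close>
    ultimately show "Poly_Mapping.lookup (E (n + 1) - (E n + ?s)) (Inf s) =
        dom.y_minus_order (P (n + 1)) (Inf s) - dom.poly_order ?xQ (Inf s)"
      using dx Q_nonzero
      by (simp add: s E_def lookup_minus lookup_add lookup_root_divisor dom.y_minus_order_def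
          dom.poly_order_def ramification_def del: mult_pCons_left)
  qed
  then have "jac_class g f (E (n + 1)) = jac_class g f (E n + ?s)"
    by (rule dom.jac_class_eqI[OF E Es])
  then show "volterra_class g f (T (n + 1)) =
      translation (Jac g f) (volterra_shift g f) (volterra_class g f (T n))"
    by (simp add: cls translation_def volterra_shift_def dom.jac_class_mult[OF E volterra_shift_div])
qed


subsection \<open>Contraction\<close>

text \<open>\<open>F(m)/x - w(m) = (y + P(m) - w(m) x Q(m)) / (x Q(m))\<close>. Dividing numerator
  and denominator by \<open>x^(g+1)\<close> makes the numerator \<open>Y + cP m\<close>.\<close>

definition cP :: "int \<Rightarrow> complex poly" where
  "cP m = pcompose (recip (g + 1) (P m - [:0, w m:] * Q m)) [:- \<sigma>, 1:]"

text \<open>The same division turns \<open>x Q(m)\<close> into \<open>Q(m)/x^g = 2 cQ m\<close>; the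
  half makes \<open>cQ m\<close> monic, since \<open>Q(m)\<close> has constant term 2.\<close>

definition cQ :: "int \<Rightarrow> complex poly" where
  "cQ m = smult (1 / 2) (pcompose (recip g (Q m)) [:- \<sigma>, 1:])"

lemma degree_pre_cP: "degree (P m - [:0, w m:] * Q m) \<le> g + 1"
proof (rule degree_diff_le)
  show "degree (P m) \<le> g + 1" using space(1)[of m] by simp
  have "degree ([:0, w m:] * Q m) \<le> degree [:0, w m:] + degree (Q m)" by (rule degree_mult_le)
  then show "degree ([:0, w m:] * Q m) \<le> g + 1" using space(3)[of m] w_nonzero[of m] by simp
qed

lemma poly_cP:
  "x \<noteq> 0 \<Longrightarrow> poly (cP m) (1 / x + \<sigma>) = (poly (P m) x - w m * x * poly (Q m) x) / x ^ (g + 1)"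
proof -
  assume x: "x \<noteq> 0"
  have "poly [:- \<sigma>, 1:] (1 / x + \<sigma>) = 1 / x" "1 / x \<noteq> 0" "1 / (1 / x) = x" using x by simp_all
  then have "poly (cP m) (1 / x + \<sigma>) = (1 / x) ^ (g + 1) * poly (P m - [:0, w m:] * Q m) x"
    unfolding cP_def poly_pcompose by (simp only: poly_recip[OF degree_pre_cP] not_False_eq_True)
  then show ?thesis using x by (simp add: field_simps)
qed

lemma poly_cQ: "x \<noteq> 0 \<Longrightarrow> poly (cQ m) (1 / x + \<sigma>) = poly (Q m) x / (2 * x ^ g)"
  unfolding cQ_def poly_pcompose poly_smult
  by (simp add: poly_recip[OF space(3)] field_simps)

lemma poly_F_at: "x \<noteq> 0 \<Longrightarrow> poly F (1 / x + \<sigma>) = poly f x / x ^ (2 * g + 2)"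
  by (simp add: poly_f_eq)

lemma poly_eqI_shifted:
  fixes p q :: "complex poly"
  assumes "\<And>x. x \<noteq> 0 \<Longrightarrow> poly p (1 / x + \<sigma>) = poly q (1 / x + \<sigma>)"
  shows "p = q"
proof (rule poly_eqI_cofinite[of "{\<sigma>}"])
  fix X assume "X \<notin> {\<sigma>}"
  then have "1 / (X - \<sigma>) \<noteq> 0" "1 / (1 / (X - \<sigma>)) + \<sigma> = X" by auto
  then show "poly p X = poly q X" using assms by metis
qed simp

lemma degree_cQ: "degree (cQ m) = g" and lead_cQ: "coeff (cQ m) g = 1"
proof -
  have c: "coeff (recip g (Q m)) g = 2" using space by (simp add: coeff_recip)
  then have "degree (recip g (Q m)) = g"
    using degree_recip_le[OF space(3)[of m]] by (intro antisym le_degree) simp_all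
  then show d: "degree (cQ m) = g" by (simp add: cQ_def degree_pcompose)
  have "lead_coeff (pcompose (recip g (Q m)) [:- \<sigma>, 1:]) = lead_coeff (recip g (Q m))"
    by (simp add: lead_coeff_comp)
  then show "coeff (cQ m) g = 1"
    using c \<open>degree (recip g (Q m)) = g\<close> by (simp add: cQ_def degree_pcompose)
qed

lemma degree_cP: "degree (cP m) \<le> g + 1" and lead_cP: "coeff (cP m) (g + 1) = 1"
proof -
  let ?p = "recip (g + 1) (P m - [:0, w m:] * Q m)"
  have c: "coeff ?p (g + 1) = 1" using degree_pre_cP[of m] space by (simp add: coeff_recip)
  then have "degree ?p = g + 1"
    using degree_recip_le[OF degree_pre_cP[of m]] by (intro antisym le_degree) simp_all
  then show "degree (cP m) \<le> g + 1" by (simp add: cP_def degree_pcompose)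
  have "lead_coeff (cP m) = lead_coeff ?p" unfolding cP_def by (simp add: lead_coeff_comp)
  then show "coeff (cP m) (g + 1) = 1"
    using c \<open>degree ?p = g + 1\<close> by (simp add: cP_def degree_pcompose)
qed

text \<open>Inserting the norm relation for \<open>f\<close> at \<open>m\<close> leaves
  \<open>w(m) x Q(m)\<close> times \<open>Q(m-1) - 2 P(m) + w(m) x Q(m)\<close>; the two recurrences
  reduce this last factor to \<open>w(m-1) x Q(m-2)\<close>.\<close>

lemma contracted_norm:
  "(poly (P m) x - w m * x * poly (Q m) x)\<^sup>2 - poly f x =
    w m * w (m - 1) * x\<^sup>2 * poly (Q m) x * poly (Q (m - 2)) x"
proof -
  have 1: "poly (P m) x = poly (Q (m - 1)) x - poly (P (m - 1)) x"
    using poly_P_Suc[of "m - 1" x] by simp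
  have 2: "w m * x * poly (Q m) x = poly (Q (m - 1)) x - 2 * poly (P (m - 1)) x +
      w (m - 1) * x * poly (Q (m - 2)) x"
    using poly_Q_Suc[of "m - 1" x] by simp
  show ?thesis using 1 2 poly_f[of x m] by algebra
qed

text \<open>The recurrences rewrite the bracket at \<open>m + 2\<close> as
  \<open>P(m+1) - w(m+1) x Q(m)\<close>, and \<open>P(m) + P(m+1) = Q(m)\<close>.\<close>

lemma contracted_sum:
  "(poly (P m) x - w m * x * poly (Q m) x) +
    (poly (P (m + 2)) x - w (m + 2) * x * poly (Q (m + 2)) x) =
    poly (Q m) x * (1 - (w m + w (m + 1)) * x)"
proof -
  have 1: "poly (P (m + 2)) x = poly (Q (m + 1)) x - poly (P (m + 1)) x"
    using poly_P_Suc[of "m + 1" x] by (simp only: add.assoc one_add_one)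
  have 2: "w (m + 2) * x * poly (Q (m + 2)) x = poly (Q (m + 1)) x - 2 * poly (P (m + 1)) x +
      w (m + 1) * x * poly (Q m) x"
    using poly_Q_Suc[of "m + 1" x] by (simp only: add.assoc one_add_one add_diff_cancel_right')
  show ?thesis using 1 2 poly_P_Suc[of m x] by algebra
qed

text \<open>This is \<open>contracted_norm\<close> divided by \<open>x^(2g+2)\<close>: the factor
  \<open>x^2\<close> leaves \<open>x^g\<close> for each \<open>Q\<close>, and 4 compensates the two
  halves in \<open>cQ\<close>.\<close>

lemma cP_norm: "F = (cP m)\<^sup>2 + smult (- 4 * (w m * w (m - 1))) (cQ m * cQ (m - 2))"
proof (rule poly_eqI_shifted)
  fix x :: complex assume x: "x \<noteq> 0"
  have x2: "x ^ (2 * g + 2) = x ^ g * x ^ g * x\<^sup>2"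
    by (simp only: power_add power_even_eq power2_eq_square)
  have QQ: "poly (cQ m) (1 / x + \<sigma>) * poly (cQ (m - 2)) (1 / x + \<sigma>) =
      x\<^sup>2 * poly (Q m) x * poly (Q (m - 2)) x / (4 * x ^ (2 * g + 2))"
    unfolding poly_cQ[OF x] x2 using x by simp
  have "poly ((cP m)\<^sup>2 + smult (- 4 * (w m * w (m - 1))) (cQ m * cQ (m - 2))) (1 / x + \<sigma>) =
     ((poly (P m) x - w m * x * poly (Q m) x)\<^sup>2 -
       w m * w (m - 1) * x\<^sup>2 * poly (Q m) x * poly (Q (m - 2)) x) / x ^ (2 * g + 2)"
  proof -
    define a where "a = poly (P m) x - w m * x * poly (Q m) x"
    define D where "D = x ^ (2 * g + 2)"
    show ?thesis
      unfolding poly_add poly_power poly_smult poly_mult poly_cP[OF x] QQ power_divide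
        power_Suc_square a_def[symmetric] D_def[symmetric]
      by (simp add: diff_divide_distrib)
  qed
  also have "\<dots> = poly f x / x ^ (2 * g + 2)"
    unfolding contracted_norm[symmetric] by simp
  finally show "poly F (1 / x + \<sigma>) =
      poly ((cP m)\<^sup>2 + smult (- 4 * (w m * w (m - 1))) (cQ m * cQ (m - 2))) (1 / x + \<sigma>)"
    using poly_F_at[OF x] by simp
qed

text \<open>This is \<open>contracted_sum\<close> divided by \<open>x^(g+1)\<close>; the constant
  \<open>- \<sigma>\<close> appears because \<open>1/x = X - \<sigma>\<close>.\<close>

lemma cP_sum: "cP m + cP (m + 2) = smult 2 ([:- w m - w (m + 1) - \<sigma>, 1:] * cQ m)"
proof (rule poly_eqI_shifted)
  fix x :: complex assume x: "x \<noteq> 0"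
  have "poly (cP m + cP (m + 2)) (1 / x + \<sigma>) =
      poly (Q m) x * (1 - (w m + w (m + 1)) * x) / x ^ (g + 1)"
    unfolding contracted_sum[symmetric] poly_add poly_cP[OF x] by (simp add: add_divide_distrib)
  also have "\<dots> = poly (smult 2 ([:- w m - w (m + 1) - \<sigma>, 1:] * cQ m)) (1 / x + \<sigma>)"
    unfolding poly_smult poly_mult poly_cQ[OF x] using x by (simp add: field_simps)
  finally show "poly (cP m + cP (m + 2)) (1 / x + \<sigma>) =
      poly (smult 2 ([:- w m - w (m + 1) - \<sigma>, 1:] * cQ m)) (1 / x + \<sigma>)" .
qed

text \<open>The state \<open>S (j + 1)\<close> comes from the triplet with index \<open>2 j + e\<close>.\<close>

definition contracted_orbit :: "int \<Rightarrow> int \<Rightarrow> jstate" where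
  "contracted_orbit e n = (cP (2 * n - 2 + e), cQ (2 * n - 2 + e))"

lemma contraction_exists:
  "\<exists>u. jfrac_orbit g F A u (contracted_orbit e) \<and> contraction g f A \<sigma> e T u (contracted_orbit e)"
proof -
  let ?S = "contracted_orbit e"
  \<comment> \<open>With \<open>n = j + 1\<close> these are the values that
    \<open>contraction\<close> prescribes for \<open>jd\<close> and \<open>jv\<close>.\<close>
  define d where "d n = w (2 * n - 2 + e) * w (2 * n - 3 + e)" for n
  define v where "v n = - w (2 * n - 2 + e) - w (2 * n - 1 + e) - \<sigma>" for n
  have "- 4 * d n \<noteq> 0" for n using w_nonzero by (simp add: d_def)
  then obtain u where u: "\<And>n. u n \<noteq> 0" "\<And>n. u n * u (n - 1) = - 4 * d n"
    using ex_alternating_product[of "\<lambda>n. - 4 * d n"] by auto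
  have F': "F = (fst (?S n))\<^sup>2 + smult (- 4 * d n) (snd (?S n) * snd (?S (n - 1)))" for n
  proof -
    have "2 * n - 2 + e - 1 = 2 * n - 3 + e" "2 * n - 2 + e - 2 = 2 * (n - 1) - 2 + e" by simp_all
    then show ?thesis using cP_norm[of "2 * n - 2 + e"] by (simp only: contracted_orbit_def d_def fst_conv snd_conv)
  qed
  have step: "fst (?S n) + fst (?S (n + 1)) = smult 2 ([:v n, 1:] * snd (?S n))" for n
  proof -
    have "2 * n - 2 + e + 1 = 2 * n - 1 + e" "2 * n - 2 + e + 2 = 2 * (n + 1) - 2 + e" by simp_all
    then show ?thesis using cP_sum[of "2 * n - 2 + e"] by (simp only: contracted_orbit_def v_def fst_conv snd_conv)
  qed
  note J = jfrac_orbitI[of u d ?S v, OF u _ _ _ _ F' step]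
  have orb: "jfrac_orbit g F A u ?S"
    by (rule J(1)) (simp_all only: contracted_orbit_def fst_conv snd_conv degree_cP lead_cP degree_cQ lead_cQ)
  have jd: "jd g A ?S n = d n" for n
    by (rule J(2)) (simp_all only: contracted_orbit_def fst_conv snd_conv degree_cP lead_cP degree_cQ lead_cQ)
  have jv: "jv g ?S n = v n" for n
    by (rule J(3)) (simp_all only: contracted_orbit_def fst_conv snd_conv degree_cP lead_cP degree_cQ lead_cQ)
  have S: "?S (j + 1) = (cP (2 * j + e), cQ (2 * j + e))" for j
    by (simp add: contracted_orbit_def)
  have line: "contracted_line e T j (x, y) =
      (y + (poly (P (2 * j + e)) x - w (2 * j + e) * x * poly (Q (2 * j + e)) x)) /
        (x * poly (Q (2 * j + e)) x)"
    if "x \<noteq> 0" "poly (Q (2 * j + e)) x \<noteq> 0" for j x y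
    using that by (simp add: contracted_line_def Fn_def field_simps)
  have "contraction g f A \<sigma> e T u ?S"
    unfolding contraction_def
  proof (intro conjI allI ballI; (clarify)?)
    fix j
    show "jd g A ?S (j + 1) = w (2 * j - 1 + e) * w (2 * j + e)"
      unfolding jd d_def by (simp add: algebra_simps)
    show "jv g ?S (j + 1) = - w (2 * j + e) - w (2 * j + 1 + e) - \<sigma>"
      unfolding jv v_def by (simp add: algebra_simps)
  next
    fix j x y assume x: "x \<noteq> 0" and q: "poly (Q (2 * j + e)) x \<noteq> 0"
    show "Yn u ?S (j + 1) (curve_map g \<sigma> (x, y)) = 2 / u (j + 1) * contracted_line e T j (x, y)"
      unfolding line[OF x q] Yn_def curve_map_def prod.case jP_def jQ_def S fst_conv snd_conv
        poly_smult poly_cP[OF x] poly_cQ[OF x]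
      using x q u(1)[of "j + 1"] by (simp add: divide_simps)
  next
    fix j x y assume on: "(x, y) \<in> affine_curve f" and x: "x \<noteq> 0"
      and q: "poly (Q (2 * j + e)) x \<noteq> 0" "poly (Q (2 * (j + 1) + e)) x \<noteq> 0"
      and l: "contracted_line e T (j + 1) (x, y) \<noteq> 0"
    define m where "m = 2 * j + e"
    have m2: "2 * (j + 1) + e = m + 2" by (simp add: m_def)
    define p p' where "p = poly (P m) x - w m * x * poly (Q m) x"
      and "p' = poly (P (m + 2)) x - w (m + 2) * x * poly (Q (m + 2)) x"
    have dj: "jd g A ?S (j + 2) = w (m + 2) * w (m + 1)"
      unfolding jd d_def m_def by (simp add: algebra_simps)
    have vj: "jv g ?S (j + 1) = - w m - w (m + 1) - \<sigma>"
      unfolding jv v_def m_def by (simp add: algebra_simps)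
    have l2: "contracted_line e T (j + 1) (x, y) = (y + p') / (x * poly (Q (m + 2)) x)"
      using line[OF x q(2), of y] unfolding m2 p'_def .
    have nz: "y + p' \<noteq> 0" using l l2 by auto
    \<comment> \<open>\<open>contracted_norm\<close> at \<open>m + 2\<close> rationalises the
      reciprocal of the next line, whose numerator is \<open>y + p'\<close>.\<close>
    have "(y + p') * (y - p') = - (w (m + 2) * w (m + 1) * x\<^sup>2 * poly (Q (m + 2)) x * poly (Q m) x)"
      using contracted_norm[of "m + 2" x] on
      by (simp add: affine_curve_def p'_def power2_eq_square algebra_simps)
    then have quot: "w (m + 2) * w (m + 1) / contracted_line e T (j + 1) (x, y) =
        - (y - p') / (x * poly (Q m) x)"
      unfolding l2 using nz x q[folded m_def] unfolding m2
      by (simp add: divide_simps power2_eq_square) (simp add: algebra_simps)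
    have l1: "contracted_line e T j (x, y) = (y + p) / (x * poly (Q m) x)"
      using line[OF x q(1), of y] by (simp only: m_def p_def)
    have p: "p = poly (Q m) x * (1 - (w m + w (m + 1)) * x) - p'"
      using contracted_sum[of m x] by (simp add: p_def p'_def algebra_simps)
    show "contracted_line e T j (x, y) =
        1 / x + \<sigma> + jv g ?S (j + 1) - jd g A ?S (j + 2) / contracted_line e T (j + 1) (x, y)"
      unfolding dj vj l1 quot p using x q(1)[folded m_def]
      by (simp add: divide_simps) (simp add: algebra_simps)
  qed
  with orb show ?thesis by blast
qed

text \<open>A state remembers \<open>Q\<close> and \<open>P - w x Q\<close>, not \<open>P\<close>
  itself, since the two \<open>w\<close> may differ. The values of \<open>P\<close> at the roots of
  \<open>Q\<close> are determined, and these are all that the divisor of a triplet uses.\<close>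

lemma contracted_states_eq:
  assumes "cP m = cP k" "cQ m = cQ k"
  shows "Q m = Q k" "poly (P m) x - w m * x * poly (Q m) x = poly (P k) x - w k * x * poly (Q k) x"
proof -
  show "Q m = Q k"
  proof (rule poly_eqI_cofinite[of "{0}"])
    fix x :: complex assume "x \<notin> {0}"
    then show "poly (Q m) x = poly (Q k) x"
      using assms(2) poly_cQ[of x m] poly_cQ[of x k] by simp
  qed simp
  have "P m - [:0, w m:] * Q m = P k - [:0, w k:] * Q k"
  proof (rule poly_eqI_cofinite[of "{0}"])
    fix x :: complex assume "x \<notin> {0}"
    then show "poly (P m - [:0, w m:] * Q m) x = poly (P k - [:0, w k:] * Q k) x"
      using assms(1) poly_cP[of x m] poly_cP[of x k] by (simp add: mult.assoc mult.left_commute)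
  qed simp
  from arg_cong[OF this, of "\<lambda>p. poly p x"]
  show "poly (P m) x - w m * x * poly (Q m) x = poly (P k) x - w k * x * poly (Q k) x"
    by (simp add: algebra_simps)
qed

text \<open>If two consecutive triplets gave the same state, the common \<open>Q\<close> would divide both \<open>P\<close>'s,
  hence \<open>Q\<^sup>2\<close> would divide \<open>f\<close>.\<close>

lemma contracted_orbits_differ: "contracted_orbit 0 n \<noteq> contracted_orbit 1 n"
proof
  assume "contracted_orbit 0 n = contracted_orbit 1 n"
  then have "cP (2 * n - 2) = cP (2 * n - 2 + 1)" "cQ (2 * n - 2) = cQ (2 * n - 2 + 1)"
    by (simp_all add: contracted_orbit_def)
  note eq = contracted_states_eq[OF this]
  define m where "m = 2 * n - 2"
  note eq = eq[folded m_def]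

  \<comment> \<open>The equal states give \<open>P(m) - P(m+1) = (w(m) - w(m+1)) x Q(m)\<close>;
    subtracted from \<open>P(m) + P(m+1) = Q(m)\<close> this shows that \<open>Q(m)\<close> divides
    \<open>2 P(m+1)\<close>.\<close>
  have "P (m + 1) = Q m * [:1 / 2, (w (m + 1) - w m) / 2:]"
  proof (rule poly_eqI_cofinite[of "{}"])
    fix x :: complex
    have "2 * poly (P (m + 1)) x = poly (Q m) x * (1 + (w (m + 1) - w m) * x)"
      using eq(2)[of x, folded eq(1)] poly_P_Suc[of m x] by algebra
    then show "poly (P (m + 1)) x = poly (Q m * [:1 / 2, (w (m + 1) - w m) / 2:]) x"
      by (simp add: field_simps)
  qed simp
  then have "(Q m)\<^sup>2 dvd (P (m + 1))\<^sup>2" by (simp only: power_mult_distrib dvd_triv_left)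
  moreover have "(Q m)\<^sup>2 dvd smult (- w (m + 1)) ([:0, 1:] * Q (m + 1) * Q (m + 1 - 1))"
    using eq(1) by (intro dvd_smult) (simp add: power2_eq_square mult.assoc del: mult_pCons_left)
  ultimately have "(Q m)\<^sup>2 dvd f"
    by (subst f_eq[of "m + 1"]) (rule dvd_add)
  then have "is_unit (Q m)" using squarefreeD[OF sqf_f] by blast
  then have "degree (Q m) = 0" using is_unit_iff_degree[OF Q_nonzero] by blast
  then show False using degree_Q g_pos by simp
qed

text \<open>Equal states come from triplets with equal divisors. The indices of these triplets,
  \<open>2 n - 2\<close> and \<open>2 m - 1\<close>, differ by an odd number of Volterra
  translations.\<close>

lemma contracted_orbits_meet:
  assumes "contracted_orbit 0 n = contracted_orbit 1 m"
  shows "volterra_shift g f [^]\<^bsub>Jac g f\<^esub> (2 * (m - n) + 1) = \<one>\<^bsub>Jac g f\<^esub>"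
proof -
  interpret J: group "Jac g f" by (rule dom.group_Jac)
  let ?i = "2 * n - 2" and ?k = "2 * m - 1"
  have "cP ?i = cP ?k" "cQ ?i = cQ ?k" using assms by (simp_all add: contracted_orbit_def)
  note eq = contracted_states_eq[OF this]
  have "root_divisor (P ?i) (Q ?i) = root_divisor (P ?k) (Q ?k)"
    unfolding eq(1)
  proof (rule root_divisor_cong)
    fix a assume "poly (Q ?k) a = 0"
    then show "poly (P ?i) a = poly (P ?k) a" using eq(2)[of a] eq(1) by simp
  qed
  then have "volterra_class g f (T ?i) = volterra_class g f (T ?k)"
    by (simp add: T_eq[of ?i] T_eq[of ?k] volterra_class_def)
  then have "volterra_shift g f [^]\<^bsub>Jac g f\<^esub> (?k - ?i) = \<one>\<^bsub>Jac g f\<^esub>"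
    using volterra_translation
    by (intro J.translation_orbit_period[where c = "\<lambda>n. volterra_class g f (T n)"])
      (simp_all add: volterra_shift_carrier translation_def)
  then show ?thesis by (simp add: algebra_simps)
qed

end

theorem theorem5p10:
  fixes g :: nat and c :: "nat \<Rightarrow> complex" and f :: "complex poly" and \<sigma> :: complex
  assumes "g \<ge> 1"
    and "f = 1 + (\<Sum>i=1..2*g+1. monom (c i) i)"
    and "c (2 * g + 1) \<noteq> 0"
    and "squarefree f"
    and "\<sigma> = c 1 / (2 * (of_nat g + 1))"
  shows "\<exists>chat F A R.
    F = monom 1 (2 * g + 2) + (\<Sum>j=2..2*g+2. monom (chat j) (2 * g + 2 - j)) \<and>
    squarefree F \<and> jfrac_curve g F A R \<and>
    \<comment> \<open>every generic Volterra orbit contracts to two different J-fraction orbits\<close>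
    (\<forall>T. generic_volterra_orbit g f T \<longrightarrow>
       s_fraction f T \<and>
       (\<exists>u0 S0 u1 S1.
          jfrac_orbit g F A u0 S0 \<and> contraction g f A \<sigma> 0 T u0 S0 \<and>
          jfrac_orbit g F A u1 S1 \<and> contraction g f A \<sigma> 1 T u1 S1 \<and>
          (\<forall>n. S0 n \<noteq> S1 n) \<and>
          \<comment> \<open>they have a common state only if the Volterra translation has odd finite order\<close>
          (\<forall>n m. S0 n = S1 m \<longrightarrow>
             volterra_shift g f [^]\<^bsub>Jac g f\<^esub> (2 * (m - n) + 1) = \<one>\<^bsub>Jac g f\<^esub>))) \<and>
    \<comment> \<open>the birational equivalence, and the translations on the Jacobians\<close>
    birational_equivalence f F (curve_map g \<sigma>) \<and>
    (\<forall>T. generic_volterra_orbit g f T \<longrightarrow>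
       (\<forall>n. volterra_class g f (T n) \<in> carrier (Jac g f) \<and>
            volterra_class g f (T (n + 1)) =
              translation (Jac g f) (volterra_shift g f) (volterra_class g f (T n)))) \<and>
    (\<forall>u S. jfrac_orbit g F A u S \<longrightarrow>
       (\<forall>n. jfrac_class g F (S n) \<in> carrier (Jac g F) \<and>
            jfrac_class g F (S (n + 1)) =
              translation (Jac g F) (jfrac_shift g F) (jfrac_class g F (S n)))) \<and>
    (\<exists>\<Phi> \<psi>. extends_to_completion g f F (curve_map g \<sigma>) \<Phi> \<and>
       \<psi> \<in> iso (Jac g f) (Jac g F) \<and>
       (\<forall>D\<in>carrier (div0_group g f).
          \<psi> (jac_class g f D) = jac_class g F (push_divisor \<Phi> D)) \<and>
       volterra_shift g f \<in> carrier (Jac g f) \<and> jfrac_shift g F \<in> carrier (Jac g F) \<and>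
       (\<forall>z\<in>carrier (Jac g f).
          \<psi> (translation (Jac g f) (volterra_shift g f)
                (translation (Jac g f) (volterra_shift g f) z)) =
          translation (Jac g F) (jfrac_shift g F) (\<psi> z)))"
proof -
  have coeff_f: "coeff f i = (if i = 0 then 1 else if i \<le> 2 * g + 1 then c i else 0)" for i
    unfolding assms(2) by (auto simp: coeff_sum coeff_1)
  have "degree f = 2 * g + 1"
    using assms(3) by (intro antisym degree_le le_degree) (auto simp: coeff_f)
  define F where "F = pcompose (recip (2 * g + 2) f) [:- \<sigma>, 1:]"
  interpret odd_even_pair g f \<sigma> F
    using assms(4) \<open>degree f = _\<close> by unfold_locales (simp_all add: coeff_f F_def)
  have \<sigma>: "\<sigma> = coeff f 1 / (2 * (of_nat g + 1))" using assms(5) by (simp add: coeff_f)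
  obtain A R where AR: "jfrac_curve g F A R" using ex_jfrac_curve[OF \<sigma>] by blast
  interpret jfrac_pair g f \<sigma> F A R
    by unfold_locales (use AR assms(1) in auto)
  \<comment> \<open>The coefficients \<open>chat j\<close> are those of \<open>F\<close> read from
    the top. The sum reaches only up to \<open>X^(2g)\<close>; the missing term in
    \<open>X^(2g+1)\<close> vanishes by the choice of \<open>\<sigma>\<close>.\<close>
  have F: "F = monom 1 (2 * g + 2) + (\<Sum>j=2..2*g+2. monom (coeff F (2 * g + 2 - j)) (2 * g + 2 - j))"
  proof (rule poly_eqI)
    fix k
    have "(\<Sum>j=2..2*g+2. coeff (monom (coeff F (2 * g + 2 - j)) (2 * g + 2 - j)) k) =
        (\<Sum>j=2..2*g+2. if j = 2 * g + 2 - k \<and> k \<le> 2 * g + 2 then coeff F k else 0)"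
      by (intro sum.cong) auto
    also have "\<dots> = (if k \<le> 2 * g then coeff F k else 0)"
      by (cases "k \<le> 2 * g + 2") auto
    also have "\<dots> = coeff F k - coeff (monom 1 (2 * g + 2)) k"
    proof -
      consider "k \<le> 2 * g" | "k = 2 * g + 1" | "k = 2 * g + 2" | "2 * g + 2 < k" by linarith
      then show ?thesis
        using coeff_F_subleading[OF \<sigma>] lead_coeff_F degree_F by cases (auto simp: coeff_eq_0)
    qed
    finally have s: "(\<Sum>j=2..2*g+2. coeff (monom (coeff F (2 * g + 2 - j)) (2 * g + 2 - j)) k) =
        coeff F k - coeff (monom 1 (2 * g + 2)) k" .
    show "coeff F k = coeff (monom 1 (2 * g + 2) +
        (\<Sum>j=2..2*g+2. monom (coeff F (2 * g + 2 - j)) (2 * g + 2 - j))) k"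
      unfolding coeff_add coeff_sum s by simp
  qed
  have orbits: "volterra_orbit g f \<sigma> F A R T" if "generic_volterra_orbit g f T" for T
    by unfold_locales (rule that)
  show ?thesis
  proof (intro exI conjI)
    show "F = monom 1 (2 * g + 2) + (\<Sum>j=2..2*g+2. monom (coeff F (2 * g + 2 - j)) (2 * g + 2 - j))"
      by (rule F)
    show "squarefree F" by (rule squarefree_F)
    show "jfrac_curve g F A R" by (rule AR)
    show "\<forall>T. generic_volterra_orbit g f T \<longrightarrow> s_fraction f T \<and>
       (\<exists>u0 S0 u1 S1.
          jfrac_orbit g F A u0 S0 \<and> contraction g f A \<sigma> 0 T u0 S0 \<and>
          jfrac_orbit g F A u1 S1 \<and> contraction g f A \<sigma> 1 T u1 S1 \<and>
          (\<forall>n. S0 n \<noteq> S1 n) \<and>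
          (\<forall>n m. S0 n = S1 m \<longrightarrow>
             volterra_shift g f [^]\<^bsub>Jac g f\<^esub> (2 * (m - n) + 1) = \<one>\<^bsub>Jac g f\<^esub>))"
    proof (intro allI impI)
      fix T assume "generic_volterra_orbit g f T"
      then interpret volterra_orbit g f \<sigma> F A R T by (rule orbits)
      show "s_fraction f T \<and>
       (\<exists>u0 S0 u1 S1.
          jfrac_orbit g F A u0 S0 \<and> contraction g f A \<sigma> 0 T u0 S0 \<and>
          jfrac_orbit g F A u1 S1 \<and> contraction g f A \<sigma> 1 T u1 S1 \<and>
          (\<forall>n. S0 n \<noteq> S1 n) \<and>
          (\<forall>n m. S0 n = S1 m \<longrightarrow>
             volterra_shift g f [^]\<^bsub>Jac g f\<^esub> (2 * (m - n) + 1) = \<one>\<^bsub>Jac g f\<^esub>))"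
        using s_fraction contraction_exists[of 0] contraction_exists[of 1]
          contracted_orbits_differ contracted_orbits_meet by blast
    qed
    show "birational_equivalence f F (curve_map g \<sigma>)" by (rule birational_curve_map)
    show "\<forall>T. generic_volterra_orbit g f T \<longrightarrow>
       (\<forall>n. volterra_class g f (T n) \<in> carrier (Jac g f) \<and>
            volterra_class g f (T (n + 1)) =
              translation (Jac g f) (volterra_shift g f) (volterra_class g f (T n)))"
      using volterra_orbit.volterra_translation[OF orbits] by blast
    show "\<forall>u S. jfrac_orbit g F A u S \<longrightarrow>
       (\<forall>n. jfrac_class g F (S n) \<in> carrier (Jac g F) \<and>
            jfrac_class g F (S (n + 1)) =
              translation (Jac g F) (jfrac_shift g F) (jfrac_class g F (S n)))"
      using jfrac_translation by blast
    show "extends_to_completion g f F (curve_map g \<sigma>) point_map"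
      by (rule extends_to_completion_curve_map)
    show "jac_map \<in> iso (Jac g f) (Jac g F)" by (rule jac_map_iso)
    show "\<forall>D\<in>carrier (div0_group g f).
        jac_map (jac_class g f D) = jac_class g F (push_divisor point_map D)"
      by (intro ballI jac_map_class)
    show "volterra_shift g f \<in> carrier (Jac g f)" by (rule volterra_shift_carrier)
    show "jfrac_shift g F \<in> carrier (Jac g F)" by (rule jfrac_shift_carrier)
    show "\<forall>z\<in>carrier (Jac g f).
        jac_map (translation (Jac g f) (volterra_shift g f)
          (translation (Jac g f) (volterra_shift g f) z)) =
        translation (Jac g F) (jfrac_shift g F) (jac_map z)"
      by (intro ballI jac_map_double_translation)
  qed
qed

end
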